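(* Let $Z\subset\mathbb{Q}$ be a subset that is not thin in $\mathbb{Q}$. For $A\subseteq\overline{\mathbb{Q}}$ and a subfield $L\subseteq\overline{\mathbb{Q}}$ write $A_L=A\cap L$. Then the set $$S_Z=\bigcup_{A\subseteq\overline{\mathbb{Q}}\,:\,A\cap\mathbb{Q}=Z}\{L\in\operatorname{Sub}(\overline{\mathbb{Q}}) : A_L\text{ is coinfinite in }L\text{ and universally definable in }L\}$$ is meager in $\operatorname{Sub}(\overline{\mathbb{Q}})$. (Equivalently, $S_Z$ is the set of $L\in\operatorname{Sub}(\overline{\mathbb{Q}})$ such that some $C\subseteq L$ with $L\setminus C$ infinite is universally definable in $L$ and satisfies $C\cap\mathbb{Q}=Z$.)
   Context: $\operatorname{Sub}(\overline{\mathbb{Q}})$ is the set of all subfields of a fixed algebraic closure $\overline{\mathbb{Q}}$ of $\mathbb{Q}$. It is regarded as a subset of the power set $2^{\overline{\mathbb{Q}}}$ (identifying subsets with characteristic functions) and carries the topology inherited from the product topology; a basis is given by the sets $U_{\vec a,\vec b}=\{L : a_1,\dots,a_n\in L,\ b_1,\dots,b_k\notin L\}$ for finite tuples $\vec a,\vec b$ from $\overline{\mathbb{Q}}$. A set is meager if it is a countable union of nowhere dense sets. A subset of $L$ is coinfinite if its complement in $L$ is infinite. Definability: a subset $C\subseteq L$ is universally definable in the field $L$ if it is the set of $x\in L$ satisfying in $L$ a formula $\forall \vec Y\,\phi(X,\vec Y)$, where $\phi$ is a quantifier-free formula in the language of rings with parameters from $L$. Thin sets (Serre): for a field $K$ of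 characteristic $0$ and $n\ge1$, a subset $T\subseteq K^n=\mathbb{A}^n(K)$ is thin if it is contained in a finite union of sets each of which is either (1) $V(K)$ for a proper Zariski-closed $V\subsetneq\mathbb{A}^n_K$, or (2) $\pi(W(K))$, where $W$ is an irreducible $K$-variety of dimension $n$ and $\pi:W\to\mathbb{A}^n_K$ is a dominant morphism of degree at least $2$. *)

theory Defs
  imports
    "HOL-Analysis.Function_Topology"
    "HOL-Algebra.Algebraic_Closure_Type"
    "HOL-Algebra.Generated_Fields"
    "HOL-Library.Poly_Mapping"
begin

text \<open>The type \<^typ>\<open>rat alg_closure\<close> serves as the fixed algebraic closure of the rationals;
  inside it \<open>\<rat>\<close> is the image of \<^const>\<open>of_rat\<close>.\<close>

section \<open>The space of subfields\<close>

definition Sub :: "'a::field set set" where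
  "Sub = {L. subfield L ring_of_type_algebra}"

text \<open>A set is identified with its characteristic function, an element of the product of
  copies of the discrete two-point space.\<close>

definition Sub_topology :: "'a::field set topology" where
  "Sub_topology =
     pullback_topology Sub (\<lambda>L x. x \<in> L) (product_topology (\<lambda>_. discrete_topology (UNIV :: bool set)) UNIV)"

definition nowhere_dense_in :: "'a topology \<Rightarrow> 'a set \<Rightarrow> bool" where
  "nowhere_dense_in T N \<longleftrightarrow>
     N \<subseteq> topspace T \<and> T interior_of (Abstract_Topology.closure_of T N) = {}"

definition meager_in :: "'a topology \<Rightarrow> 'a set \<Rightarrow> bool" where
  "meager_in T S \<longleftrightarrow> (\<exists>\<N>. countable \<N> \<and> (\<forall>N\<in>\<N>. nowhere_dense_in T N) \<and> S = \<Union>\<N>)"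


section \<open>Universal definability\<close>

datatype 'a rterm =
    Var nat
  | Par 'a
  | Zero
  | One
  | Plus "'a rterm" "'a rterm"
  | Minus "'a rterm"
  | Times "'a rterm" "'a rterm"

datatype 'a qfform =
    Equal "'a rterm" "'a rterm"
  | Neg "'a qfform"
  | Conj "'a qfform" "'a qfform"
  | Disj "'a qfform" "'a qfform"

primrec tvars :: "'a rterm \<Rightarrow> nat set" where
  "tvars (Var i) = {i}"
| "tvars (Par a) = {}"
| "tvars Zero = {}"
| "tvars One = {}"
| "tvars (Plus s t) = tvars s \<union> tvars t"
| "tvars (Minus t) = tvars t"
| "tvars (Times s t) = tvars s \<union> tvars t"

primrec fvars :: "'a qfform \<Rightarrow> nat set" where
  "fvars (Equal s t) = tvars s \<union> tvars t"
| "fvars (Neg p) = fvars p"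
| "fvars (Conj p q) = fvars p \<union> fvars q"
| "fvars (Disj p q) = fvars p \<union> fvars q"

primrec tval :: "(nat \<Rightarrow> 'a::field) \<Rightarrow> 'a rterm \<Rightarrow> 'a" where
  "tval e (Var i) = e i"
| "tval e (Par a) = a"
| "tval e Zero = 0"
| "tval e One = 1"
| "tval e (Plus s t) = tval e s + tval e t"
| "tval e (Minus t) = - tval e t"
| "tval e (Times s t) = tval e s * tval e t"

primrec sat :: "(nat \<Rightarrow> 'a::field) \<Rightarrow> 'a qfform \<Rightarrow> bool" where
  "sat e (Equal s t) \<longleftrightarrow> tval e s = tval e t"
| "sat e (Neg p) \<longleftrightarrow> \<not> sat e p"
| "sat e (Conj p q) \<longleftrightarrow> sat e p \<and> sat e q"
| "sat e (Disj p q) \<longleftrightarrow> sat e p \<or> sat e q"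

text \<open>The set of parameters of a formula \<open>\<phi>\<close> is \<open>set_qfform \<phi>\<close>. Variable \<open>0\<close> plays the role of
  \<open>X\<close>, the variables \<open>1, \<dots>, k\<close> those of \<open>Y\<close>. A quantifier-free formula with parameters in the
  subfield \<open>L\<close>, evaluated at elements of \<open>L\<close>, holds in \<open>L\<close> iff it holds in the ambient field, so
  only the universally quantified variables have to be relativised to \<open>L\<close>.\<close>

definition universally_definable_in :: "'a::field set \<Rightarrow> 'a set \<Rightarrow> bool" where
  "universally_definable_in L C \<longleftrightarrow>
     (\<exists>\<phi> k. set_qfform \<phi> \<subseteq> L \<and> fvars \<phi> \<subseteq> {..k} \<and>
        C = {x\<in>L. \<forall>ys. length ys = k \<and> set ys \<subseteq> L \<longrightarrow> sat (\<lambda>i. (x # ys) ! i) \<phi>})"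


section \<open>Polynomials and affine varieties\<close>

text \<open>The polynomial ring \<open>K[x\<^sub>0, \<dots>, x\<^sub>m\<^sub>-\<^sub>1]\<close>, a monomial being its exponent function.\<close>

type_synonym 'k mpoly = "(nat \<Rightarrow>\<^sub>0 nat) \<Rightarrow>\<^sub>0 'k"

definition mpoly_ring :: "nat \<Rightarrow> 'k::field mpoly ring" where
  "mpoly_ring m = \<lparr>carrier = {p. \<forall>t\<in>Poly_Mapping.keys p. Poly_Mapping.keys t \<subseteq> {..<m}},
     monoid.mult = (*), one = 1, zero = 0, add = (+)\<rparr>"

abbreviation mconst :: "'k::field \<Rightarrow> 'k mpoly" where
  "mconst c \<equiv> Poly_Mapping.single 0 c"

text \<open>Evaluation at the point \<open>x\<close> with coordinates in a \<open>K\<close>-algebra with structure map \<open>h\<close>.\<close>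

definition mpeval :: "('k::field \<Rightarrow> 'a::comm_ring_1) \<Rightarrow> (nat \<Rightarrow> 'a) \<Rightarrow> 'k mpoly \<Rightarrow> 'a" where
  "mpeval h x p = (\<Sum>t\<in>Poly_Mapping.keys p. h (Poly_Mapping.lookup p t) *
     (\<Prod>i\<in>Poly_Mapping.keys t. x i ^ Poly_Mapping.lookup t i))"

definition affine_space :: "nat \<Rightarrow> (nat \<Rightarrow> 'a) set" where
  "affine_space n = {..<n} \<rightarrow>\<^sub>E UNIV"

text \<open>The \<open>F\<close>-points of the closed subvariety of affine \<open>n\<close>-space cut out by \<open>E\<close>, where
  \<open>h : K \<rightarrow> F\<close>. We use this with \<open>h = id\<close> for \<open>K\<close>-points and with \<open>h = to_ac\<close> for geometric points.\<close>

definition zero_locus :: "('k::field \<Rightarrow> 'a::field) \<Rightarrow> nat \<Rightarrow> 'k mpoly set \<Rightarrow> (nat \<Rightarrow> 'a) set" where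
  "zero_locus h n E = {x \<in> affine_space n. \<forall>p\<in>E. mpeval h x p = 0}"

definition poly_image ::
    "('k::field \<Rightarrow> 'a::field) \<Rightarrow> nat \<Rightarrow> (nat \<Rightarrow> 'k mpoly) \<Rightarrow> (nat \<Rightarrow> 'a) set \<Rightarrow> (nat \<Rightarrow> 'a) set" where
  "poly_image h n f S = (\<lambda>x. \<lambda>i\<in>{..<n}. mpeval h x (f i)) ` S"


section \<open>Function fields\<close>

definition fraction :: "('a, 'b) ring_scheme \<Rightarrow> 'a \<Rightarrow> 'a \<Rightarrow> ('a \<times> 'a) set" where
  "fraction R a b = {(c, d). c \<in> carrier R \<and> d \<in> carrier R - {\<zero>\<^bsub>R\<^esub>} \<and> a \<otimes>\<^bsub>R\<^esub> d = c \<otimes>\<^bsub>R\<^esub> b}"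

definition fraction_field :: "('a, 'b) ring_scheme \<Rightarrow> ('a \<times> 'a) set ring" where
  "fraction_field R =
    \<lparr>carrier = {fraction R a b |a b. a \<in> carrier R \<and> b \<in> carrier R - {\<zero>\<^bsub>R\<^esub>}},
     monoid.mult = (\<lambda>u v. \<Union>(a, b)\<in>u. \<Union>(c, d)\<in>v. fraction R (a \<otimes>\<^bsub>R\<^esub> c) (b \<otimes>\<^bsub>R\<^esub> d)),
     one = fraction R \<one>\<^bsub>R\<^esub> \<one>\<^bsub>R\<^esub>,
     zero = fraction R \<zero>\<^bsub>R\<^esub> \<one>\<^bsub>R\<^esub>,
     add = (\<lambda>u v. \<Union>(a, b)\<in>u. \<Union>(c, d)\<in>v.
              fraction R (a \<otimes>\<^bsub>R\<^esub> d \<oplus>\<^bsub>R\<^esub> c \<otimes>\<^bsub>R\<^esub> b) (b \<otimes>\<^bsub>R\<^esub> d))\<rparr>"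

text \<open>An irreducible closed subvariety \<open>W\<close> of affine \<open>m\<close>-space over \<open>K\<close> is given by its prime
  ideal \<open>P\<close>; \<open>K[W]\<close> is the quotient by \<open>P\<close>, and \<open>K(W)\<close> its fraction field. The function
  \<open>regular_fun m P p\<close> is the polynomial \<open>p\<close> viewed as an element of \<open>K(W)\<close>.\<close>

definition coordinate_ring :: "nat \<Rightarrow> 'k::field mpoly set \<Rightarrow> 'k mpoly set ring" where
  "coordinate_ring m P = mpoly_ring m Quot P"

definition function_field ::
    "nat \<Rightarrow> 'k::field mpoly set \<Rightarrow> ('k mpoly set \<times> 'k mpoly set) set ring" where
  "function_field m P = fraction_field (coordinate_ring m P)"

definition regular_fun ::
    "nat \<Rightarrow> 'k::field mpoly set \<Rightarrow> 'k mpoly \<Rightarrow> ('k mpoly set \<times> 'k mpoly set) set" where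
  "regular_fun m P p =
     fraction (coordinate_ring m P) (P +>\<^bsub>mpoly_ring m\<^esub> p) \<one>\<^bsub>coordinate_ring m P\<^esub>"

definition constant_funs :: "nat \<Rightarrow> 'k::field mpoly set \<Rightarrow> ('k mpoly set \<times> 'k mpoly set) set set" where
  "constant_funs m P = range (\<lambda>c. regular_fun m P (mconst c))"

definition transcendence_basis :: "('a, 'b) ring_scheme \<Rightarrow> 'a set \<Rightarrow> 'a set \<Rightarrow> bool" where
  "transcendence_basis F K B \<longleftrightarrow> B \<subseteq> carrier F \<and>
     (\<forall>b\<in>B. (ring.transcendental F over generate_field F (K \<union> (B - {b}))) b) \<and>
     (\<forall>x\<in>carrier F. (ring.algebraic F over generate_field F (K \<union> B)) x)"

text \<open>The dimension of \<open>W\<close> is the transcendence degree of \<open>K(W)\<close> over \<open>K\<close>.\<close>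

definition has_dimension :: "nat \<Rightarrow> 'k::field mpoly set \<Rightarrow> nat \<Rightarrow> bool" where
  "has_dimension m P n \<longleftrightarrow>
     (\<exists>B. finite B \<and> card B = n \<and>
        transcendence_basis (function_field m P) (constant_funs m P) B)"

text \<open>The morphism from \<open>W\<close> to affine \<open>n\<close>-space with components \<open>f 0, \<dots>, f (n - 1)\<close> is dominant:
  the image of \<open>W\<close> (in geometric points) is Zariski dense.\<close>

definition dominant :: "nat \<Rightarrow> 'k::field mpoly set \<Rightarrow> nat \<Rightarrow> (nat \<Rightarrow> 'k mpoly) \<Rightarrow> bool" where
  "dominant m P n f \<longleftrightarrow>
     (\<forall>E \<subseteq> carrier (mpoly_ring n).
        poly_image to_ac n f (zero_locus to_ac m P) \<subseteq> zero_locus to_ac n E \<longrightarrow>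
        zero_locus to_ac n E = affine_space n)"

text \<open>The degree of a dominant morphism to affine \<open>n\<close>-space is the degree of \<open>K(W)\<close> over the
  pulled back function field \<open>K(f\<^sub>0, \<dots>, f\<^sub>n\<^sub>-\<^sub>1)\<close> of affine space.\<close>

definition has_degree :: "nat \<Rightarrow> 'k::field mpoly set \<Rightarrow> nat \<Rightarrow> (nat \<Rightarrow> 'k mpoly) \<Rightarrow> nat \<Rightarrow> bool" where
  "has_degree m P n f d \<longleftrightarrow>
     (ring.dimension (function_field m P) d
       over generate_field (function_field m P)
              (constant_funs m P \<union> (\<lambda>i. regular_fun m P (f i)) ` {..<n}))
       (carrier (function_field m P))"


section \<open>Thin sets\<close>

definition thin_type1 :: "nat \<Rightarrow> (nat \<Rightarrow> 'k::field_char_0) set \<Rightarrow> bool" where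
  "thin_type1 n T \<longleftrightarrow>
     (\<exists>E. E \<subseteq> carrier (mpoly_ring n) \<and> zero_locus to_ac n E \<noteq> affine_space n \<and>
        T = zero_locus id n E)"

text \<open>It suffices to consider affine \<open>W\<close>: an arbitrary irreducible variety of dimension \<open>n\<close>
  with a dominant morphism of degree \<open>d\<close> to affine \<open>n\<close>-space is a finite union of nonempty open
  affine subvarieties, which are irreducible of dimension \<open>n\<close> and on which the morphism is again
  dominant of degree \<open>d\<close>; and thinness allows finite unions.\<close>

definition thin_type2 :: "nat \<Rightarrow> (nat \<Rightarrow> 'k::field_char_0) set \<Rightarrow> bool" where
  "thin_type2 n T \<longleftrightarrow>
     (\<exists>m P f d. primeideal P (mpoly_ring m) \<and> has_dimension m P n \<and>
        (\<forall>i<n. f i \<in> carrier (mpoly_ring m)) \<and> dominant m P n f \<and>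
        has_degree m P n f d \<and> d \<ge> 2 \<and>
        T = poly_image id n f (zero_locus id m P))"

definition thin :: "nat \<Rightarrow> (nat \<Rightarrow> 'k::field_char_0) set \<Rightarrow> bool" where
  "thin n T \<longleftrightarrow> T \<subseteq> affine_space n \<and>
     (\<exists>\<T>. finite \<T> \<and> (\<forall>V\<in>\<T>. thin_type1 n V \<or> thin_type2 n V) \<and> T \<subseteq> \<Union>\<T>)"

text \<open>Subsets of \<open>K\<close> are regarded as subsets of the affine line.\<close>

definition thin_in_field :: "'k::field_char_0 set \<Rightarrow> bool" where
  "thin_in_field Z \<longleftrightarrow> thin 1 ((\<lambda>z. \<lambda>i\<in>{..<1}. z) ` Z)"


section \<open>The sets in question\<close>

definition S_set :: "rat set \<Rightarrow> rat alg_closure set set" where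
  "S_set Z = (\<Union>A\<in>{A. A \<inter> \<rat> = of_rat ` Z}.
     {L \<in> Sub. infinite (L - (A \<inter> L)) \<and> universally_definable_in L (A \<inter> L)})"

end

theory Submission
  imports Defs "HOL-Library.Function_Algebras"
begin

text \<open>Baire category reduces the theorem to the following: if an existential formula with
  parameters in \<open>L\<close> has infinitely many solutions in \<open>L\<close>, \<open>C \<subseteq> L\<close> and \<open>B\<close> are finite with \<open>B\<close> disjoint from
  \<open>L\<close>, then some subfield containing \<open>C\<close> and disjoint from \<open>B\<close> contains a solution \<open>z \<in> Z\<close>.

  By Hensel's lemma, the formula is satisfied along an arc \<open>\<eta>\<close> through a sufficiently generic solution
  point, with \<open>X\<close>-coordinate \<open>T = x\<^sub>0 + s\<close>, with coefficients in \<open>L\<close> and with coordinates algebraic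
  over \<open>\<rat>(T)\<close>. Looking at the coefficients of power series, the field \<open>\<rat>(C, T, \<eta>)\<close> does not meet \<open>B\<close>.
  Specialise \<open>T\<close> to \<open>z \<in> \<rat>\<close> and \<open>\<eta>\<close> to algebraic numbers accordingly. For \<open>z\<close> outside a thin set,
  the minimal polynomials over \<open>\<rat>(T)\<close> of finitely many primitive elements stay irreducible over \<open>\<rat>\<close>
  (Hilbert irreducibility), hence the conjugation that witnesses \<open>b \<notin> \<rat>(C, T, \<eta>)\<close> specialises to one that
  witnesses that \<open>b\<close> is not in the specialised field. As \<open>Z\<close> is not thin, we may take \<open>z \<in> Z\<close>.\<close>

section \<open>Subfields and polynomials over them\<close>

text \<open>The obstacle is that the points satisfying the quantifier-free part may form a reducible
  and singular set, so that a generic smooth point would call for dimension theory. An ultrafilter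
  \<open>U\<close> on the solution points replaces it: a relation counts as valid if it holds for
  \<open>U\<close>-almost all points, and in characteristic 0 a relation of least degree has a
  simple root at almost all of them, which is what Hensel's lemma asks for. Infinitely many
  solutions let \<open>U\<close> avoid every single value of the first coordinate; this coordinate
  is then transcendental over \<open>L\<close> and can be moved freely, first by the series variable
  and then to z. Negated equations survive because both passages, from points to series and from T
  to almost all z, preserve vanishing and also non-vanishing of the finitely many atomic terms. Both
  passages rest on the same argument, \<open>relations_transfer_adjoin\<close>. In the Baire step
  the point is that having a given rational solution is an open condition on the field: a solution
  only involves finitely many elements.\<close>

lemma Sub_iff:
  "K \<in> Sub \<longleftrightarrow> 0 \<in> K \<and> 1 \<in> K \<and> (\<forall>x\<in>K. \<forall>y\<in>K. x + y \<in> K) \<and> (\<forall>x\<in>K. \<forall>y\<in>K. x * y \<in> K) \<and>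
     (\<forall>x\<in>K. - x \<in> K) \<and> (\<forall>x\<in>K. inverse x \<in> (K :: 'a::field set))"
proof -
  define R where "R = (ring_of_type_algebra :: 'a ring)"
  interpret R: field R unfolding R_def by (rule field_from_type_algebra)
  have R: "carrier R = UNIV" "\<And>x y. x \<otimes>\<^bsub>R\<^esub> y = x * y" "\<And>x y. x \<oplus>\<^bsub>R\<^esub> y = x + y" "\<one>\<^bsub>R\<^esub> = 1" "\<zero>\<^bsub>R\<^esub> = 0"
    by (simp_all add: R_def ring_of_type_algebra_def)
  have neg: "\<ominus>\<^bsub>R\<^esub> x = - x" for x
    using R.r_neg[of x] R by (simp add: eq_neg_iff_add_eq_0 add.commute)
  have inv: "inv\<^bsub>R\<^esub> x = inverse x" if "x \<noteq> 0" for x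
  proof -
    have "x \<in> Units R" using that by (simp add: R.field_Units R)
    then have "x * inv\<^bsub>R\<^esub> x = 1" using R.Units_r_inv R by metis
    then show ?thesis by (metis inverse_unique)
  qed
  show ?thesis
  proof
    assume "K \<in> Sub"
    then have K: "subfield K R" by (simp add: Sub_def R_def)
    then have s: "subring K R" by (rule subfieldE)
    have "inverse x \<in> K" if "x \<in> K" for x
    proof (cases "x = 0")
      case False
      then show ?thesis using R.subfield_m_inv(1)[OF K, of x] that inv[of x] R by auto
    qed (use that in simp)
    then show "0 \<in> K \<and> 1 \<in> K \<and> (\<forall>x\<in>K. \<forall>y\<in>K. x + y \<in> K) \<and> (\<forall>x\<in>K. \<forall>y\<in>K. x * y \<in> K) \<and>
       (\<forall>x\<in>K. - x \<in> K) \<and> (\<forall>x\<in>K. inverse x \<in> K)"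
      using R.subring_props[OF K] R neg by metis
  next
    assume K: "0 \<in> K \<and> 1 \<in> K \<and> (\<forall>x\<in>K. \<forall>y\<in>K. x + y \<in> K) \<and> (\<forall>x\<in>K. \<forall>y\<in>K. x * y \<in> K) \<and>
       (\<forall>x\<in>K. - x \<in> K) \<and> (\<forall>x\<in>K. inverse x \<in> K)"
    have "subfield K R"
    proof (rule R.subfieldI')
      show "subring K R" by (rule R.subringI) (use K R neg in auto)
      show "inv\<^bsub>R\<^esub> k \<in> K" if "k \<in> K - {\<zero>\<^bsub>R\<^esub>}" for k using that K inv[of k] R by auto
    qed
    then show "K \<in> Sub" by (simp add: Sub_def R_def)
  qed
qed

lemma
  assumes "K \<in> Sub"
  shows Sub_0: "0 \<in> K" and Sub_1: "1 \<in> K"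
    and Sub_add: "x \<in> K \<Longrightarrow> y \<in> K \<Longrightarrow> x + y \<in> K"
    and Sub_mult: "x \<in> K \<Longrightarrow> y \<in> K \<Longrightarrow> x * y \<in> K"
    and Sub_uminus: "x \<in> K \<Longrightarrow> - x \<in> K"
    and Sub_inverse: "x \<in> K \<Longrightarrow> inverse x \<in> K"
    and Sub_diff: "x \<in> K \<Longrightarrow> y \<in> K \<Longrightarrow> x - y \<in> K"
    and Sub_divide: "x \<in> K \<Longrightarrow> y \<in> K \<Longrightarrow> x / y \<in> K"
proof -
  show "0 \<in> K" "1 \<in> K" and add: "x \<in> K \<Longrightarrow> y \<in> K \<Longrightarrow> x + y \<in> K"
    and mult: "x \<in> K \<Longrightarrow> y \<in> K \<Longrightarrow> x * y \<in> K" and um: "x \<in> K \<Longrightarrow> - x \<in> K"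
    and inv: "x \<in> K \<Longrightarrow> inverse x \<in> K" for x y
    using assms unfolding Sub_iff by blast+
  show "x \<in> K \<Longrightarrow> y \<in> K \<Longrightarrow> x - y \<in> K" using add[of x "- y"] um[of y] by simp
  show "x \<in> K \<Longrightarrow> y \<in> K \<Longrightarrow> x / y \<in> K" using mult[of x "inverse y"] inv[of y] by (simp add: divide_inverse)
qed

lemmas Sub_closed = Sub_0 Sub_1 Sub_add Sub_mult Sub_uminus Sub_inverse Sub_diff Sub_divide

lemma Sub_sum: "K \<in> Sub \<Longrightarrow> (\<And>i. i \<in> I \<Longrightarrow> f i \<in> K) \<Longrightarrow> sum f I \<in> K"
  by (induction I rule: infinite_finite_induct) (auto intro: Sub_closed)

lemma Sub_power: "K \<in> Sub \<Longrightarrow> x \<in> K \<Longrightarrow> x ^ n \<in> K"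
  by (induction n) (auto intro: Sub_closed)

lemma Sub_of_nat: "K \<in> Sub \<Longrightarrow> of_nat n \<in> K"
  by (induction n) (auto intro: Sub_closed)

lemma Sub_of_rat: "K \<in> Sub \<Longrightarrow> (of_rat q :: 'a::field_char_0) \<in> K"
proof (cases q)
  case (Fract a b)
  assume K: "K \<in> Sub"
  have "(of_int z :: 'a) \<in> K" for z
    by (cases z) (use K Sub_of_nat[OF K] in \<open>auto intro!: Sub_closed simp del: of_nat_Suc\<close>)
  then show ?thesis using Fract K by (simp add: of_rat_rat Sub_divide)
qed

lemma Rats_subset_Sub: "K \<in> Sub \<Longrightarrow> (\<rat> :: 'a::field_char_0 set) \<subseteq> K"
  using Sub_of_rat by (auto simp: Rats_def)

lemma Rats_in_Sub: "(\<rat> :: 'a::field_char_0 set) \<in> Sub"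
  unfolding Sub_iff by auto

lemma Inter_in_Sub: "\<K> \<subseteq> Sub \<Longrightarrow> \<Inter>\<K> \<in> Sub"
  unfolding Sub_iff subset_iff Inter_iff by blast

section \<open>Generated subfields, subrings and polynomials over them\<close>

definition field_gen :: "'a::field set \<Rightarrow> 'a set" where
  "field_gen S = \<Inter>{K \<in> Sub. S \<subseteq> K}"

lemma field_gen_in_Sub: "field_gen S \<in> Sub"
  unfolding field_gen_def by (rule Inter_in_Sub) auto

lemma field_gen_superset: "S \<subseteq> field_gen S"
  unfolding field_gen_def by auto

lemma field_gen_least: "K \<in> Sub \<Longrightarrow> S \<subseteq> K \<Longrightarrow> field_gen S \<subseteq> K"
  unfolding field_gen_def by auto

lemma field_gen_mono: "S \<subseteq> T \<Longrightarrow> field_gen S \<subseteq> field_gen T"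
  by (meson field_gen_in_Sub field_gen_least field_gen_superset order_trans)

text \<open>Stated for arbitrary commutative rings because it is also used for rings of functions on
  an index set, which have zero divisors, and for rings of power series.\<close>

definition ring_closed :: "'a::comm_ring_1 set \<Rightarrow> bool" where
  "ring_closed A \<longleftrightarrow> 0 \<in> A \<and> 1 \<in> A \<and> (\<forall>x\<in>A. \<forall>y\<in>A. x + y \<in> A) \<and> (\<forall>x\<in>A. \<forall>y\<in>A. x * y \<in> A) \<and>
     (\<forall>x\<in>A. - x \<in> A)"

lemma ring_closed_Sub: "K \<in> Sub \<Longrightarrow> ring_closed K"
  unfolding ring_closed_def Sub_iff by blast

definition polys_over :: "'a::zero set \<Rightarrow> 'a poly set" where
  "polys_over K = {p. \<forall>i. coeff p i \<in> K}"

text \<open>The ring K[x], in general not a field; \<open>adjoin_in_Sub\<close> shows that it is one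
  for \<open>x\<close> algebraic over a subfield.\<close>

definition adjoin :: "'a::comm_ring_1 set \<Rightarrow> 'a \<Rightarrow> 'a set" where
  "adjoin K x = (\<lambda>p. poly p x) ` polys_over K"

lemma polys_over_mono: "K \<subseteq> L \<Longrightarrow> polys_over K \<subseteq> polys_over L"
  by (auto simp: polys_over_def)

lemma coeff_polys_over: "p \<in> polys_over K \<Longrightarrow> coeff p i \<in> K"
  by (auto simp: polys_over_def)

lemma polys_over_pCons: "pCons a p \<in> polys_over K \<longleftrightarrow> a \<in> K \<and> p \<in> polys_over K"
  by (auto simp: polys_over_def coeff_pCons split: nat.splits)

context
  fixes A :: "'a::comm_ring_1 set" assumes A: "ring_closed A"
begin

lemma rc_0: "0 \<in> A" and rc_1: "1 \<in> A"
  and rc_add: "x \<in> A \<Longrightarrow> y \<in> A \<Longrightarrow> x + y \<in> A"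
  and rc_mult: "x \<in> A \<Longrightarrow> y \<in> A \<Longrightarrow> x * y \<in> A"
  and rc_uminus: "x \<in> A \<Longrightarrow> - x \<in> A"
  using A unfolding ring_closed_def by blast+

lemma rc_diff: "x \<in> A \<Longrightarrow> y \<in> A \<Longrightarrow> x - y \<in> A"
  using rc_add[of x "- y"] rc_uminus[of y] by simp

lemma rc_sum: "(\<And>i. i \<in> I \<Longrightarrow> f i \<in> A) \<Longrightarrow> sum f I \<in> A"
  by (induction I rule: infinite_finite_induct) (auto intro: rc_0 rc_add)

lemma rc_of_nat: "of_nat n \<in> A"
  by (induction n) (auto intro: rc_0 rc_1 rc_add)

lemma rc_polys_0: "0 \<in> polys_over A"
  and rc_polys_1: "1 \<in> polys_over A"
  using rc_0 rc_1 by (auto simp: polys_over_def)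

lemma rc_polys_add: "p \<in> polys_over A \<Longrightarrow> q \<in> polys_over A \<Longrightarrow> p + q \<in> polys_over A"
  and rc_polys_diff: "p \<in> polys_over A \<Longrightarrow> q \<in> polys_over A \<Longrightarrow> p - q \<in> polys_over A"
  and rc_polys_uminus: "p \<in> polys_over A \<Longrightarrow> - p \<in> polys_over A"
  and rc_polys_smult: "a \<in> A \<Longrightarrow> p \<in> polys_over A \<Longrightarrow> smult a p \<in> polys_over A"
  using rc_add rc_diff rc_uminus rc_mult by (auto simp: polys_over_def)

lemma rc_polys_mult: "p \<in> polys_over A \<Longrightarrow> q \<in> polys_over A \<Longrightarrow> p * q \<in> polys_over A"
  by (auto simp: polys_over_def coeff_mult intro!: rc_sum rc_mult)

lemma rc_polys_monom: "a \<in> A \<Longrightarrow> monom a n \<in> polys_over A"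
  using rc_0 by (auto simp: polys_over_def)

lemma rc_poly: "p \<in> polys_over A \<Longrightarrow> x \<in> A \<Longrightarrow> poly p x \<in> A"
  by (induction p) (auto simp: polys_over_pCons intro: rc_0 rc_add rc_mult)

lemma rc_pcompose: "p \<in> polys_over A \<Longrightarrow> q \<in> polys_over A \<Longrightarrow> pcompose p q \<in> polys_over A"
  by (induction p)
     (auto simp: polys_over_pCons pcompose_pCons rc_polys_0 intro!: rc_polys_add rc_polys_mult)

lemma subset_adjoin_rc: "A \<subseteq> adjoin A x"
proof
  fix a assume "a \<in> A"
  then show "a \<in> adjoin A x" unfolding adjoin_def
    by (intro image_eqI[of _ _ "[:a:]"]) (auto simp: polys_over_pCons rc_polys_0)
qed

lemma in_adjoin_rc: "x \<in> adjoin A x"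
  unfolding adjoin_def
  by (rule image_eqI[of _ _ "[:0,1:]"]) (auto simp: polys_over_pCons rc_polys_0 rc_1 rc_0)

lemma ring_closed_adjoin: "ring_closed (adjoin A x)"
  unfolding ring_closed_def
proof (intro conjI ballI)
  show "0 \<in> adjoin A x" "1 \<in> adjoin A x" using subset_adjoin_rc rc_0 rc_1 by auto
  fix a assume "a \<in> adjoin A x"
  then obtain p where p: "p \<in> polys_over A" "a = poly p x" by (auto simp: adjoin_def)
  show "- a \<in> adjoin A x" unfolding adjoin_def p
    by (force intro: rc_polys_uminus p simp flip: poly_minus)
  fix b assume "b \<in> adjoin A x"
  then obtain q where q: "q \<in> polys_over A" "b = poly q x" by (auto simp: adjoin_def)
  show "a + b \<in> adjoin A x" "a * b \<in> adjoin A x"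
    unfolding adjoin_def p q
    by (force intro: rc_polys_add rc_polys_mult p q simp flip: poly_add poly_mult)+
qed

end

text \<open>Bounds generated fields by explicit quotients; used for polynomial values at T, for
  images of coordinate rings and for power series over \<open>L\<close>.\<close>

lemma fractions_in_Sub:
  assumes R: "ring_closed (R :: 'a::field set)"
  shows "{a / b |a b. a \<in> R \<and> b \<in> R \<and> b \<noteq> 0} \<in> Sub" (is "?K \<in> Sub")
  unfolding Sub_iff
proof (intro conjI ballI)
  have mem: "a / b \<in> ?K" if "a \<in> R" "b \<in> R" "b \<noteq> 0" for a b using that by blast
  show "0 \<in> ?K" using mem[of 0 1] rc_0[OF R] rc_1[OF R] by simp
  show "1 \<in> ?K" using mem[of 1 1] rc_1[OF R] by simp
  fix x assume "x \<in> ?K"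
  then obtain a b where x: "x = a / b" "a \<in> R" "b \<in> R" "b \<noteq> 0" by blast
  show "- x \<in> ?K" using mem[of "- a" b] rc_uminus[OF R] x by simp
  show "inverse x \<in> ?K" using mem[of b a] \<open>0 \<in> ?K\<close> x by (cases "a = 0") auto
  fix y assume "y \<in> ?K"
  then obtain c d where y: "y = c / d" "c \<in> R" "d \<in> R" "d \<noteq> 0" by blast
  show "x * y \<in> ?K" using mem[of "a * c" "b * d"] rc_mult[OF R] x y by simp
  have "x + y = (a * d + c * b) / (b * d)" using x y by (simp add: add_frac_eq)
  then show "x + y \<in> ?K" using mem[of "a * d + c * b" "b * d"] rc_mult[OF R] rc_add[OF R] x y by simp
qed

lemmas polys_over_0 = rc_polys_0[OF ring_closed_Sub]
  and polys_over_1 = rc_polys_1[OF ring_closed_Sub]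
  and polys_over_add = rc_polys_add[OF ring_closed_Sub]
  and polys_over_diff = rc_polys_diff[OF ring_closed_Sub]
  and polys_over_uminus = rc_polys_uminus[OF ring_closed_Sub]
  and polys_over_smult = rc_polys_smult[OF ring_closed_Sub]
  and polys_over_mult = rc_polys_mult[OF ring_closed_Sub]
  and polys_over_monom = rc_polys_monom[OF ring_closed_Sub]
  and poly_polys_over = rc_poly[OF ring_closed_Sub]
  and polys_over_pcompose = rc_pcompose[OF ring_closed_Sub]
  and subset_adjoin = subset_adjoin_rc[OF ring_closed_Sub]
  and in_adjoin = in_adjoin_rc[OF ring_closed_Sub]

context
  fixes K :: "'a::field set" assumes K: "K \<in> Sub"
begin

lemma polys_over_pderiv: "p \<in> polys_over K \<Longrightarrow> pderiv p \<in> polys_over K"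
  unfolding polys_over_def mem_Collect_eq coeff_pderiv by (intro allI Sub_mult[OF K] Sub_of_nat[OF K]) simp

text \<open>Long division: each step divides only by the leading coefficient of \<open>g\<close>, so
  the coefficients never leave \<open>K\<close>.\<close>

lemma polys_over_divmod:
  assumes p: "p \<in> polys_over K" and g: "g \<in> polys_over K" "g \<noteq> 0"
  shows "\<exists>q r. q \<in> polys_over K \<and> r \<in> polys_over K \<and> p = g * q + r \<and> (r = 0 \<or> degree r < degree g)"
  using p
proof (induction "degree p" arbitrary: p rule: less_induct)
  case less
  show ?case
  proof (cases "p = 0 \<or> degree p < degree g")
    case True
    then show ?thesis using less.prems polys_over_0[OF K] by (intro exI[of _ 0] exI[of _ p]) auto
  next
    case False
    define t where "t = monom (lead_coeff p / lead_coeff g) (degree p - degree g)"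
    have t: "t \<in> polys_over K" unfolding t_def
      using less.prems g by (intro polys_over_monom[OF K] Sub_divide[OF K] coeff_polys_over)
    define p' where "p' = p - g * t"
    have p': "p' \<in> polys_over K" unfolding p'_def
      using less.prems g t by (intro polys_over_diff[OF K] polys_over_mult[OF K])
    have "degree p' < degree p \<or> p' = 0"
    proof (cases "p' = 0")
      case False
      have t0: "t \<noteq> 0" using \<open>\<not> (p = 0 \<or> degree p < degree g)\<close> g by (simp add: t_def)
      have dt: "degree (g * t) = degree p"
        using \<open>\<not> (p = 0 \<or> degree p < degree g)\<close> g t0
        by (simp add: degree_mult_eq) (simp add: t_def degree_monom_eq)
      have "lead_coeff (g * t) = lead_coeff p"
        using g t0 \<open>\<not> (p = 0 \<or> degree p < degree g)\<close>
        by (subst lead_coeff_mult) (simp add: t_def degree_monom_eq)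
      then have "coeff p' (degree p) = 0" using dt by (simp add: p'_def)
      moreover have "degree p' \<le> degree p" unfolding p'_def using dt by (metis degree_diff_le order.refl)
      ultimately show ?thesis using False eq_zero_or_degree_less by blast
    qed simp
    then obtain q r where qr: "q \<in> polys_over K" "r \<in> polys_over K" "p' = g * q + r"
        "r = 0 \<or> degree r < degree g"
      using less.hyps[of p'] p' polys_over_0[OF K] by (metis add.right_neutral mult_zero_right)
    then show ?thesis using t
      by (intro exI[of _ "q + t"] exI[of _ r]) (auto simp: p'_def algebra_simps intro: polys_over_add[OF K])
  qed
qed

text \<open>Division with remainder is unique over the ambient field, so its \<open>div\<close> and
  \<open>mod\<close> agree with the quotient and remainder found over \<open>K\<close>.\<close>

lemma polys_over_div: "p \<in> polys_over K \<Longrightarrow> g \<in> polys_over K \<Longrightarrow> p div g \<in> polys_over K"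
  and polys_over_mod: "p \<in> polys_over K \<Longrightarrow> g \<in> polys_over K \<Longrightarrow> p mod g \<in> polys_over K"
proof -
  have *: "p div g \<in> polys_over K \<and> p mod g \<in> polys_over K"
    if p: "p \<in> polys_over K" and g: "g \<in> polys_over K"
  proof (cases "g = 0")
    case True
    then show ?thesis using p polys_over_0[OF K] by simp
  next
    case False
    obtain q r where qr: "q \<in> polys_over K" "r \<in> polys_over K" "p = g * q + r" "r = 0 \<or> degree r < degree g"
      using polys_over_divmod[OF p g False] by blast
    have "r mod g = r" "r div g = 0" using qr(4) by (auto simp: mod_poly_less div_poly_less)
    then have "p mod g = r" "p div g = q" using False by (simp_all add: qr(3))
    then show ?thesis using qr by simp
  qed
  show "p \<in> polys_over K \<Longrightarrow> g \<in> polys_over K \<Longrightarrow> p div g \<in> polys_over K"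
    "p \<in> polys_over K \<Longrightarrow> g \<in> polys_over K \<Longrightarrow> p mod g \<in> polys_over K" using * by auto
qed

end

section \<open>Algebraic elements and minimal polynomials\<close>

definition alg_over :: "'a::field set \<Rightarrow> 'a \<Rightarrow> bool" where
  "alg_over K x \<longleftrightarrow> (\<exists>p\<in>polys_over K. p \<noteq> 0 \<and> poly p x = 0)"

definition min_poly :: "'a::field set \<Rightarrow> 'a \<Rightarrow> 'a poly \<Rightarrow> bool" where
  "min_poly K x m \<longleftrightarrow> m \<in> polys_over K \<and> lead_coeff m = 1 \<and> poly m x = 0 \<and>
     (\<forall>p\<in>polys_over K. p \<noteq> 0 \<longrightarrow> poly p x = 0 \<longrightarrow> degree m \<le> degree p)"

lemma alg_over_mono: "alg_over K x \<Longrightarrow> K \<subseteq> L \<Longrightarrow> alg_over L x"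
  unfolding alg_over_def using polys_over_mono by blast

lemma alg_over_self: "K \<in> Sub \<Longrightarrow> x \<in> K \<Longrightarrow> alg_over K x"
  unfolding alg_over_def
  by (intro bexI[of _ "[:-x, 1:]"]) (auto simp: polys_over_pCons polys_over_0 Sub_1 Sub_uminus)

lemma min_poly_exists:
  assumes K: "K \<in> Sub" and x: "alg_over K x"
  obtains m where "min_poly K x m"
proof -
  define D where "D = {n. \<exists>p\<in>polys_over K. p \<noteq> 0 \<and> poly p x = 0 \<and> degree p = n}"
  have "D \<noteq> {}" using x by (auto simp: D_def alg_over_def)
  then have "Inf D \<in> D" by (rule Inf_nat_def1)
  then obtain p where p: "p \<in> polys_over K" "p \<noteq> 0" "poly p x = 0" "degree p = Inf D"
    by (auto simp: D_def)
  define m where "m = smult (inverse (lead_coeff p)) p"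
  have "min_poly K x m" unfolding min_poly_def
  proof (intro conjI ballI impI)
    show "m \<in> polys_over K" unfolding m_def
      using p K by (intro polys_over_smult Sub_inverse coeff_polys_over)
    show "lead_coeff m = 1" using p(2) by (simp add: m_def)
    show "poly m x = 0" using p(3) by (simp add: m_def)
    fix q assume "q \<in> polys_over K" "q \<noteq> 0" "poly q x = 0"
    then have "degree q \<in> D" by (auto simp: D_def)
    then have "Inf D \<le> degree q" by (rule cInf_lower) auto
    then show "degree m \<le> degree q" using p by (simp add: m_def)
  qed
  then show ?thesis by (rule that)
qed

lemma poly_mod_root:
  fixes p m :: "'a::field poly"
  assumes "poly m x = 0"
  shows "poly (p mod m) x = poly p x"
proof -
  have "poly p x = poly (p div m * m + p mod m) x" by simp
  then show ?thesis using assms by (simp only: poly_add poly_mult) simp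
qed

lemma min_poly_dvd:
  assumes K: "K \<in> Sub" and m: "min_poly K x m" and p: "p \<in> polys_over K" "poly p x = 0"
  shows "m dvd p"
proof -
  have m': "m \<in> polys_over K" "poly m x = 0" "m \<noteq> 0" using m by (auto simp: min_poly_def)
  have "p mod m \<in> polys_over K" using polys_over_mod[OF K p(1)] m' by blast
  moreover have "poly (p mod m) x = 0" using p(2) m'(2) by (simp add: poly_mod_root)
  moreover have "p mod m = 0 \<or> degree (p mod m) < degree m" using degree_mod_less[OF m'(3)] .
  ultimately have "p mod m = 0" using m unfolding min_poly_def by (meson not_le)
  then show ?thesis by (rule dvd_eq_mod_eq_0[THEN iffD2])
qed

text \<open>Inverses come by induction on the degree of \<open>p\<close>: dividing \<open>m\<close>
  by \<open>p\<close> leaves a remainder \<open>r\<close> with r(x) = - p(x) q(x), so an inverse of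
  r(x) yields one of p(x). The remainder is nonzero, since otherwise a proper factor of
  \<open>m\<close> would vanish at \<open>x\<close>.\<close>

lemma adjoin_in_Sub:
  assumes K: "K \<in> Sub" and x: "alg_over K x"
  shows "adjoin K x \<in> Sub"
proof -
  obtain m where m: "min_poly K x m" using min_poly_exists[OF assms] .
  have inv: "\<exists>u\<in>polys_over K. poly u x * poly p x = 1"
    if "p \<in> polys_over K" "p \<noteq> 0" "degree p < degree m" for p
    using that
  proof (induction "degree p" arbitrary: p rule: less_induct)
    case less
    obtain q r where qr: "q \<in> polys_over K" "r \<in> polys_over K" "m = p * q + r"
        "r = 0 \<or> degree r < degree p"
      using polys_over_divmod[OF K _ less.prems(1,2), of m] m by (auto simp: min_poly_def)
    have nz: "poly f x \<noteq> 0" if "f \<in> polys_over K" "f \<noteq> 0" "degree f < degree m" for f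
      using that m unfolding min_poly_def by (meson not_le)
    have m0: "poly m x = 0" "m \<noteq> 0" using m by (auto simp: min_poly_def)
    show ?case
    proof (cases "degree p = 0")
      case True
      then obtain a where a: "p = [:a:]" using degree_eq_zeroE by blast
      show ?thesis
        by (rule bexI[of _ "[:inverse a:]"])
           (use a less.prems K in \<open>auto simp: polys_over_pCons polys_over_0 Sub_inverse\<close>)
    next
      case False
      have "r \<noteq> 0"
      proof
        assume "r = 0"
        then have mpq: "m = p * q" using qr by simp
        then have "q \<noteq> 0" using m0 by auto
        moreover have "degree q < degree m" using mpq False m0 by (auto simp: degree_mult_eq)
        ultimately have "poly q x \<noteq> 0" using nz qr by blast
        then show False using m0 nz[OF less.prems] mpq by simp
      qed
      then obtain u where u: "u \<in> polys_over K" "poly u x * poly r x = 1"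
        using less.hyps[of r] qr less.prems by auto
      have "poly r x = - (poly p x * poly q x)" using m0 qr(3) by (simp add: eq_neg_iff_add_eq_0 add.commute)
      then show ?thesis using u qr K
        by (intro bexI[of _ "- (u * q)"]) (auto simp: algebra_simps intro: polys_over_uminus polys_over_mult)
    qed
  qed
  show ?thesis unfolding Sub_iff
  proof (intro conjI ballI)
    show "0 \<in> adjoin K x" "1 \<in> adjoin K x"
      "\<And>a b. a \<in> adjoin K x \<Longrightarrow> b \<in> adjoin K x \<Longrightarrow> a + b \<in> adjoin K x"
      "\<And>a b. a \<in> adjoin K x \<Longrightarrow> b \<in> adjoin K x \<Longrightarrow> a * b \<in> adjoin K x"
      "\<And>a. a \<in> adjoin K x \<Longrightarrow> - a \<in> adjoin K x"
      using ring_closed_adjoin[OF ring_closed_Sub[OF K], of x] unfolding ring_closed_def by blast+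
    fix a assume "a \<in> adjoin K x"
    then obtain p where p: "p \<in> polys_over K" "a = poly p x" by (auto simp: adjoin_def)
    show "inverse a \<in> adjoin K x"
    proof (cases "a = 0")
      case True
      then show ?thesis using subset_adjoin[OF K] Sub_0[OF K] by auto
    next
      case False
      have m': "m \<in> polys_over K" "m \<noteq> 0" "poly m x = 0" using m by (auto simp: min_poly_def)
      define r where "r = p mod m"
      have "poly r x = a" unfolding r_def p(2) using m'(3) by (rule poly_mod_root)
      moreover have "r \<in> polys_over K" unfolding r_def using polys_over_mod[OF K p(1) m'(1)] .
      moreover have "r \<noteq> 0" using False \<open>poly r x = a\<close> by auto
      moreover have "degree r < degree m" using degree_mod_less[OF m'(2), of p] \<open>r \<noteq> 0\<close> by (simp add: r_def)
      ultimately obtain u where "u \<in> polys_over K" "poly u x * a = 1" using inv by blast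
      then show ?thesis unfolding adjoin_def
        by (intro image_eqI[of _ _ u]) (auto simp: inverse_unique mult.commute)
    qed
  qed
qed

lemma adjoin_least: "L \<in> Sub \<Longrightarrow> K \<subseteq> L \<Longrightarrow> x \<in> L \<Longrightarrow> adjoin K x \<subseteq> L"
  unfolding adjoin_def using poly_polys_over[of L] polys_over_mono[of K L] by blast

text \<open>This imports from HOL-Algebra that sums and products of algebraic elements are algebraic.\<close>

lemma alg_over_iff_algebraic:
  fixes K :: "'a::field set"
  assumes K: "K \<in> Sub"
  shows "alg_over K x \<longleftrightarrow> (ring.algebraic ring_of_type_algebra over K) x"
proof -
  define R where "R = (ring_of_type_algebra :: 'a ring)"
  interpret R: field R unfolding R_def by (rule field_from_type_algebra)
  have R: "carrier R = UNIV" "\<And>x y. x \<otimes>\<^bsub>R\<^esub> y = x * y" "\<And>x y. x \<oplus>\<^bsub>R\<^esub> y = x + y" "\<one>\<^bsub>R\<^esub> = 1" "\<zero>\<^bsub>R\<^esub> = 0"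
    by (simp_all add: R_def ring_of_type_algebra_def)
  have pw: "x [^]\<^bsub>R\<^esub> n = x ^ n" for x and n :: nat
    by (induction n) (auto simp: R mult.commute)
  \<comment> \<open>HOL-Algebra polynomials are coefficient lists with the leading coefficient
    first, hence the reversal.\<close>
  have ev: "R.eval xs x = poly (Poly (rev xs)) x" for xs
    by (induction xs) (auto simp: R pw Poly_append poly_monom)
  have sub: "subfield K R" using K by (simp add: Sub_def R_def)
  have car: "xs \<in> carrier (K[X]\<^bsub>R\<^esub>) \<longleftrightarrow> xs = [] \<or> set xs \<subseteq> K \<and> hd xs \<noteq> 0" for xs
    by (auto simp: univ_poly_def polynomial_def R)
  have "alg_over K x \<longleftrightarrow> (R.algebraic over K) x"
  proof
    assume "alg_over K x"
    then obtain p where p: "p \<in> polys_over K" "p \<noteq> 0" "poly p x = 0" by (auto simp: alg_over_def)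
    have "rev (coeffs p) \<in> carrier (K[X]\<^bsub>R\<^esub>)" unfolding car
      using p by (auto simp: polys_over_def hd_rev last_coeffs_eq_coeff_degree coeffs_def)
    then show "(R.algebraic over K) x"
      by (rule R.algebraicI) (use p in \<open>auto simp: ev R\<close>)
  next
    assume "(R.algebraic over K) x"
    then obtain xs where xs: "xs \<in> carrier (K[X]\<^bsub>R\<^esub>)" "xs \<noteq> []" "R.eval xs x = \<zero>\<^bsub>R\<^esub>"
      using R.algebraicE[OF subfieldE(1)[OF sub]] R by auto
    define p where "p = Poly (rev xs)"
    have "p \<in> polys_over K" unfolding p_def polys_over_def
      using xs Sub_0[OF K] by (auto simp: car nth_default_def) (metis set_rev nth_mem length_rev subsetD)
    moreover have "p \<noteq> 0"
    proof
      assume "p = 0"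
      then obtain n where n: "rev xs = replicate n 0" by (auto simp: p_def Poly_eq_0)
      then have "hd xs = 0" using xs(2)
        by (metis hd_in_set in_set_replicate set_rev)
      then show False using xs car by auto
    qed
    moreover have "poly p x = 0" using xs ev R by (simp add: p_def)
    ultimately show "alg_over K x" by (auto simp: alg_over_def)
  qed
  then show ?thesis by (simp add: R_def)
qed

lemma algebraics_in_Sub:
  fixes K :: "'a::field set"
  assumes K: "K \<in> Sub"
  shows "{x. alg_over K x} \<in> Sub"
proof -
  define R where "R = (ring_of_type_algebra :: 'a ring)"
  interpret R: field R unfolding R_def by (rule field_from_type_algebra)
  have "subfield {x \<in> carrier R. (R.algebraic over K) x} R"
    by (rule R.subfield_of_algebraics) (use K in \<open>simp add: Sub_def R_def\<close>)
  then show ?thesis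
    unfolding Sub_def mem_Collect_eq alg_over_iff_algebraic[OF K] by (simp add: R_def ring_of_type_algebra_def)
qed

text \<open>The coefficients of a polynomial for \<open>x\<close> generate a finite extension
  \<open>E\<close> of \<open>K\<close>; then E(x) is finite over \<open>E\<close> and hence over
  \<open>K\<close>.\<close>

lemma alg_over_trans:
  fixes K :: "'a::field set"
  assumes K: "K \<in> Sub" and x: "alg_over {x. alg_over K x} x"
  shows "alg_over K x"
proof -
  define R where "R = (ring_of_type_algebra :: 'a ring)"
  interpret R: field R unfolding R_def by (rule field_from_type_algebra)
  have car: "carrier R = UNIV" by (simp add: R_def ring_of_type_algebra_def)
  have sub: "subfield K R" using K by (simp add: Sub_def R_def)
  obtain p where p: "p \<in> polys_over {x. alg_over K x}" "p \<noteq> 0" "poly p x = 0"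
    using x by (auto simp: alg_over_def)
  have alg: "(R.algebraic over K) c" if "c \<in> set (coeffs p)" for c
  proof -
    have "set (coeffs p) \<subseteq> range (coeff p)" by (auto simp: coeffs_def)
    with that have "c \<in> range (coeff p)" by blast
    then obtain i where "c = coeff p i" by blast
    then show ?thesis using p(1) alg_over_iff_algebraic[OF K] by (auto simp: polys_over_def R_def)
  qed
  define E where "E = R.finite_extension K (coeffs p)"
  have E: "subfield E R" "R.finite_dimension K E" unfolding E_def
    using R.finite_extension_is_subfield[OF sub] R.finite_extension_finite_dimension(1)[OF sub] alg car
    by auto
  have E': "E \<in> Sub" using E by (simp add: Sub_def R_def)
  have "set (coeffs p) \<subseteq> E" unfolding E_def
    using R.finite_extension_mem[OF subfieldE(1)[OF sub]] car by auto
  then have "coeff p i \<in> E" for i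
    using Sub_0[OF E'] coeff_in_coeffs[OF p(2), of i] by (cases "i \<le> degree p") (auto simp: coeff_eq_0)
  then have "alg_over E x" using p by (auto simp: alg_over_def polys_over_def)
  then have Ex: "(R.algebraic over E) x" using alg_over_iff_algebraic[OF E'] by (simp add: R_def)
  then have "R.finite_dimension E (R.simple_extension E x)"
    using R.finite_dimension_simple_extension[OF E(1)] car by auto
  then have "R.finite_dimension K (R.simple_extension E x)"
    using R.telescopic_base_dim(1)[OF sub E] by blast
  moreover have "subring (R.simple_extension E x) R"
    using R.simple_extension_is_subring[OF subfieldE(1)[OF E(1)]] car by auto
  moreover have "x \<in> R.simple_extension E x"
    using R.simple_extension_mem[OF subfieldE(1)[OF E(1)]] car by auto
  ultimately have "(R.algebraic over K) x"
    using R.finite_dimension_imp_algebraic[OF sub] by blast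
  then show ?thesis using alg_over_iff_algebraic[OF K] by (simp add: R_def)
qed

section \<open>Conjugates and primitive elements\<close>

lemma min_poly_other_root:
  fixes K :: "'a::{alg_closed_field, field_char_0} set"
  assumes K: "K \<in> Sub" and m: "min_poly K x m" and deg: "degree m \<ge> 2"
  obtains y where "y \<noteq> x" "poly m y = 0"
proof -
  have m': "m \<in> polys_over K" "m \<noteq> 0" "poly m x = 0" using m by (auto simp: min_poly_def)
  obtain q where q: "m = [:-x, 1:] ^ order x m * q" "\<not> [:-x, 1:] dvd q"
    using order_decomp[OF m'(2)] by blast
  show ?thesis
  proof (cases "degree q = 0")
    case False
    then obtain y where y: "poly q y = 0" using alg_closed_imp_poly_has_root by blast
    then have "y \<noteq> x" using q(2) by (auto simp: poly_eq_0_iff_dvd)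
    moreover have "poly m y = 0" by (subst q(1)) (simp add: y)
    ultimately show ?thesis by (rule that)
  next
    case True
    have "degree m = degree ([:-x, 1:] ^ order x m) + degree q"
      using m'(2) q(1) by (metis degree_mult_eq mult_eq_0_iff)
    then have "order x m \<ge> 2" using True deg by (simp add: degree_power_eq)
    then obtain c where c: "m = [:-x, 1:] ^ 2 * c"
      by (metis order_divides dvd_def m'(2))
    \<comment> \<open>If \<open>x\<close> is the only root, it is a multiple one, and the
      derivative, which is nonzero in characteristic 0, contradicts the minimality of
      \<open>m\<close>.\<close>
    have "poly (pderiv m) x = 0" unfolding c power2_eq_square pderiv_mult poly_add poly_mult by simp
    moreover have "pderiv m \<in> polys_over K" using polys_over_pderiv[OF K m'(1)] .
    moreover have "pderiv m \<noteq> 0" using deg by (simp add: pderiv_eq_0_iff)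
    ultimately have "degree m \<le> degree (pderiv m)" using m by (auto simp: min_poly_def)
    then show ?thesis using deg by (simp add: degree_pderiv)
  qed
qed

lemma min_poly_degree_ge_2:
  assumes K: "K \<in> Sub" and m: "min_poly K x m" and x: "x \<notin> K"
  shows "degree m \<ge> 2"
proof (rule ccontr)
  assume "\<not> degree m \<ge> 2"
  moreover have "degree m \<noteq> 0"
  proof
    assume "degree m = 0"
    then have "m = 1" using m by (auto simp: min_poly_def elim!: degree_eq_zeroE)
    then show False using m by (simp add: min_poly_def)
  qed
  ultimately have d: "degree m = 1" by linarith
  then have "m = [:coeff m 0, 1:]" using m
    by (intro poly_eqI) (auto simp: min_poly_def coeff_pCons coeff_eq_0 split: nat.splits)
  then have "poly [:coeff m 0, 1:] x = 0" using m by (simp add: min_poly_def)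
  then have "x = - coeff m 0" by (simp add: eq_neg_iff_add_eq_0 add.commute)
  moreover have "coeff m 0 \<in> K" using m by (auto simp: min_poly_def polys_over_def)
  ultimately show False using x Sub_uminus[OF K] by auto
qed

lemma primitive_element_two:
  fixes K :: "'a::{alg_closed_field, field_char_0} set"
  assumes K: "K \<in> Sub" and a: "alg_over K a" and b: "alg_over K b"
  obtains n where "alg_over K (a + of_nat n * b)" "a \<in> adjoin K (a + of_nat n * b)"
    "b \<in> adjoin K (a + of_nat n * b)"
proof -
  obtain f where f: "f \<in> polys_over K" "f \<noteq> 0" "poly f a = 0" using a by (auto simp: alg_over_def)
  obtain g where g: "g \<in> polys_over K" "g \<noteq> 0" "poly g b = 0" using b by (auto simp: alg_over_def)
  \<comment> \<open>A number n has to be avoided if roots u of \<open>f\<close> and v of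
    \<open>g\<close> with v distinct from \<open>b\<close> satisfy u + n v = a + n b. The pairs with
    v = b only contribute 0, because division by zero gives 0.\<close>
  define Bad where "Bad = (\<lambda>(u, v). (u - a) / (b - v)) ` ({u. poly f u = 0} \<times> {v. poly g v = 0})"
  have "finite Bad" unfolding Bad_def using f g poly_roots_finite by blast
  then have "\<exists>n. of_nat n \<notin> Bad"
    by (metis finite_imageD infinite_UNIV_char_0 inj_of_nat finite_subset image_subsetI)
  then obtain n where n: "(of_nat n :: 'a) \<notin> Bad" by blast
  define \<gamma> where "\<gamma> = a + of_nat n * b"
  have algs: "{x. alg_over K x} \<in> Sub" using algebraics_in_Sub[OF K] .
  have "\<gamma> \<in> {x. alg_over K x}" unfolding \<gamma>_def
    using a b by (intro Sub_add[OF algs] Sub_mult[OF algs] Sub_of_nat[OF algs]) auto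
  then have \<gamma>: "alg_over K \<gamma>" by simp
  define K' where "K' = adjoin K \<gamma>"
  have K': "K' \<in> Sub" "K \<subseteq> K'" "\<gamma> \<in> K'"
    unfolding K'_def using adjoin_in_Sub[OF K \<gamma>] subset_adjoin[OF K] in_adjoin[OF K] by auto
  have "alg_over K' b" using b K' alg_over_mono by blast
  then obtain m where m: "min_poly K' b m" using min_poly_exists[OF K'(1)] by blast
  \<comment> \<open>h(X) = f(\<gamma> - n X) has coefficients in K' and vanishes at
    \<open>b\<close>, because \<gamma> - n b = a.\<close>
  define h where "h = pcompose f [:\<gamma>, - of_nat n:]"
  have h: "h \<in> polys_over K'" unfolding h_def
    using f(1) polys_over_mono[OF K'(2)] K' Sub_of_nat[OF K'(1)]
    by (intro polys_over_pcompose[OF K'(1)]) (auto simp: polys_over_pCons polys_over_0 intro: Sub_uminus)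
  have "poly h b = 0" by (simp add: h_def poly_pcompose \<gamma>_def f mult.commute)
  then have mh: "m dvd h" using min_poly_dvd[OF K'(1) m h] by simp
  have mg: "m dvd g" using min_poly_dvd[OF K'(1) m] g polys_over_mono[OF K'(2)] by blast
  \<comment> \<open>\<open>m\<close> divides \<open>g\<close> and \<open>h\<close>, whose only common root is \<open>b\<close> by the choice of \<open>n\<close>.\<close>
  have "b \<in> K'"
  proof (rule ccontr)
    assume "b \<notin> K'"
    then obtain v where v: "v \<noteq> b" "poly m v = 0"
      using min_poly_other_root[OF K'(1) m] min_poly_degree_ge_2[OF K'(1) m] by blast
    have gv: "poly g v = 0" using mg v by (metis dvd_def mult_eq_0_iff poly_mult)
    have "poly h v = 0" using mh v by (metis dvd_def mult_eq_0_iff poly_mult)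
    then have "poly f (\<gamma> - of_nat n * v) = 0" by (simp add: h_def poly_pcompose mult.commute)
    then have "((\<gamma> - of_nat n * v) - a) / (b - v) \<in> Bad" using gv by (force simp: Bad_def)
    moreover have "((\<gamma> - of_nat n * v) - a) / (b - v) = of_nat n"
      using v by (simp add: \<gamma>_def field_simps)
    ultimately show False using n by simp
  qed
  moreover have "a = \<gamma> - of_nat n * b" by (simp add: \<gamma>_def)
  ultimately have "a \<in> K'" using K' Sub_of_nat[OF K'(1)] by (metis Sub_diff Sub_mult)
  then show ?thesis using that[of n] \<gamma> \<open>b \<in> K'\<close> by (simp add: K'_def \<gamma>_def)
qed

text \<open>That \<gamma> lies in the field generated by \<open>K\<close> and \<open>S\<close> is
  recorded because later a conjugation fixing all of \<open>K\<close> and \<open>S\<close> has to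
  fix \<gamma>.\<close>

lemma primitive_element:
  fixes K :: "'a::{alg_closed_field, field_char_0} set"
  assumes K: "K \<in> Sub" and "finite S" "\<forall>x\<in>S. alg_over K x"
  obtains \<gamma> where "\<gamma> \<in> field_gen (K \<union> S)" "alg_over K \<gamma>" "S \<subseteq> adjoin K \<gamma>"
proof -
  have "\<exists>\<gamma>. \<gamma> \<in> field_gen (K \<union> S) \<and> alg_over K \<gamma> \<and> S \<subseteq> adjoin K \<gamma>"
    using assms(2,3)
  proof (induction S)
    case empty
    show ?case using K alg_over_self[OF K Sub_0[OF K]] Sub_0[OF field_gen_in_Sub] by auto
  next
    case (insert b S)
    then obtain a where a: "a \<in> field_gen (K \<union> S)" "alg_over K a" "S \<subseteq> adjoin K a" by auto
    obtain n where n: "alg_over K (a + of_nat n * b)" "a \<in> adjoin K (a + of_nat n * b)"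
        "b \<in> adjoin K (a + of_nat n * b)"
      using primitive_element_two[OF K a(2), of b] insert by blast
    let ?F = "field_gen (K \<union> insert b S)"
    have F: "?F \<in> Sub" by (rule field_gen_in_Sub)
    have "a \<in> ?F" using a(1) field_gen_mono[of "K \<union> S" "K \<union> insert b S"] by auto
    moreover have "b \<in> ?F" using field_gen_superset[of "K \<union> insert b S"] by auto
    ultimately have "a + of_nat n * b \<in> ?F"
      by (intro Sub_add[OF F] Sub_mult[OF F] Sub_of_nat[OF F])
    moreover have "adjoin K a \<subseteq> adjoin K (a + of_nat n * b)"
      using adjoin_least[OF adjoin_in_Sub[OF K n(1)] subset_adjoin[OF K] n(2)] .
    ultimately show ?case using n a by blast
  qed
  then show ?thesis using that by blast
qed

section \<open>Ultrafilters and Hensel's lemma\<close>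

text \<open>By Zorn's lemma there is a maximal family of sets that contains those of
  \<open>F\<close> and has the finite intersection property. If it contained neither a set nor its
  complement, finite subfamilies whose intersections miss the one and the other would together have
  empty intersection.\<close>

lemma ultrafilter_exists:
  assumes "F \<noteq> (bot :: 'a filter)"
  obtains U where "U \<le> F" "U \<noteq> bot" "\<And>P. eventually P U \<or> eventually (\<lambda>x. \<not> P x) U"
proof -
  define fip where "fip = (\<lambda>M :: 'a set set. \<forall>H. finite H \<longrightarrow> H \<subseteq> M \<longrightarrow> \<Inter>H \<noteq> {})"
  define B where "B = {S. eventually (\<lambda>x. x \<in> S) F}"
  define \<A> where "\<A> = {M. B \<subseteq> M \<and> fip M}"
  have "fip B" unfolding fip_def
  proof (intro allI impI)
    fix H assume "finite H" "H \<subseteq> B"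
    then have "eventually (\<lambda>x. \<forall>S\<in>H. x \<in> S) F" by (auto simp: eventually_ball_finite_distrib B_def)
    then show "\<Inter>H \<noteq> {}" using assms eventually_happens by fastforce
  qed
  then have "\<A> \<noteq> {}" by (auto simp: \<A>_def)
  moreover have "\<Union>\<C> \<in> \<A>" if \<C>: "\<C> \<noteq> {}" "subset.chain \<A> \<C>" for \<C>
  proof -
    have "fip (\<Union>\<C>)" unfolding fip_def
    proof (intro allI impI)
      fix H assume H: "finite H" "H \<subseteq> \<Union>\<C>"
      obtain M where "M \<in> \<C>" "H \<subseteq> M" using finite_subset_Union_chain[OF H \<C>(1) \<C>(2)] by blast
      then show "\<Inter>H \<noteq> {}" using \<C>(2) H(1) by (auto simp: subset.chain_def \<A>_def fip_def)
    qed
    moreover have "B \<subseteq> \<Union>\<C>" using \<C> by (auto simp: subset.chain_def \<A>_def) blast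
    ultimately show ?thesis by (simp add: \<A>_def)
  qed
  ultimately obtain M where M: "M \<in> \<A>" and max: "\<And>N. N \<in> \<A> \<Longrightarrow> M \<subseteq> N \<Longrightarrow> N = M"
    using subset_Zorn_nonempty[of \<A>] by metis
  have M': "B \<subseteq> M" "fip M" using M by (auto simp: \<A>_def)
  have ultra: "S \<in> M \<or> - S \<in> M" for S
  proof (rule ccontr)
    assume no: "\<not> (S \<in> M \<or> - S \<in> M)"
    have "\<exists>H. finite H \<and> H \<subseteq> M \<and> \<Inter>H \<inter> R = {}" if "R \<notin> M" for R
    proof -
      have "\<not> fip (insert R M)"
        using max[of "insert R M"] M' that by (auto simp: \<A>_def)
      then obtain H where H: "finite H" "H \<subseteq> insert R M" "\<Inter>H = {}" by (auto simp: fip_def)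
      have "\<Inter>(H - {R}) \<inter> R \<subseteq> \<Inter>H" by blast
      then show ?thesis using H by (intro exI[of _ "H - {R}"]) auto
    qed
    then obtain H1 H2 where H: "finite H1" "H1 \<subseteq> M" "\<Inter>H1 \<inter> S = {}" "finite H2" "H2 \<subseteq> M" "\<Inter>H2 \<inter> - S = {}"
      using no by meson
    then have "\<Inter>(H1 \<union> H2) = {}" by blast
    then show False using M'(2) H unfolding fip_def by (metis Un_subset_iff finite_UnI)
  qed
  define U where "U = (INF S\<in>M. principal S)"
  have ev: "eventually (\<lambda>x. x \<in> S) U" if "S \<in> M" for S
    unfolding U_def using that by (intro eventually_INF1[of S]) (auto simp: eventually_principal)
  show ?thesis
  proof (rule that)
    show "U \<le> F"
    proof (rule filter_leI)
      fix P assume "eventually P F"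
      then have "Collect P \<in> M" using M'(1) by (auto simp: B_def)
      then show "eventually P U" using ev by force
    qed
    show "U \<noteq> bot" unfolding U_def
    proof (rule INF_filter_not_bot)
      fix H assume "H \<subseteq> M" "finite H"
      then show "(INF S\<in>H. principal S) \<noteq> bot"
        using M'(2) by (auto simp: INF_principal_finite principal_eq_bot_iff fip_def)
    qed
    show "eventually P U \<or> eventually (\<lambda>x. \<not> P x) U" for P
      using ultra[of "Collect P"] ev by (fastforce elim: eventually_mono)
  qed
qed

definition fps_over :: "'a::zero set \<Rightarrow> 'a fps set" where
  "fps_over L = {f. \<forall>n. fps_nth f n \<in> L}"

lemma ring_closed_fps_over:
  assumes "L \<in> Sub"
  shows "ring_closed (fps_over L)"
  unfolding ring_closed_def fps_over_def using Sub_closed[OF assms]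
  by (auto simp: fps_mult_nth fps_one_def intro!: Sub_sum[OF assms])

lemma fps_const_over: "L \<in> Sub \<Longrightarrow> fps_const c \<in> fps_over L \<longleftrightarrow> c \<in> L"
  by (force simp: fps_over_def Sub_0)

lemma fps_X_over: "L \<in> Sub \<Longrightarrow> fps_X \<in> fps_over L"
  by (auto simp: fps_over_def fps_X_def Sub_0 Sub_1)

lemma poly_diff_factor:
  fixes p :: "'a::comm_ring_1 poly"
  shows "\<exists>r. poly p a - poly p b = (a - b) * r"
proof (induction p)
  case (pCons c p)
  then obtain r where r: "poly p a - poly p b = (a - b) * r" by blast
  have "poly (pCons c p) a - poly (pCons c p) b = (a - b) * poly p a + b * (poly p a - poly p b)"
    by (simp add: algebra_simps)
  also have "\<dots> = (a - b) * (poly p a + b * r)" unfolding r by (simp add: algebra_simps)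
  finally show ?case by blast
qed (auto intro: exI[of _ 0])

lemma poly_taylor2:
  fixes p :: "'a::idom poly"
  shows "\<exists>r. poly p (a + h) = poly p a + h * poly (pderiv p) a + h\<^sup>2 * r"
proof (induction p)
  case (pCons c p)
  then obtain r where r: "poly p (a + h) = poly p a + h * poly (pderiv p) a + h\<^sup>2 * r" by blast
  have "poly (pCons c p) (a + h) = poly (pCons c p) a + h * poly (pderiv (pCons c p)) a
      + h\<^sup>2 * (poly (pderiv p) a + (a + h) * r)"
    unfolding pderiv_pCons poly_pCons r by (simp add: algebra_simps power2_eq_square)
  then show ?case by blast
qed (auto intro: exI[of _ 0])

lemma fps_nth_poly_0:
  "fps_nth (poly p a) 0 = poly (map_poly (\<lambda>f. fps_nth f 0) p) (fps_nth a 0)"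
  by (induction p) (auto simp: map_poly_pCons)

lemma fps_mult_low:
  fixes f g :: "'a::comm_ring_1 fps"
  assumes "\<And>k. k < n \<Longrightarrow> fps_nth f k = 0"
  shows "m < n \<Longrightarrow> fps_nth (f * g) m = 0" "fps_nth (f * g) n = fps_nth f n * fps_nth g 0"
proof -
  show "m < n \<Longrightarrow> fps_nth (f * g) m = 0"
    using assms by (auto simp: fps_mult_nth intro!: sum.neutral)
  have "fps_nth (f * g) n = (\<Sum>i\<in>{n}. fps_nth f i * fps_nth g (n - i))"
    unfolding fps_mult_nth using assms by (intro sum.mono_neutral_right) auto
  then show "fps_nth (f * g) n = fps_nth f n * fps_nth g 0" by simp
qed

text \<open>Successive approximation in which each step corrects one coefficient. The constant term
  \<open>d\<close> of the derivative never changes, so all corrections are quotients of elements of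
  \<open>L\<close> by the same nonzero element of \<open>L\<close>.\<close>

lemma hensel_fps:
  fixes g :: "'a::field fps poly"
  assumes L: "L \<in> Sub" and g: "g \<in> polys_over (fps_over L)" and c: "c \<in> L"
    and root: "fps_nth (poly g (fps_const c)) 0 = 0"
    and simple: "fps_nth (poly (pderiv g) (fps_const c)) 0 \<noteq> 0"
  obtains y where "y \<in> fps_over L" "poly g y = 0" "fps_nth y 0 = c"
proof -
  note R = ring_closed_fps_over[OF L]
  define d where "d = fps_nth (poly (pderiv g) (fps_const c)) 0"
  have dn: "fps_nth (poly (pderiv g) a) 0 = d" if "fps_nth a 0 = c" for a
    unfolding d_def fps_nth_poly_0 using that by simp
  have "pderiv g \<in> polys_over (fps_over L)"
    using g unfolding polys_over_def mem_Collect_eq coeff_pderiv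
    by (intro allI rc_mult[OF R] rc_of_nat[OF R]) simp
  then have "poly (pderiv g) (fps_const c) \<in> fps_over L"
    using rc_poly[OF R] fps_const_over[OF L] c by blast
  then have dL: "d \<in> L" unfolding d_def fps_over_def by blast
  \<comment> \<open>By Taylor expansion, adding - (e / d) X^(n+1) turns the coefficient e of
    \<open>poly g a\<close> at n+1 into e - (e / d) d = 0. Lower coefficients do not change, and the
    quadratic term starts beyond n+1.\<close>
  define stp where "stp n a = a - fps_const (fps_nth (poly g a) (Suc n) / d) * fps_X ^ Suc n" for n a
  define a where "a = rec_nat (fps_const c) stp"
  have a_0: "a 0 = fps_const c" and a_Suc: "a (Suc n) = stp n (a n)" for n
    by (simp_all add: a_def)
  have a: "a n \<in> fps_over L \<and> fps_nth (a n) 0 = c \<and> (\<forall>k\<le>n. fps_nth (poly g (a n)) k = 0)" for n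
  proof (induction n)
    case 0
    then show ?case using root c fps_const_over[OF L] by (simp add: a_0)
  next
    case (Suc n)
    let ?e = "fps_nth (poly g (a n)) (Suc n)"
    let ?h = "fps_const (- ?e / d) * fps_X ^ Suc n"
    have eL: "?e \<in> L" using rc_poly[OF R g] Suc by (auto simp: fps_over_def)
    have eq: "a (Suc n) = a n + ?h"
      by (simp add: a_Suc stp_def algebra_simps flip: fps_const_neg)
    have h: "fps_nth ?h k = (if k = Suc n then - ?e / d else 0)" for k
      by (simp add: fps_X_power_nth del: power_Suc)
    have "a (Suc n) \<in> fps_over L"
      using Suc eL dL unfolding eq fps_over_def mem_Collect_eq fps_add_nth h
      by (auto intro!: Sub_closed[OF L])
    moreover have "fps_nth (a (Suc n)) 0 = c" using Suc unfolding eq fps_add_nth h by simp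
    moreover have "fps_nth (poly g (a (Suc n))) k = 0" if k: "k \<le> Suc n" for k
    proof -
      obtain r where r: "poly g (a n + ?h) = poly g (a n) + ?h * poly (pderiv g) (a n) + ?h\<^sup>2 * r"
        using poly_taylor2 by blast
      have low: "fps_nth ?h k = 0" if "k < Suc n" for k using that unfolding h by simp
      have h2: "fps_nth (?h\<^sup>2 * r) k = 0"
      proof (cases "k = Suc n")
        case True
        have "fps_nth (?h * (?h * r)) (Suc n) = fps_nth ?h (Suc n) * fps_nth (?h * r) 0"
          by (rule fps_mult_low(2)) (rule low)
        also have "fps_nth (?h * r) 0 = 0" using fps_mult_low(1)[of "Suc n" ?h 0 r] low by blast
        finally show ?thesis using True by (simp only: power2_eq_square mult.assoc mult_zero_right)
      next
        case False
        then show ?thesis using k fps_mult_low(1)[of "Suc n" ?h k "?h * r"] low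
          by (simp only: power2_eq_square mult.assoc)
      qed
      have h1: "fps_nth (?h * poly (pderiv g) (a n)) k = (if k = Suc n then - ?e else 0)"
      proof (cases "k = Suc n")
        case True
        have "fps_nth (?h * poly (pderiv g) (a n)) (Suc n) = fps_nth ?h (Suc n) * d"
          using fps_mult_low(2)[of "Suc n" ?h "poly (pderiv g) (a n)"] low dn Suc by metis
        then show ?thesis using True simple h[of "Suc n"] by (simp add: d_def)
      next
        case False
        then show ?thesis using k fps_mult_low(1)[of "Suc n" ?h k] low by force
      qed
      show ?thesis unfolding eq r fps_add_nth h1 h2 using Suc k by (auto simp: le_Suc_eq)
    qed
    ultimately show ?case by blast
  qed
  \<comment> \<open>The coefficient at n is final from the n-th approximation on, so the diagonal is
    the limit.\<close>
  define y where "y = Abs_fps (\<lambda>n. fps_nth (a n) n)"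
  have stab: "fps_nth (a (n + m)) k = fps_nth (a n) k" if "k \<le> n" for n m k
    using that by (induction m) (simp_all add: a_Suc stp_def fps_X_power_nth del: power_Suc)
  have yk: "fps_nth y k = fps_nth (a n) k" if "k \<le> n" for n k
    using stab[of k k "n - k"] that by (simp add: y_def)
  show ?thesis
  proof (rule that)
    show "y \<in> fps_over L" using a by (auto simp: y_def fps_over_def)
    show "fps_nth y 0 = c" using a yk[of 0 0] by simp
    show "poly g y = 0"
    proof (rule fps_ext)
      fix n
      obtain r where r: "poly g y - poly g (a n) = (y - a n) * r" using poly_diff_factor by blast
      have "fps_nth ((y - a n) * r) n = 0"
        by (rule fps_mult_low(1)[of "Suc n"]) (auto simp: yk)
      then have "fps_nth (poly g y) n = fps_nth (poly g (a n)) n" using r by (metis eq_iff_diff_eq_0 fps_sub_nth)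
      then show "fps_nth (poly g y) n = fps_nth 0 n" using a by simp
    qed
  qed
qed

section \<open>Transferring relations along an adjunction\<close>

lemma poly_fun_apply:
  fixes f :: "('i \<Rightarrow> 'b::comm_ring_1) poly"
  shows "poly f y i = poly (map_poly (\<lambda>c. c i) f) (y i)"
  by (induction f) (auto simp: map_poly_pCons)

lemma coeff_map_poly_apply: "coeff (map_poly (\<lambda>c. c i) f) j = coeff f j i"
  by (simp add: coeff_map_poly)

lemma eventually_poly_fun_0:
  fixes f :: "('i \<Rightarrow> 'b::comm_ring_1) poly"
  assumes "\<And>j. \<forall>\<^sub>F i in V. coeff f j i = 0"
  shows "\<forall>\<^sub>F i in V. poly f y i = 0"
proof -
  have "\<forall>\<^sub>F i in V. \<forall>j\<in>{..degree f}. coeff f j i = 0"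
    using assms by (simp add: eventually_ball_finite_distrib)
  then show ?thesis
  proof eventually_elim
    case (elim i)
    then have "map_poly (\<lambda>c. c i) f = 0"
      by (intro poly_eqI) (metis atMost_iff coeff_0 coeff_eq_0 coeff_map_poly_apply not_le zero_fun_apply)
    then show ?case by (simp add: poly_fun_apply)
  qed
qed

text \<open>Used both for arcs and for specialisation: \<open>U\<close> stands for the known
  situation and \<open>V\<close> for the one to which relations are carried. Division by
  \<open>g\<close> costs only factors \<open>lead_coeff g\<close>, which do not vanish along
  \<open>V\<close>; once the degree is below that of \<open>g\<close>, minimality makes every
  coefficient vanish along \<open>U\<close>, and \<open>transfer\<close> moves this to
  \<open>V\<close>.\<close>

lemma relations_transfer_adjoin:
  fixes A :: "('i \<Rightarrow> 'b::idom) set"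
  assumes A: "ring_closed A"
    and transfer: "\<And>f. f \<in> A \<Longrightarrow> \<forall>\<^sub>F i in U. f i = 0 \<Longrightarrow> \<forall>\<^sub>F i in V. f i = 0"
    and g: "g \<in> polys_over A" "degree g > 0" "\<forall>\<^sub>F i in U. poly g y i = 0" "\<forall>\<^sub>F i in V. poly g y i = 0"
    and lc: "\<forall>\<^sub>F i in V. lead_coeff g i \<noteq> 0"
    and minimal: "\<And>h j. h \<in> polys_over A \<Longrightarrow> degree h < degree g \<Longrightarrow> \<forall>\<^sub>F i in U. poly h y i = 0 \<Longrightarrow>
       \<forall>\<^sub>F i in U. coeff h j i = 0"
    and f: "f \<in> polys_over A" "\<forall>\<^sub>F i in U. poly f y i = 0"
  shows "\<forall>\<^sub>F i in V. poly f y i = 0"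
  using f
proof (induction "degree f" arbitrary: f rule: less_induct)
  case less
  show ?case
  proof (cases "degree f < degree g")
    case True
    have "\<forall>\<^sub>F i in V. coeff f j i = 0" for j
      using transfer[OF coeff_polys_over[OF less.prems(1)] minimal[OF less.prems(1) True less.prems(2)]] .
    then show ?thesis by (rule eventually_poly_fun_0)
  next
    case False
    \<comment> \<open>one step of pseudo-division by \<open>g\<close>\<close>
    define f' where "f' = smult (lead_coeff g) f - monom (lead_coeff f) (degree f - degree g) * g"
    have "f' \<in> polys_over A" unfolding f'_def
      using less.prems(1) g(1)
      by (intro rc_polys_diff[OF A] rc_polys_smult[OF A] rc_polys_mult[OF A] rc_polys_monom[OF A] coeff_polys_over)
    moreover have "degree f' < degree f"
    proof -
      have "degree (monom (lead_coeff f) (degree f - degree g) * g) \<le> degree f"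
        using degree_mult_le[of "monom (lead_coeff f) (degree f - degree g)" g]
          degree_monom_le[of "lead_coeff f" "degree f - degree g"] False by linarith
      then have le: "degree f' \<le> degree f" unfolding f'_def by (intro degree_diff_le degree_smult_le)
      have "coeff f' (degree f) = 0" unfolding f'_def using False
        by (simp add: coeff_monom_mult)
      then show ?thesis using le g(2) False
        by (metis gr_zeroI le_neq_implies_less leading_coeff_0_iff not_less degree_0 less_le_trans)
    qed
    moreover have f'i: "poly f' y i = lead_coeff g i * poly f y i - poly (monom (lead_coeff f) (degree f - degree g)) y i * poly g y i" for i
      by (simp add: f'_def)
    have "\<forall>\<^sub>F i in U. poly f' y i = 0"
      using less.prems(2) g(3) by eventually_elim (simp add: f'i)
    ultimately have "\<forall>\<^sub>F i in V. poly f' y i = 0" using less.hyps by blast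
    with lc g(4) show ?thesis by eventually_elim (simp add: f'i)
  qed
qed

section \<open>Arcs through generic points\<close>

definition is_hom :: "('a::comm_ring_1 \<Rightarrow> 'b::comm_ring_1) \<Rightarrow> bool" where
  "is_hom h \<longleftrightarrow> h 0 = 0 \<and> h 1 = 1 \<and> (\<forall>x y. h (x + y) = h x + h y) \<and> (\<forall>x y. h (x * y) = h x * h y)"

lemma
  assumes "is_hom h"
  shows is_hom_0: "h 0 = 0" and is_hom_1: "h 1 = 1" and is_hom_add: "h (x + y) = h x + h y"
    and is_hom_mult: "h (x * y) = h x * h y" and is_hom_uminus: "h (- x) = - h x"
    and is_hom_diff: "h (x - y) = h x - h y"
proof -
  show "h 0 = 0" "h 1 = 1" and add: "h (x + y) = h x + h y" and "h (x * y) = h x * h y" for x y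
    using assms by (auto simp: is_hom_def)
  then show um: "h (- x) = - h x" for x by (metis add.right_inverse add_eq_0_iff)
  show "h (x - y) = h x - h y" using add[of x "- y"] um by simp
qed

lemmas is_hom_simps = is_hom_0 is_hom_1 is_hom_add is_hom_mult is_hom_uminus is_hom_diff

lemma is_hom_poly: "is_hom h \<Longrightarrow> h (poly p x) = poly (map_poly h p) (h x)"
  by (induction p) (auto simp: is_hom_simps map_poly_pCons)

lemma is_hom_comp: "is_hom h \<Longrightarrow> is_hom g \<Longrightarrow> is_hom (\<lambda>x. h (g x))"
  by (auto simp: is_hom_def)

lemma is_hom_map_poly:
  assumes h: "is_hom h"
  shows "is_hom (map_poly h)"
proof -
  have add: "map_poly h (p + q) = map_poly h p + map_poly h q" for p q
    by (rule poly_eqI) (simp add: coeff_map_poly is_hom_simps[OF h])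
  have smult: "map_poly h (smult a p) = smult (h a) (map_poly h p)" for a p
    by (rule poly_eqI) (simp add: coeff_map_poly is_hom_simps[OF h])
  have "map_poly h (p * q) = map_poly h p * map_poly h q" for p q
    by (induction p) (auto simp: add smult map_poly_pCons is_hom_simps[OF h])
  then show ?thesis unfolding is_hom_def using is_hom_1[OF h] by (auto simp: add map_poly_1')
qed

lemma is_hom_poly_map: "is_hom h \<Longrightarrow> is_hom (\<lambda>p. poly (map_poly h p) x)"
  by (rule is_hom_comp[OF _ is_hom_map_poly, of "\<lambda>p. poly p x"]) (simp_all add: is_hom_def)

lemma ring_closed_range: "is_hom h \<Longrightarrow> ring_closed (range h)"
  unfolding ring_closed_def
  by (auto simp flip: is_hom_add is_hom_mult is_hom_uminus) (metis is_hom_0 is_hom_1 rangeI)+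

lemma is_hom_fps_const: "is_hom fps_const"
  by (auto simp: is_hom_def)

text \<open>Unlike in \<open>tval\<close>, the parameters are moved along \<open>h\<close>, so a
  term can be evaluated in power series, in functions on an index set or in a larger field.\<close>

primrec tev :: "('a \<Rightarrow> 'b::comm_ring_1) \<Rightarrow> (nat \<Rightarrow> 'b) \<Rightarrow> 'a rterm \<Rightarrow> 'b" where
  "tev h e (Var i) = e i"
| "tev h e (Par a) = h a"
| "tev h e Zero = 0"
| "tev h e One = 1"
| "tev h e (Plus s t) = tev h e s + tev h e t"
| "tev h e (Minus t) = - tev h e t"
| "tev h e (Times s t) = tev h e s * tev h e t"

lemma is_hom_tev: "is_hom g \<Longrightarrow> g (tev h e t) = tev (\<lambda>a. g (h a)) (\<lambda>i. g (e i)) t"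
  by (induction t) (auto simp: is_hom_simps)

lemma tval_eq_tev: "tval e t = tev (\<lambda>a. a) e t"
  by (induction t) auto

lemma is_hom_tval: "is_hom h \<Longrightarrow> h (tval e t) = tev h (\<lambda>i. h (e i)) t"
  by (simp add: tval_eq_tev is_hom_tev)

lemma tev_cong: "(\<And>i. i \<in> tvars t \<Longrightarrow> e i = e' i) \<Longrightarrow> tev h e t = tev h e' t"
  by (induction t) auto

lemma tev_in_ring:
  assumes "ring_closed A" "\<And>c. c \<in> set_rterm t \<Longrightarrow> h c \<in> A" "\<And>i. i \<in> tvars t \<Longrightarrow> e i \<in> A"
  shows "tev h e t \<in> A"
  using assms(2,3) by (induction t) (auto intro: rc_0 rc_1 rc_add rc_mult rc_uminus assms(1))

lemma tev_fun_apply: "tev h e t x = tev (\<lambda>a. h a x) (\<lambda>i. e i x) t"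
  by (induction t) auto

text \<open>The coefficients will be functions on an index set, hence possibly zero divisors; at
  each index this becomes \<open>pderiv\<close>, see \<open>map_formal_deriv_apply\<close>.\<close>

definition formal_deriv :: "'c::comm_ring_1 poly \<Rightarrow> 'c poly" where
  "formal_deriv g = (\<Sum>j<degree g. monom (of_nat (Suc j) * coeff g (Suc j)) j)"

lemma coeff_formal_deriv: "coeff (formal_deriv g) j = of_nat (Suc j) * coeff g (Suc j)"
proof -
  have "coeff (formal_deriv g) j = (\<Sum>n<degree g. if n = j then of_nat (Suc n) * coeff g (Suc n) else 0)"
    by (simp add: formal_deriv_def coeff_sum)
  also have "\<dots> = (if j < degree g then of_nat (Suc j) * coeff g (Suc j) else 0)"
    by (subst sum.delta) auto
  finally show ?thesis by (auto simp: coeff_eq_0)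
qed

lemma degree_formal_deriv: "degree g > 0 \<Longrightarrow> degree (formal_deriv g) < degree g"
  by (rule le_less_trans[of _ "degree g - 1"], rule degree_le) (auto simp: coeff_formal_deriv coeff_eq_0 simp del: of_nat_Suc)

lemma map_formal_deriv_apply:
  fixes g :: "('i \<Rightarrow> 'b::idom) poly"
  shows "map_poly (\<lambda>c. c i) (formal_deriv g) = pderiv (map_poly (\<lambda>c. c i) g)"
  by (rule poly_eqI)
     (simp add: coeff_map_poly coeff_formal_deriv coeff_pderiv del: of_nat_Suc)

text \<open>A relation of least degree is taken among those with a coefficient that does not vanish
  almost everywhere. If its leading coefficient were not almost everywhere nonzero, it would vanish
  almost everywhere, \<open>U\<close> being an ultrafilter, and dropping the leading term would give
  a smaller relation.\<close>

lemma minimal_relation: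
  fixes A :: "('i \<Rightarrow> 'b::idom) set"
  assumes A: "ring_closed A" and ultra: "\<And>P. eventually P U \<or> eventually (\<lambda>i. \<not> P i) U" and ne: "U \<noteq> bot"
    and ex: "f \<in> polys_over A" "\<forall>\<^sub>F i in U. poly f y i = 0" "\<not> (\<forall>\<^sub>F i in U. coeff f j i = 0)"
  obtains g where "g \<in> polys_over A" "degree g > 0" "\<forall>\<^sub>F i in U. poly g y i = 0"
    "\<forall>\<^sub>F i in U. lead_coeff g i \<noteq> 0"
    "\<And>h j. h \<in> polys_over A \<Longrightarrow> degree h < degree g \<Longrightarrow> \<forall>\<^sub>F i in U. poly h y i = 0 \<Longrightarrow>
       \<forall>\<^sub>F i in U. coeff h j i = 0"
proof -
  define rel where "rel g \<longleftrightarrow> g \<in> polys_over A \<and> (\<forall>\<^sub>F i in U. poly g y i = 0) \<and>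
    (\<exists>j. \<not> (\<forall>\<^sub>F i in U. coeff g j i = 0))" for g
  have "rel f" using ex by (auto simp: rel_def)
  then obtain g where g: "rel g" and least: "\<And>h. rel h \<Longrightarrow> degree g \<le> degree h"
    using ex_has_least_nat[of rel _ degree] by blast
  have gA: "g \<in> polys_over A" and g0: "\<forall>\<^sub>F i in U. poly g y i = 0" using g by (auto simp: rel_def)
  have minimal: "\<forall>\<^sub>F i in U. coeff h j i = 0"
    if "h \<in> polys_over A" "degree h < degree g" "\<forall>\<^sub>F i in U. poly h y i = 0" for h j
    using least[of h] that by (auto simp: rel_def)
  have lc: "\<forall>\<^sub>F i in U. lead_coeff g i \<noteq> 0"
  proof (rule ccontr)
    assume "\<not> ?thesis"
    then have lc0: "\<forall>\<^sub>F i in U. lead_coeff g i = 0" using ultra by force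
    obtain j where j: "\<not> (\<forall>\<^sub>F i in U. coeff g j i = 0)" using g by (auto simp: rel_def)
    have jd: "j < degree g"
    proof (rule ccontr)
      assume "\<not> j < degree g"
      then have "j = degree g \<or> coeff g j = 0" using coeff_eq_0[of g j] by linarith
      then show False using j lc0 by auto
    qed
    define h where "h = g - monom (lead_coeff g) (degree g)"
    have hA: "h \<in> polys_over A" unfolding h_def
      using gA by (intro rc_polys_diff[OF A] rc_polys_monom[OF A] coeff_polys_over)
    have "degree h \<le> degree g" unfolding h_def by (intro degree_diff_le) (auto simp: degree_monom_le)
    moreover have "coeff h (degree g) = 0" by (simp add: h_def)
    ultimately have "degree h < degree g"
      using jd by (metis degree_0 gr_implies_not0 le_neq_implies_less leading_coeff_0_iff neq0_conv)
    moreover have "\<forall>\<^sub>F i in U. poly h y i = 0"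
      using g0 lc0 by eventually_elim (simp add: h_def poly_monom)
    ultimately have "\<forall>\<^sub>F i in U. coeff h j i = 0" using minimal hA by blast
    then show False using j jd by (simp add: h_def)
  qed
  have dg: "degree g > 0"
  proof (rule ccontr)
    assume "\<not> degree g > 0"
    then obtain c where c: "g = [:c:]" using degree_eq_zeroE by blast
    have "\<forall>\<^sub>F i in U. False" using lc g0 by eventually_elim (simp add: c)
    then show False using ne by simp
  qed
  show ?thesis by (rule that[OF gA dg g0 lc minimal])
qed

text \<open>For \<open>U\<close>-almost every point \<open>\<xi>\<close>, the coordinates are lifted one at a time to power series with
  constant terms \<open>\<xi>\<close>, starting with \<open>\<xi> 0 + X\<close>, so that relations holding at almost all points hold
  for the lifts: a coordinate without a generic relation over the previous ones is lifted to a
  constant, the others by Hensel's lemma applied to a relation of minimal degree. The set \<open>\<Lambda>\<close> keeps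
  track of the lifts being algebraic over the rational functions.\<close>

locale generic_points =
  fixes L :: "'a::field_char_0 set" and U :: "(nat \<Rightarrow> 'a) filter" and k :: nat
    and \<iota> :: "'a fps \<Rightarrow> 'o::field" and \<Lambda> :: "'o set"
  assumes L: "L \<in> Sub"
    and U_ne: "U \<noteq> bot"
    and ultra: "\<And>P. eventually P U \<or> eventually (\<lambda>\<xi>. \<not> P \<xi>) U"
    and U_L: "\<And>i. i \<le> k \<Longrightarrow> \<forall>\<^sub>F \<xi> in U. \<xi> i \<in> L"
    and U_0: "\<And>c. \<forall>\<^sub>F \<xi> in U. \<xi> 0 \<noteq> c"
    and \<iota>: "is_hom \<iota>" "inj \<iota>"
    and \<Lambda>: "\<Lambda> \<in> Sub" "\<And>x. alg_over \<Lambda> x \<Longrightarrow> x \<in> \<Lambda>"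
    and \<iota>_const: "\<And>c. c \<in> L \<Longrightarrow> \<iota> (fps_const c) \<in> \<Lambda>"
    and \<iota>_X: "\<iota> fps_X \<in> \<Lambda>"
begin

lemma not_eventually_iff: "\<not> eventually P U \<longleftrightarrow> eventually (\<lambda>\<xi>. \<not> P \<xi>) U"
proof
  assume "eventually (\<lambda>\<xi>. \<not> P \<xi>) U"
  then show "\<not> eventually P U" using U_ne eventually_conj[of P U "\<lambda>\<xi>. \<not> P \<xi>"] by auto
qed (use ultra in blast)

lemma \<iota>_eq_0: "\<iota> f = 0 \<longleftrightarrow> f = 0"
  using \<iota> is_hom_0[OF \<iota>(1)] by (metis injD)

text \<open>A function on pairs \<open>(\<xi>, b)\<close> packages a family of values at the points (\<open>b = False\<close>) together
  with a family of power series (\<open>b = True\<close>).\<close>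

definition lifts :: "((nat \<Rightarrow> 'a) \<times> bool \<Rightarrow> 'a fps) set" where
  "lifts = {f. \<forall>\<^sub>F \<xi> in U. f (\<xi>, False) = fps_const (fps_nth (f (\<xi>, True)) 0) \<and>
      f (\<xi>, True) \<in> fps_over L \<and> \<iota> (f (\<xi>, True)) \<in> \<Lambda>}"

definition coord :: "nat \<Rightarrow> ((nat \<Rightarrow> 'a) \<Rightarrow> 'a fps) \<Rightarrow> (nat \<Rightarrow> 'a) \<times> bool \<Rightarrow> 'a fps" where
  "coord i \<eta> = (\<lambda>(\<xi>, b). if b then \<eta> \<xi> else fps_const (\<xi> i))"

text \<open>The last clause is the invariant of the construction. Its converse comes from
  \<open>lifts\<close>, because the value at a point is the constant term of the series.\<close>

definition lifting_ring :: "((nat \<Rightarrow> 'a) \<times> bool \<Rightarrow> 'a fps) set \<Rightarrow> bool" where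
  "lifting_ring A \<longleftrightarrow> ring_closed A \<and> (\<forall>c\<in>L. (\<lambda>_. fps_const c) \<in> A) \<and> A \<subseteq> lifts \<and>
     (\<forall>f\<in>A. (\<forall>\<^sub>F \<xi> in U. f (\<xi>, False) = 0) \<longrightarrow> (\<forall>\<^sub>F \<xi> in U. f (\<xi>, True) = 0))"

lemma ring_closed_lifts: "ring_closed lifts"
proof -
  note R = ring_closed_fps_over[OF L]
  show ?thesis unfolding ring_closed_def
  proof (intro conjI ballI)
    show "0 \<in> lifts" "1 \<in> lifts"
      unfolding lifts_def using rc_0[OF R] rc_1[OF R] Sub_0[OF \<Lambda>(1)] Sub_1[OF \<Lambda>(1)] \<iota>
      by (auto simp: is_hom_simps)
    fix f assume f: "f \<in> lifts"
    then show "- f \<in> lifts" unfolding lifts_def mem_Collect_eq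
      by eventually_elim
         (use \<iota> in \<open>auto simp: is_hom_simps intro: rc_uminus[OF R] Sub_uminus[OF \<Lambda>(1)]\<close>)
    fix g assume g: "g \<in> lifts"
    show "f + g \<in> lifts" using f g unfolding lifts_def mem_Collect_eq
      by eventually_elim
         (use \<iota> in \<open>auto simp: is_hom_simps intro: rc_add[OF R] Sub_add[OF \<Lambda>(1)]\<close>)
    show "f * g \<in> lifts" using f g unfolding lifts_def mem_Collect_eq
      by eventually_elim
         (use \<iota> in \<open>auto simp: is_hom_simps intro: rc_mult[OF R] Sub_mult[OF \<Lambda>(1)]\<close>)
  qed
qed

lemma lifting_ring_adjoin:
  assumes A: "lifting_ring A" and y: "y \<in> lifts"
    and rel: "\<And>f. f \<in> polys_over A \<Longrightarrow> \<forall>\<^sub>F \<xi> in U. poly f y (\<xi>, False) = 0 \<Longrightarrow>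
      \<forall>\<^sub>F \<xi> in U. poly f y (\<xi>, True) = 0"
  shows "lifting_ring (adjoin A y)"
proof -
  have A': "ring_closed A" "A \<subseteq> lifts" "\<And>c. c \<in> L \<Longrightarrow> (\<lambda>_. fps_const c) \<in> A"
    using A by (auto simp: lifting_ring_def)
  show ?thesis unfolding lifting_ring_def
  proof (intro conjI ballI impI)
    show "ring_closed (adjoin A y)" using ring_closed_adjoin[OF A'(1)] .
    show "\<And>c. c \<in> L \<Longrightarrow> (\<lambda>_. fps_const c) \<in> adjoin A y" using A'(3) subset_adjoin_rc[OF A'(1)] by blast
    show "adjoin A y \<subseteq> lifts"
      unfolding adjoin_def using rc_poly[OF ring_closed_lifts _ y] polys_over_mono[OF A'(2)] by blast
    fix f assume "f \<in> adjoin A y" "\<forall>\<^sub>F \<xi> in U. f (\<xi>, False) = 0"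
    then show "\<forall>\<^sub>F \<xi> in U. f (\<xi>, True) = 0" using rel by (auto simp: adjoin_def)
  qed
qed

lemma poly_coord_False: "poly f (coord i \<eta>) (\<xi>, False) = poly f (coord i \<eta>') (\<xi>, False)"
  by (simp add: poly_fun_apply coord_def)

lemma coord_const_lifts: "i \<le> k \<Longrightarrow> coord i (\<lambda>\<xi>. fps_const (\<xi> i)) \<in> lifts"
  unfolding lifts_def mem_Collect_eq using U_L
  by (rule eventually_mono) (auto simp: coord_def fps_const_over[OF L] \<iota>_const)

lemma lifting_ring_coord:
  assumes A: "lifting_ring A" and i: "i \<le> k"
  shows "\<exists>\<eta>. lifting_ring (adjoin A (coord i \<eta>))"
proof -
  have A': "ring_closed A" "A \<subseteq> lifts"
    and A_transfer: "\<And>f. f \<in> A \<Longrightarrow> \<forall>\<^sub>F \<xi> in U. f (\<xi>, False) = 0 \<Longrightarrow> \<forall>\<^sub>F \<xi> in U. f (\<xi>, True) = 0"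
    using A by (auto simp: lifting_ring_def)
  define y where "y = coord i (\<lambda>\<xi>. fps_const (\<xi> i))"
  have y: "y \<in> lifts" using coord_const_lifts[OF i] by (simp add: y_def)
  show ?thesis
  proof (cases "\<exists>f\<in>polys_over A. (\<forall>\<^sub>F \<xi> in U. poly f y (\<xi>, False) = 0) \<and>
      (\<exists>j. \<not> (\<forall>\<^sub>F \<xi> in U. coeff f j (\<xi>, False) = 0))")
    case False
    have "lifting_ring (adjoin A y)"
    proof (rule lifting_ring_adjoin[OF A y])
      fix f assume f: "f \<in> polys_over A" "\<forall>\<^sub>F \<xi> in U. poly f y (\<xi>, False) = 0"
      \<comment> \<open>Every polynomial vanishing at the coordinate has coefficients that vanish at
        almost all points, and by the invariant of \<open>A\<close> so do their lifts; the lift of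
        the coordinate does not matter.\<close>
      then have "\<forall>\<^sub>F \<xi> in U. coeff f j (\<xi>, False) = 0" for j using False by blast
      then have "\<forall>\<^sub>F \<xi> in U. coeff f j (\<xi>, True) = 0" for j
        using A_transfer coeff_polys_over[OF f(1)] by blast
      then have "\<forall>\<^sub>F p in filtermap (\<lambda>\<xi>. (\<xi>, True)) U. poly f y p = 0"
        by (intro eventually_poly_fun_0) (simp add: eventually_filtermap)
      then show "\<forall>\<^sub>F \<xi> in U. poly f y (\<xi>, True) = 0" by (simp add: eventually_filtermap)
    qed
    then show ?thesis by (auto simp: y_def)
  next
    case True
    then obtain f j where f: "f \<in> polys_over A" "\<forall>\<^sub>F \<xi> in U. poly f y (\<xi>, False) = 0"
      "\<not> (\<forall>\<^sub>F \<xi> in U. coeff f j (\<xi>, False) = 0)" by blast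
    let ?U = "filtermap (\<lambda>\<xi>. (\<xi>, False)) U"
    obtain g where gA: "g \<in> polys_over A" and dg: "degree g > 0"
      and "\<forall>\<^sub>F p in ?U. poly g y p = 0" "\<forall>\<^sub>F p in ?U. lead_coeff g p \<noteq> 0"
      and "\<And>h j. h \<in> polys_over A \<Longrightarrow> degree h < degree g \<Longrightarrow> \<forall>\<^sub>F p in ?U. poly h y p = 0 \<Longrightarrow>
        \<forall>\<^sub>F p in ?U. coeff h j p = 0"
      by (rule minimal_relation[OF A'(1), of ?U f y j])
         (use ultra U_ne f in \<open>auto simp: eventually_filtermap filtermap_bot_iff\<close>)
    then have g0: "\<forall>\<^sub>F \<xi> in U. poly g y (\<xi>, False) = 0"
      and lc: "\<forall>\<^sub>F \<xi> in U. lead_coeff g (\<xi>, False) \<noteq> 0"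
      and minimal: "\<And>h j. h \<in> polys_over A \<Longrightarrow> degree h < degree g \<Longrightarrow>
        \<forall>\<^sub>F \<xi> in U. poly h y (\<xi>, False) = 0 \<Longrightarrow> \<forall>\<^sub>F \<xi> in U. coeff h j (\<xi>, False) = 0"
      by (simp_all add: eventually_filtermap)
    \<comment> \<open>In characteristic 0 the derivative is a nontrivial polynomial of smaller
      degree, so by minimality it does not vanish at \<open>y\<close>: the root is simple, as
      Hensel's lemma requires.\<close>
    have "coeff (formal_deriv g) (degree g - 1) (\<xi>, False) = of_nat (degree g) * lead_coeff g (\<xi>, False)" for \<xi>
      using dg by (simp add: coeff_formal_deriv del: of_nat_Suc)
    then have "\<forall>\<^sub>F \<xi> in U. coeff (formal_deriv g) (degree g - 1) (\<xi>, False) \<noteq> 0"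
      using lc dg by (auto elim: eventually_mono)
    moreover have fdA: "formal_deriv g \<in> polys_over A"
      using gA unfolding polys_over_def mem_Collect_eq coeff_formal_deriv
      by (intro allI rc_mult[OF A'(1)] rc_of_nat[OF A'(1)]) simp
    ultimately have deriv: "\<forall>\<^sub>F \<xi> in U. poly (formal_deriv g) y (\<xi>, False) \<noteq> 0"
      using minimal[OF fdA degree_formal_deriv[OF dg]] not_eventually_iff by metis
    \<comment> \<open>The relation with its coefficients replaced by their lifts; the lifted
      coordinate is to be a root with constant term \<open>\<xi> i\<close>. The arbitrary value of
      \<open>SOME\<close> for points without such a root concerns a \<open>U\<close>-negligible set
      only.\<close>
    define gt where "gt \<xi> = map_poly (\<lambda>c. c (\<xi>, True)) g" for \<xi>
    define \<eta> where "\<eta> \<xi> = (SOME z. z \<in> fps_over L \<and> poly (gt \<xi>) z = 0 \<and> fps_nth z 0 = \<xi> i)" for \<xi>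
    have lift_poly: "poly f y \<in> lifts" if "f \<in> polys_over A" for f
      using rc_poly[OF ring_closed_lifts _ y] polys_over_mono[OF A'(2)] that by blast
    have "\<forall>\<^sub>F \<xi> in U. \<forall>j\<in>{..degree g}. coeff g j (\<xi>, False) = fps_const (fps_nth (coeff g j (\<xi>, True)) 0) \<and>
      coeff g j (\<xi>, True) \<in> fps_over L \<and> \<iota> (coeff g j (\<xi>, True)) \<in> \<Lambda>"
      using coeff_polys_over[OF gA] A'(2) by (auto simp: eventually_ball_finite_distrib lifts_def)
    with U_L[OF i] lift_poly[OF gA, unfolded lifts_def mem_Collect_eq]
      lift_poly[OF fdA, unfolded lifts_def mem_Collect_eq] g0 lc deriv
    have \<eta>: "\<forall>\<^sub>F \<xi> in U. (\<eta> \<xi> \<in> fps_over L \<and> poly (gt \<xi>) (\<eta> \<xi>) = 0 \<and> fps_nth (\<eta> \<xi>) 0 = \<xi> i) \<and>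
        \<iota> (\<eta> \<xi>) \<in> \<Lambda> \<and> lead_coeff g (\<xi>, True) \<noteq> 0"
    proof eventually_elim
      case (elim \<xi>)
      have gt_coeff: "coeff (gt \<xi>) j = coeff g j (\<xi>, True)" for j
        by (simp add: gt_def coeff_map_poly)
      have gtL: "gt \<xi> \<in> polys_over (fps_over L)"
        unfolding polys_over_def mem_Collect_eq gt_coeff
      proof
        fix j show "coeff g j (\<xi>, True) \<in> fps_over L"
          using elim rc_0[OF ring_closed_fps_over[OF L]] by (cases "j \<le> degree g") (auto simp: coeff_eq_0)
      qed
      have yT: "y (\<xi>, True) = fps_const (\<xi> i)" by (simp add: y_def coord_def)
      have "fps_nth (poly (gt \<xi>) (fps_const (\<xi> i))) 0 = 0"
        using elim by (simp add: poly_fun_apply yT flip: gt_def)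
      moreover have "fps_nth (poly (pderiv (gt \<xi>)) (fps_const (\<xi> i))) 0 \<noteq> 0"
        using elim by (auto simp: poly_fun_apply yT map_formal_deriv_apply simp flip: gt_def)
      ultimately have "\<exists>z. z \<in> fps_over L \<and> poly (gt \<xi>) z = 0 \<and> fps_nth z 0 = \<xi> i"
        using hensel_fps[OF L gtL] elim by metis
      then have z: "\<eta> \<xi> \<in> fps_over L \<and> poly (gt \<xi>) (\<eta> \<xi>) = 0 \<and> fps_nth (\<eta> \<xi>) 0 = \<xi> i"
        unfolding \<eta>_def by (rule someI_ex)
      have lcT: "lead_coeff g (\<xi>, True) \<noteq> 0" using elim by auto
      \<comment> \<open>The coefficients of \<open>gt \<xi>\<close> are sent into \<Lambda>, which
        contains everything algebraic over it, in particular the image of the root.\<close>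
      have "alg_over \<Lambda> (\<iota> (\<eta> \<xi>))" unfolding alg_over_def
      proof (intro bexI conjI)
        show "poly (map_poly \<iota> (gt \<xi>)) (\<iota> (\<eta> \<xi>)) = 0"
          using is_hom_poly[OF \<iota>(1), of "gt \<xi>" "\<eta> \<xi>"] z is_hom_0[OF \<iota>(1)] by simp
        have ic: "coeff (map_poly \<iota> (gt \<xi>)) j = \<iota> (coeff g j (\<xi>, True))" for j
          by (simp add: coeff_map_poly is_hom_0[OF \<iota>(1)] gt_coeff)
        show "map_poly \<iota> (gt \<xi>) \<noteq> 0" using ic[of "degree g"] lcT \<iota>_eq_0 by fastforce
        show "map_poly \<iota> (gt \<xi>) \<in> polys_over \<Lambda>" unfolding polys_over_def mem_Collect_eq ic
        proof
          fix j show "\<iota> (coeff g j (\<xi>, True)) \<in> \<Lambda>"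
            using elim Sub_0[OF \<Lambda>(1)] is_hom_0[OF \<iota>(1)] by (cases "j \<le> degree g") (auto simp: coeff_eq_0)
        qed
      qed
      then show ?case using z lcT \<Lambda>(2) by blast
    qed
    define y' where "y' = coord i \<eta>"
    have yy': "poly f y (\<xi>, False) = poly f y' (\<xi>, False)" for f \<xi>
      unfolding y_def y'_def by (rule poly_coord_False)
    have "lifting_ring (adjoin A y')"
    proof (rule lifting_ring_adjoin[OF A])
      show "y' \<in> lifts" unfolding lifts_def mem_Collect_eq
        using \<eta> by eventually_elim (simp add: y'_def coord_def)
      fix f assume f: "f \<in> polys_over A" "\<forall>\<^sub>F \<xi> in U. poly f y' (\<xi>, False) = 0"
      have "\<forall>\<^sub>F p in filtermap (\<lambda>\<xi>. (\<xi>, True)) U. poly f y' p = 0"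
      proof (rule relations_transfer_adjoin[OF A'(1), of "filtermap (\<lambda>\<xi>. (\<xi>, False)) U" _ g])
        show "\<forall>\<^sub>F p in filtermap (\<lambda>\<xi>. (\<xi>, True)) U. poly g y' p = 0"
          unfolding eventually_filtermap using \<eta>
          by eventually_elim (simp add: poly_fun_apply y'_def coord_def gt_def)
        show "\<forall>\<^sub>F p in filtermap (\<lambda>\<xi>. (\<xi>, True)) U. lead_coeff g p \<noteq> 0"
          unfolding eventually_filtermap using \<eta> by eventually_elim simp
      qed (use gA dg g0 minimal A_transfer f in \<open>simp_all add: eventually_filtermap yy'\<close>)
      then show "\<forall>\<^sub>F \<xi> in U. poly f y' (\<xi>, True) = 0" by (simp add: eventually_filtermap)
    qed
    then show ?thesis by (auto simp: y'_def)
  qed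
qed

text \<open>A nonzero polynomial over \<open>L\<close> has finitely many roots, and
  \<open>U_0\<close> excludes each of them, so it cannot vanish at \<open>\<xi> 0\<close> for almost
  all \<xi>. The first coordinate thus has no relation over \<open>L\<close> and may be lifted to
  the nonconstant series \<open>\<xi> 0\<close> + X.\<close>

lemma lifting_ring_base: "lifting_ring (adjoin ((\<lambda>c _. fps_const c) ` L) (coord 0 (\<lambda>\<xi>. fps_const (\<xi> 0) + fps_X)))"
  (is "lifting_ring (adjoin ?A ?y)")
proof (rule lifting_ring_adjoin)
  have hom: "is_hom (\<lambda>c _. fps_const c :: 'a fps)" by (auto simp: is_hom_def fun_eq_iff)
  have rc: "ring_closed ?A" unfolding ring_closed_def
  proof (intro conjI ballI)
    let ?h = "(\<lambda>c _. fps_const c) :: 'a \<Rightarrow> (nat \<Rightarrow> 'a) \<times> bool \<Rightarrow> 'a fps"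
    have hom: "is_hom ?h" by (auto simp: is_hom_def fun_eq_iff)
    show "0 \<in> ?A" using Sub_0[OF L] is_hom_0[OF hom] by (intro image_eqI[of _ _ 0]) auto
    show "1 \<in> ?A" using Sub_1[OF L] is_hom_1[OF hom] by (intro image_eqI[of _ _ 1]) auto
    fix f assume "f \<in> ?A"
    then obtain a where a: "a \<in> L" "f = ?h a" by blast
    then show "- f \<in> ?A" using Sub_uminus[OF L] is_hom_uminus[OF hom, of a] by (intro image_eqI[of _ _ "- a"]) auto
    fix g assume "g \<in> ?A"
    then obtain b where b: "b \<in> L" "g = ?h b" by blast
    show "f + g \<in> ?A" using a b Sub_add[OF L] is_hom_add[OF hom, of a b] by (intro image_eqI[of _ _ "a + b"]) auto
    show "f * g \<in> ?A" using a b Sub_mult[OF L] is_hom_mult[OF hom, of a b] by (intro image_eqI[of _ _ "a * b"]) auto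
  qed
  show "lifting_ring ?A" unfolding lifting_ring_def
    using rc U_ne by (auto simp: lifts_def fps_const_over[OF L] \<iota>_const)
  show "?y \<in> lifts" unfolding lifts_def mem_Collect_eq
    using U_L[of 0, simplified]
  proof eventually_elim
    case (elim \<xi>)
    then show ?case using rc_add[OF ring_closed_fps_over[OF L]] fps_X_over[OF L] \<iota>_X \<iota>_const Sub_add[OF \<Lambda>(1)]
      by (auto simp: coord_def fps_const_over[OF L] is_hom_add[OF \<iota>(1)])
  qed
  fix f assume f: "f \<in> polys_over ?A" "\<forall>\<^sub>F \<xi> in U. poly f ?y (\<xi>, False) = 0"
  \<comment> \<open>The coefficients of \<open>f\<close> are constant functions whose value is a
    constant series, so any argument reads them off.\<close>
  define p where "p = map_poly (\<lambda>c. fps_nth (c undefined) 0) f"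
  have cf: "coeff f j = (\<lambda>_. fps_const (coeff p j))" for j
    using coeff_polys_over[OF f(1), of j] by (auto simp: p_def coeff_map_poly)
  have "poly f ?y (\<xi>, False) = fps_const (poly p (\<xi> 0))" for \<xi>
  proof -
    have "map_poly (\<lambda>c. c (\<xi>, False)) f = map_poly fps_const p"
      by (rule poly_eqI) (simp add: coeff_map_poly cf)
    then show ?thesis by (simp add: poly_fun_apply coord_def is_hom_poly[OF is_hom_fps_const])
  qed
  then have ev: "\<forall>\<^sub>F \<xi> in U. poly p (\<xi> 0) = 0" using f(2) by simp
  have "p = 0"
  proof (rule ccontr)
    assume "p \<noteq> 0"
    then have "finite {x. poly p x = 0}" by (rule poly_roots_finite)
    then have "\<forall>\<^sub>F \<xi> in U. \<forall>c\<in>{x. poly p x = 0}. \<xi> 0 \<noteq> c"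
      using U_0 by (intro eventually_ball_finite) auto
    with ev have "\<forall>\<^sub>F \<xi> in U. False" by eventually_elim auto
    then show False using U_ne by simp
  qed
  then have "f = 0" using cf by (intro poly_eqI) (simp add: fun_eq_iff)
  then show "\<forall>\<^sub>F \<xi> in U. poly f ?y (\<xi>, True) = 0" by simp
qed

lemma lifting_ring_coords:
  "n \<le> k \<Longrightarrow> \<exists>A \<eta>. lifting_ring A \<and> (\<forall>i\<le>n. coord i (\<eta> i) \<in> A) \<and> \<eta> 0 = (\<lambda>\<xi>. fps_const (\<xi> 0) + fps_X)"
proof (induction n)
  case 0
  let ?A = "adjoin ((\<lambda>c _. fps_const c) ` L) (coord 0 (\<lambda>\<xi>. fps_const (\<xi> 0) + fps_X))"
  have "ring_closed ((\<lambda>c _. fps_const c :: 'a fps) ` L :: ((nat \<Rightarrow> 'a) \<times> bool \<Rightarrow> 'a fps) set)"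
    using Sub_closed[OF L] unfolding ring_closed_def by (force simp: fun_eq_iff image_iff)
  then have "coord 0 (\<lambda>\<xi>. fps_const (\<xi> 0) + fps_X) \<in> ?A" by (rule in_adjoin_rc)
  then show ?case using lifting_ring_base by (intro exI[of _ ?A] exI[of _ "\<lambda>_ \<xi>. fps_const (\<xi> 0) + fps_X"]) simp
next
  case (Suc n)
  then obtain A \<eta> where A: "lifting_ring A" "\<forall>i\<le>n. coord i (\<eta> i) \<in> A" "\<eta> 0 = (\<lambda>\<xi>. fps_const (\<xi> 0) + fps_X)"
    by auto
  have rc: "ring_closed A" using A by (simp add: lifting_ring_def)
  obtain \<theta> where \<theta>: "lifting_ring (adjoin A (coord (Suc n) \<theta>))" using lifting_ring_coord[OF A(1) Suc.prems] by blast
  show ?case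
    by (rule exI[of _ "adjoin A (coord (Suc n) \<theta>)"], rule exI[of _ "\<eta>(Suc n := \<theta>)"])
       (use \<theta> A in_adjoin_rc[OF rc] subset_adjoin_rc[OF rc] in \<open>auto simp: le_Suc_eq\<close>)
qed

text \<open>Vanishing passes to the series by the invariant of \<open>lifting_ring\<close>;
  non-vanishing passes because the value at the point is the constant term of the series. The
  equivalence makes the result applicable to formulas with negations.\<close>

theorem generic_arc:
  assumes ts: "finite ts" "\<And>t. t \<in> ts \<Longrightarrow> set_rterm t \<subseteq> L \<and> tvars t \<subseteq> {..k}"
  shows "\<forall>\<^sub>F \<xi> in U. \<exists>\<eta>. \<eta> 0 = fps_const (\<xi> 0) + fps_X \<and> (\<forall>i\<le>k. \<eta> i \<in> fps_over L \<and> \<iota> (\<eta> i) \<in> \<Lambda>) \<and>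
     (\<forall>t\<in>ts. tval \<xi> t = 0 \<longleftrightarrow> tev fps_const \<eta> t = 0)"
proof -
  obtain A \<eta> where A: "lifting_ring A" "\<forall>i\<le>k. coord i (\<eta> i) \<in> A" "\<eta> 0 = (\<lambda>\<xi>. fps_const (\<xi> 0) + fps_X)"
    using lifting_ring_coords[of k] by blast
  have A': "ring_closed A" "A \<subseteq> lifts" "\<And>c. c \<in> L \<Longrightarrow> (\<lambda>_. fps_const c) \<in> A"
      "\<And>f. f \<in> A \<Longrightarrow> \<forall>\<^sub>F \<xi> in U. f (\<xi>, False) = 0 \<Longrightarrow> \<forall>\<^sub>F \<xi> in U. f (\<xi>, True) = 0"
    using A(1) by (auto simp: lifting_ring_def)
  have t_ev: "\<forall>\<^sub>F \<xi> in U. tval \<xi> t = 0 \<longleftrightarrow> tev fps_const (\<lambda>i. \<eta> i \<xi>) t = 0" if t: "t \<in> ts" for t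
  proof -
    define f where "f = tev (\<lambda>c _. fps_const c) (\<lambda>i. coord i (\<eta> i)) t"
    have fA: "f \<in> A" unfolding f_def
      using A(2) A'(3) ts(2)[OF t] by (intro tev_in_ring[OF A'(1)]) auto
    have fF: "f (\<xi>, False) = fps_const (tval \<xi> t)" for \<xi>
      by (simp add: f_def tev_fun_apply coord_def is_hom_tval[OF is_hom_fps_const])
    have fT: "f (\<xi>, True) = tev fps_const (\<lambda>i. \<eta> i \<xi>) t" for \<xi>
      by (simp add: f_def tev_fun_apply coord_def)
    show ?thesis
    proof (cases "\<forall>\<^sub>F \<xi> in U. f (\<xi>, False) = 0")
      case True
      with A'(4)[OF fA True] show ?thesis by eventually_elim (simp add: fF fT)
    next
      case False
      then have "\<forall>\<^sub>F \<xi> in U. f (\<xi>, False) \<noteq> 0" using not_eventually_iff by auto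
      moreover have "\<forall>\<^sub>F \<xi> in U. f (\<xi>, False) = fps_const (fps_nth (f (\<xi>, True)) 0)"
        using fA A'(2) by (auto simp: lifts_def elim: eventually_mono)
      ultimately show ?thesis by eventually_elim (auto simp: fF simp flip: fT)
    qed
  qed
  have "\<forall>\<^sub>F \<xi> in U. \<forall>i\<in>{..k}. \<eta> i \<xi> \<in> fps_over L \<and> \<iota> (\<eta> i \<xi>) \<in> \<Lambda>"
  proof (subst eventually_ball_finite_distrib, simp, intro ballI)
    fix i assume "i \<in> {..k}"
    then have "coord i (\<eta> i) \<in> lifts" using A(2) A'(2) by auto
    then show "\<forall>\<^sub>F \<xi> in U. \<eta> i \<xi> \<in> fps_over L \<and> \<iota> (\<eta> i \<xi>) \<in> \<Lambda>"
      unfolding lifts_def mem_Collect_eq by (rule eventually_mono) (simp add: coord_def)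
  qed
  moreover have "\<forall>\<^sub>F \<xi> in U. \<forall>t\<in>ts. tval \<xi> t = 0 \<longleftrightarrow> tev fps_const (\<lambda>i. \<eta> i \<xi>) t = 0"
    using t_ev ts(1) by (simp add: eventually_ball_finite_distrib)
  ultimately show ?thesis
  proof eventually_elim
    case (elim \<xi>)
    then show ?case using A(3) by (intro exI[of _ "\<lambda>i. \<eta> i \<xi>"]) auto
  qed
qed

end

section \<open>Polynomial rings and fraction fields\<close>

definition monomial_value :: "(nat \<Rightarrow> 'a::comm_ring_1) \<Rightarrow> (nat \<Rightarrow>\<^sub>0 nat) \<Rightarrow> 'a" where
  "monomial_value x t = (\<Prod>i\<in>Poly_Mapping.keys t. x i ^ Poly_Mapping.lookup t i)"

lemma monomial_value_superset:
  assumes "finite S" "Poly_Mapping.keys t \<subseteq> S"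
  shows "monomial_value x t = (\<Prod>i\<in>S. x i ^ Poly_Mapping.lookup t i)"
  unfolding monomial_value_def using assms
  by (intro prod.mono_neutral_left) (auto simp: in_keys_iff)

lemma monomial_value_add: "monomial_value x (s + t) = monomial_value x s * monomial_value x t"
proof -
  let ?S = "Poly_Mapping.keys s \<union> Poly_Mapping.keys t"
  have "monomial_value x (s + t) = (\<Prod>i\<in>?S. x i ^ Poly_Mapping.lookup (s + t) i)"
    by (rule monomial_value_superset) (use keys_add[of s t] in auto)
  also have "\<dots> = (\<Prod>i\<in>?S. x i ^ Poly_Mapping.lookup s i) * (\<Prod>i\<in>?S. x i ^ Poly_Mapping.lookup t i)"
    by (simp add: lookup_add power_add prod.distrib)
  also have "\<dots> = monomial_value x s * monomial_value x t"
    by (simp add: monomial_value_superset[of ?S])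
  finally show ?thesis .
qed

lemma mpeval_superset:
  assumes h: "is_hom h" and S: "finite S" "Poly_Mapping.keys p \<subseteq> S"
  shows "mpeval h x p = (\<Sum>t\<in>S. h (Poly_Mapping.lookup p t) * monomial_value x t)"
  unfolding mpeval_def monomial_value_def using S is_hom_0[OF h]
  by (intro sum.mono_neutral_left) (auto simp: in_keys_iff)

lemma mpeval_single: "is_hom h \<Longrightarrow> mpeval h x (Poly_Mapping.single t a) = h a * monomial_value x t"
  by (subst mpeval_superset[of h "{t}"]) auto

lemma mpeval_zero: "mpeval h x 0 = 0"
  by (simp add: mpeval_def)

lemma mpeval_add:
  assumes h: "is_hom h"
  shows "mpeval h x (p + q) = mpeval h x p + mpeval h x q"
proof -
  let ?S = "Poly_Mapping.keys p \<union> Poly_Mapping.keys q"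
  have "mpeval h x (p + q) = (\<Sum>t\<in>?S. h (Poly_Mapping.lookup (p + q) t) * monomial_value x t)"
    by (rule mpeval_superset[OF h]) (use keys_add[of p q] in auto)
  also have "\<dots> = (\<Sum>t\<in>?S. h (Poly_Mapping.lookup p t) * monomial_value x t)
      + (\<Sum>t\<in>?S. h (Poly_Mapping.lookup q t) * monomial_value x t)"
    by (simp add: lookup_add is_hom_add[OF h] algebra_simps sum.distrib)
  also have "\<dots> = mpeval h x p + mpeval h x q"
    by (simp add: mpeval_superset[OF h, of ?S])
  finally show ?thesis .
qed

lemma mpeval_sum: "is_hom h \<Longrightarrow> mpeval h x (sum f I) = (\<Sum>i\<in>I. mpeval h x (f i))"
  by (induction I rule: infinite_finite_induct) (auto simp: mpeval_zero mpeval_add)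

lemma mpoly_as_sum: "p = (\<Sum>t\<in>Poly_Mapping.keys p. Poly_Mapping.single t (Poly_Mapping.lookup p t))"
  by (rule poly_mapping_eqI) (auto simp: lookup_sum lookup_single when_def in_keys_iff)

lemma mpeval_mult:
  assumes h: "is_hom h"
  shows "mpeval h x (p * q) = mpeval h x p * mpeval h x q"
proof -
  have *: "mpeval h x (Poly_Mapping.single s a * q) = h a * monomial_value x s * mpeval h x q" for s a
  proof -
    have "Poly_Mapping.single s a * q =
      (\<Sum>t\<in>Poly_Mapping.keys q. Poly_Mapping.single (s + t) (a * Poly_Mapping.lookup q t))"
      by (subst mpoly_as_sum[of q]) (simp add: sum_distrib_left mult_single)
    then have "mpeval h x (Poly_Mapping.single s a * q) =
      (\<Sum>t\<in>Poly_Mapping.keys q. h a * monomial_value x s * (h (Poly_Mapping.lookup q t) * monomial_value x t))"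
      by (simp add: mpeval_sum[OF h] mpeval_single[OF h] monomial_value_add is_hom_mult[OF h] mult_ac)
    also have "\<dots> = h a * monomial_value x s * mpeval h x q"
      by (simp add: mpeval_superset[OF h, of "Poly_Mapping.keys q"] sum_distrib_left)
    finally show ?thesis .
  qed
  have "mpeval h x (p * q) = (\<Sum>t\<in>Poly_Mapping.keys p. mpeval h x (Poly_Mapping.single t (Poly_Mapping.lookup p t) * q))"
    by (subst mpoly_as_sum[of p]) (simp add: sum_distrib_right mpeval_sum[OF h])
  also have "\<dots> = mpeval h x p * mpeval h x q"
    by (simp add: * mpeval_superset[OF h, of "Poly_Mapping.keys p"] sum_distrib_right)
  finally show ?thesis .
qed

lemma mpeval_one: "is_hom h \<Longrightarrow> mpeval h x 1 = 1"
  by (simp add: mpeval_single is_hom_1 monomial_value_def flip: single_one)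

lemma is_hom_mpeval: "is_hom h \<Longrightarrow> is_hom (mpeval h x)"
  by (simp add: is_hom_def[of "mpeval h x"] mpeval_zero mpeval_one mpeval_add mpeval_mult)

abbreviation mvar :: "nat \<Rightarrow> 'k::field mpoly" where
  "mvar i \<equiv> Poly_Mapping.single (Poly_Mapping.single i (Suc 0)) 1"

lemma mpeval_mvar: "is_hom h \<Longrightarrow> mpeval h x (mvar i) = x i"
  by (simp add: mpeval_single monomial_value_def is_hom_1)

lemma mpeval_mconst: "is_hom h \<Longrightarrow> mpeval h x (mconst c) = h c"
  by (simp add: mpeval_single monomial_value_def)

lemma is_hom_mpeval_apply:
  assumes g: "is_hom g"
  shows "g (mpeval h x p) = mpeval (\<lambda>a. g (h a)) (\<lambda>i. g (x i)) p"
proof -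
  have sum: "g (sum f I) = (\<Sum>i\<in>I. g (f i))" for f :: "_ \<Rightarrow> _" and I
    by (induction I rule: infinite_finite_induct) (auto simp: is_hom_simps[OF g])
  have pow: "g (a ^ n) = g a ^ n" for a n by (induction n) (auto simp: is_hom_simps[OF g])
  have prod: "g (prod f I) = (\<Prod>i\<in>I. g (f i))" for f :: "_ \<Rightarrow> _" and I
    by (induction I rule: infinite_finite_induct) (auto simp: is_hom_simps[OF g])
  show ?thesis by (simp add: mpeval_def sum is_hom_mult[OF g] prod pow)
qed

lemma mpeval_cong:
  assumes "p \<in> carrier (mpoly_ring m)" "\<And>i. i < m \<Longrightarrow> x i = x' i"
  shows "mpeval h x p = mpeval h x' p"
  unfolding mpeval_def
proof (rule sum.cong)
  fix t assume "t \<in> Poly_Mapping.keys p"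
  then have "Poly_Mapping.keys t \<subseteq> {..<m}" using assms(1) by (auto simp: mpoly_ring_def)
  then show "h (Poly_Mapping.lookup p t) * (\<Prod>i\<in>Poly_Mapping.keys t. x i ^ Poly_Mapping.lookup t i) =
    h (Poly_Mapping.lookup p t) * (\<Prod>i\<in>Poly_Mapping.keys t. x' i ^ Poly_Mapping.lookup t i)"
    using assms(2) by (intro arg_cong2[of _ _ _ _ "(*)"] prod.cong) auto
qed simp

lemma mpeval_in_ring:
  assumes A: "ring_closed A" and h: "\<And>c. h c \<in> A" and x: "\<And>i. i < m \<Longrightarrow> x i \<in> A"
    and p: "p \<in> carrier (mpoly_ring m)"
  shows "mpeval h x p \<in> A"
proof -
  have pow: "a ^ n \<in> A" if "a \<in> A" for a n using that by (induction n) (auto intro: rc_1[OF A] rc_mult[OF A])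
  have prod: "(\<Prod>i\<in>I. f i) \<in> A" if "\<And>i. i \<in> I \<Longrightarrow> f i \<in> A" for f :: "nat \<Rightarrow> _" and I
    using that by (induction I rule: infinite_finite_induct) (auto intro: rc_1[OF A] rc_mult[OF A])
  show ?thesis unfolding mpeval_def
    using p by (intro rc_sum[OF A] rc_mult[OF A] h prod pow x) (auto simp: mpoly_ring_def)
qed

lemma mpoly_ring_sel:
  "p \<otimes>\<^bsub>mpoly_ring m\<^esub> q = p * q" "p \<oplus>\<^bsub>mpoly_ring m\<^esub> q = p + q"
  "\<one>\<^bsub>mpoly_ring m\<^esub> = 1" "\<zero>\<^bsub>mpoly_ring m\<^esub> = 0"
  by (simp_all add: mpoly_ring_def)

lemma cring_mpoly_ring: "cring (mpoly_ring m :: 'k::field mpoly ring)"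
proof -
  let ?R = "mpoly_ring m :: 'k mpoly ring"
  have car: "p \<in> carrier ?R \<longleftrightarrow> (\<forall>t\<in>Poly_Mapping.keys p. Poly_Mapping.keys t \<subseteq> {..<m})" for p
    by (simp add: mpoly_ring_def)
  have add: "p + q \<in> carrier ?R" if "p \<in> carrier ?R" "q \<in> carrier ?R" for p q
    using that keys_add[of p q] unfolding car by blast
  have mult: "p * q \<in> carrier ?R" if "p \<in> carrier ?R" "q \<in> carrier ?R" for p q
    unfolding car
  proof
    fix t assume "t \<in> Poly_Mapping.keys (p * q)"
    then obtain a b where "t = a + b" "a \<in> Poly_Mapping.keys p" "b \<in> Poly_Mapping.keys q"
      using keys_mult[of p q] by blast
    then show "Poly_Mapping.keys t \<subseteq> {..<m}" using that keys_add[of a b] unfolding car by blast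
  qed
  have um: "- p \<in> carrier ?R" if "p \<in> carrier ?R" for p
    using that unfolding car by (simp add: keys_minus)
  have one: "1 \<in> carrier ?R" and zero: "0 \<in> carrier ?R" unfolding car by auto
  show ?thesis
  proof (rule cringI)
    show "abelian_group ?R"
    proof (rule abelian_groupI)
      fix p assume "p \<in> carrier ?R"
      then show "\<exists>q\<in>carrier ?R. q \<oplus>\<^bsub>?R\<^esub> p = \<zero>\<^bsub>?R\<^esub>"
        using um by (intro bexI[of _ "- p"]) (auto simp: mpoly_ring_sel)
    qed (use add zero in \<open>auto simp: mpoly_ring_sel algebra_simps\<close>)
    show "comm_monoid ?R"
      by (rule comm_monoidI) (use mult one in \<open>auto simp: mpoly_ring_sel algebra_simps\<close>)
  qed (auto simp: mpoly_ring_sel algebra_simps)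
qed

lemma mconst_in_mpoly_ring: "mconst c \<in> carrier (mpoly_ring m)"
  by (auto simp: mpoly_ring_def)

lemma mvar_in_mpoly_ring: "i < m \<Longrightarrow> mvar i \<in> carrier (mpoly_ring m)"
  by (auto simp: mpoly_ring_def)

section \<open>Fraction fields modelled inside a given field\<close>

locale fraction_model =
  fixes D :: "('d, 'e) ring_scheme" (structure) and \<psi> :: "'d \<Rightarrow> 'o::field"
  assumes D: "cring D"
    and \<psi>: "\<psi> \<in> ring_hom D ring_of_type_algebra"
    and inj: "inj_on \<psi> (carrier D)"
begin

sublocale D: cring D by (rule D)

abbreviation "F \<equiv> fraction_field D"

text \<open>Elements of \<open>fraction_field\<close> are classes of pairs; naming a class by its
  value in \<open>'o\<close> replaces computation with representatives by computation with values.
  Outside \<open>fracs\<close> the set is empty, hence the side conditions below.\<close>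

definition fr :: "'o \<Rightarrow> ('d \<times> 'd) set" where
  "fr v = {(c, d). c \<in> carrier D \<and> d \<in> carrier D - {\<zero>} \<and> \<psi> c / \<psi> d = v}"

definition fracs :: "'o set" where
  "fracs = {\<psi> a / \<psi> b |a b. a \<in> carrier D \<and> b \<in> carrier D - {\<zero>}}"

lemma \<psi>_simps:
  "a \<in> carrier D \<Longrightarrow> b \<in> carrier D \<Longrightarrow> \<psi> (a \<otimes> b) = \<psi> a * \<psi> b"
  "a \<in> carrier D \<Longrightarrow> b \<in> carrier D \<Longrightarrow> \<psi> (a \<oplus> b) = \<psi> a + \<psi> b"
  "\<psi> \<one> = 1" "\<psi> \<zero> = 0" "a \<in> carrier D \<Longrightarrow> \<psi> (\<ominus> a) = - \<psi> a"
proof -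
  note h = ring_hom_mult[OF \<psi>] ring_hom_add[OF \<psi>] ring_hom_one[OF \<psi>]
  show m: "\<psi> (a \<otimes> b) = \<psi> a * \<psi> b" and a: "\<psi> (a \<oplus> b) = \<psi> a + \<psi> b"
    if "a \<in> carrier D" "b \<in> carrier D" for a b
    using h that by (simp_all add: ring_of_type_algebra_def)
  show "\<psi> \<one> = 1" using h by (simp add: ring_of_type_algebra_def)
  show z: "\<psi> \<zero> = 0" using a[of \<zero> \<zero>] by (metis D.zero_closed D.l_zero add_cancel_right_right)
  show "\<psi> (\<ominus> a) = - \<psi> a" if "a \<in> carrier D" for a
    using a[of a "\<ominus> a"] that z by (simp add: D.r_neg eq_neg_iff_add_eq_0 add.commute)
qed

lemma \<psi>_nonzero: "b \<in> carrier D - {\<zero>} \<Longrightarrow> \<psi> b \<noteq> 0"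
  using inj \<psi>_simps(4) by (metis D.zero_closed DiffE inj_on_eq_iff singletonI)

lemma nonzero_mult: "b \<in> carrier D - {\<zero>} \<Longrightarrow> d \<in> carrier D - {\<zero>} \<Longrightarrow> b \<otimes> d \<in> carrier D - {\<zero>}"
  using \<psi>_nonzero[of b] \<psi>_nonzero[of d] \<psi>_simps(1)[of b d] \<psi>_simps(4) by auto

lemma one_nonzero: "\<one> \<in> carrier D - {\<zero>}"
  using \<psi>_simps(3,4) by auto

lemma fraction_eq_fr:
  assumes "a \<in> carrier D" "b \<in> carrier D - {\<zero>}"
  shows "fraction D a b = fr (\<psi> a / \<psi> b)"
proof -
  have "a \<otimes> d = c \<otimes> b \<longleftrightarrow> \<psi> c / \<psi> d = \<psi> a / \<psi> b" if "c \<in> carrier D" "d \<in> carrier D - {\<zero>}" for c d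
  proof -
    have "a \<otimes> d = c \<otimes> b \<longleftrightarrow> \<psi> (a \<otimes> d) = \<psi> (c \<otimes> b)"
      using assms that by (intro inj_on_eq_iff[OF inj, symmetric]) auto
    then show ?thesis using assms that \<psi>_nonzero[of b] \<psi>_nonzero[of d] by (auto simp: \<psi>_simps field_simps)
  qed
  then show ?thesis unfolding fraction_def fr_def by auto
qed

lemma fr_nonempty: "v \<in> fracs \<Longrightarrow> \<exists>a b. (a, b) \<in> fr v"
  by (auto simp: fracs_def fr_def)

lemma fr_inj: "v \<in> fracs \<Longrightarrow> fr v = fr w \<longleftrightarrow> v = w"
  using fr_nonempty[of v] by (fastforce simp: fr_def)

lemma fracs_in_Sub: "fracs \<in> Sub"
proof -
  have "0 \<in> \<psi> ` carrier D" "1 \<in> \<psi> ` carrier D"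
    using imageI[OF D.zero_closed, of \<psi>] imageI[OF D.one_closed, of \<psi>] by (simp_all add: \<psi>_simps)
  then have "ring_closed (\<psi> ` carrier D)"
    unfolding ring_closed_def by (auto simp flip: \<psi>_simps(1,2,5))
  moreover have "fracs = {a / b |a b. a \<in> \<psi> ` carrier D \<and> b \<in> \<psi> ` carrier D \<and> b \<noteq> 0}"
    unfolding fracs_def using \<psi>_nonzero \<psi>_simps(4) by blast
  ultimately show ?thesis by (simp add: fractions_in_Sub)
qed

lemma carrier_F: "carrier F = fr ` fracs"
proof -
  have "carrier F = {fraction D a b |a b. a \<in> carrier D \<and> b \<in> carrier D - {\<zero>}}"
    by (simp add: fraction_field_def)
  also have "\<dots> = fr ` fracs"
    unfolding fracs_def using fraction_eq_fr by (auto simp: image_iff) blast+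
  finally show ?thesis .
qed

lemma fr_UN:
  assumes "v \<in> fracs" "w \<in> fracs"
    and "\<And>a b c d. (a, b) \<in> fr v \<Longrightarrow> (c, d) \<in> fr w \<Longrightarrow> f a b c d = Z"
  shows "(\<Union>(a, b)\<in>fr v. \<Union>(c, d)\<in>fr w. f a b c d) = Z"
  using fr_nonempty[OF assms(1)] fr_nonempty[OF assms(2)] assms(3) by fastforce

lemma F_sel:
  "v \<in> fracs \<Longrightarrow> w \<in> fracs \<Longrightarrow> fr v \<otimes>\<^bsub>F\<^esub> fr w = fr (v * w)"
  "v \<in> fracs \<Longrightarrow> w \<in> fracs \<Longrightarrow> fr v \<oplus>\<^bsub>F\<^esub> fr w = fr (v + w)"
  "\<one>\<^bsub>F\<^esub> = fr 1" "\<zero>\<^bsub>F\<^esub> = fr 0"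
proof -
  show "fr v \<otimes>\<^bsub>F\<^esub> fr w = fr (v * w)" if "v \<in> fracs" "w \<in> fracs"
    unfolding fraction_field_def monoid.select_convs
  proof (rule fr_UN[OF that])
    fix a b c d assume "(a, b) \<in> fr v" "(c, d) \<in> fr w"
    then show "fraction D (a \<otimes> c) (b \<otimes> d) = fr (v * w)"
      using nonzero_mult[of b d] by (subst fraction_eq_fr) (auto simp: fr_def \<psi>_simps)
  qed
  show "fr v \<oplus>\<^bsub>F\<^esub> fr w = fr (v + w)" if "v \<in> fracs" "w \<in> fracs"
    unfolding fraction_field_def ring_record_simps
  proof (rule fr_UN[OF that])
    fix a b c d assume ab: "(a, b) \<in> fr v" "(c, d) \<in> fr w"
    then have "\<psi> b \<noteq> 0" "\<psi> d \<noteq> 0" using \<psi>_nonzero by (auto simp: fr_def)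
    with ab have "\<psi> (a \<otimes> d \<oplus> c \<otimes> b) / \<psi> (b \<otimes> d) = v + w" by (auto simp: fr_def \<psi>_simps field_simps)
    then show "fraction D (a \<otimes> d \<oplus> c \<otimes> b) (b \<otimes> d) = fr (v + w)"
      using ab nonzero_mult[of b d] by (subst fraction_eq_fr) (auto simp: fr_def)
  qed
  show "\<one>\<^bsub>F\<^esub> = fr 1" "\<zero>\<^bsub>F\<^esub> = fr 0"
    using one_nonzero by (auto simp: fraction_field_def fraction_eq_fr \<psi>_simps)
qed

text \<open>The field structure of the subfield \<open>fracs\<close> is carried over along the
  isomorphism \<open>fr\<close>.\<close>

lemma field_F: "field F"
proof -
  define R where "R = (ring_of_type_algebra :: 'o ring)"
  interpret R: field R unfolding R_def by (rule field_from_type_algebra)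
  have R: "\<And>x y. x \<otimes>\<^bsub>R\<^esub> y = x * y" "\<And>x y. x \<oplus>\<^bsub>R\<^esub> y = x + y" "\<one>\<^bsub>R\<^esub> = 1" "\<zero>\<^bsub>R\<^esub> = 0"
    by (simp_all add: R_def ring_of_type_algebra_def)
  let ?S = "R\<lparr>carrier := fracs\<rparr>"
  have "subfield fracs R" using fracs_in_Sub by (simp add: Sub_def R_def)
  then have "field ?S" by (rule R.subfield_iff)
  moreover have "fr \<in> ring_iso ?S F"
  proof (rule ring_iso_memI)
    show "bij_betw fr (carrier ?S) (carrier F)"
      unfolding bij_betw_def carrier_F by (auto simp: inj_on_def fr_inj)
  qed (auto simp: carrier_F F_sel R)
  ultimately have "field (F\<lparr>zero := fr \<zero>\<^bsub>?S\<^esub>\<rparr>)"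
    by (rule field.ring_iso_imp_img_field)
  moreover have "F\<lparr>zero := fr \<zero>\<^bsub>?S\<^esub>\<rparr> = F"
    using F_sel(3,4) by (simp add: R fraction_field_def)
  ultimately show ?thesis by simp
qed

sublocale F: field F by (rule field_F)

lemma fr_closed: "v \<in> fracs \<Longrightarrow> fr v \<in> carrier F"
  by (simp add: carrier_F)

lemma fr_uminus: "v \<in> fracs \<Longrightarrow> \<ominus>\<^bsub>F\<^esub> fr v = fr (- v)"
  using Sub_uminus[OF fracs_in_Sub, of v] by (intro F.minus_equality) (auto simp: F_sel fr_closed)

lemma fr_inverse: "v \<in> fracs \<Longrightarrow> v \<noteq> 0 \<Longrightarrow> inv\<^bsub>F\<^esub> fr v = fr (inverse v)"
  using Sub_inverse[OF fracs_in_Sub, of v] by (intro F.comm_inv_char) (auto simp: F_sel fr_closed)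

lemma fr_eq_0: "v \<in> fracs \<Longrightarrow> fr v = \<zero>\<^bsub>F\<^esub> \<longleftrightarrow> v = 0"
  by (simp add: F_sel fr_inj)

lemma subfield_image:
  assumes K: "K \<in> Sub" "K \<subseteq> fracs"
  shows "subfield (fr ` K) F"
proof (rule F.subfieldI')
  have K': "\<And>x. x \<in> K \<Longrightarrow> x \<in> fracs" using K(2) by blast
  show "subring (fr ` K) F"
    by (rule F.subringI)
       (use K' Sub_closed[OF K(1)] in \<open>auto simp: F_sel fr_uminus carrier_F\<close>)
  show "inv\<^bsub>F\<^esub> k \<in> fr ` K" if "k \<in> fr ` K - {\<zero>\<^bsub>F\<^esub>}" for k
  proof -
    from that obtain x where x: "x \<in> K" "k = fr x" by blast
    then have "x \<noteq> 0" using that F_sel(4) by blast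
    then show ?thesis using x K' Sub_inverse[OF K(1)] by (simp add: fr_inverse)
  qed
qed

lemma subfield_preimage:
  assumes M: "subfield M F"
  shows "{v \<in> fracs. fr v \<in> M} \<in> Sub"
proof -
  note m = F.subring_props[OF M]
  have inv: "inv\<^bsub>F\<^esub> x \<in> M" if "x \<in> M" "x \<noteq> \<zero>\<^bsub>F\<^esub>" for x using F.subfield_m_inv(1)[OF M] that by auto
  show ?thesis unfolding Sub_iff
  proof (intro conjI ballI; (elim CollectE conjE)?, (intro CollectI conjI)?)
    show "0 \<in> fracs" "1 \<in> fracs" using Sub_closed[OF fracs_in_Sub] by auto
    show "fr 0 \<in> M" "fr 1 \<in> M" using m F_sel by auto
    fix x assume x: "x \<in> fracs" "fr x \<in> M"
    show "- x \<in> fracs" "inverse x \<in> fracs" using Sub_closed[OF fracs_in_Sub] x by auto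
    show "fr (- x) \<in> M" using m x fr_uminus by metis
    show "fr (inverse x) \<in> M" using inv[of "fr x"] x fr_inverse[of x] fr_eq_0[of x] by (cases "x = 0") auto
    fix y assume y: "y \<in> fracs" "fr y \<in> M"
    show "x + y \<in> fracs" "x * y \<in> fracs" using Sub_closed[OF fracs_in_Sub] x y by auto
    show "fr (x + y) \<in> M" "fr (x * y) \<in> M" using m x y F_sel by metis+
  qed
qed

text \<open>Images and preimages under \<open>fr\<close> of subfields are subfields, so least
  subfields correspond.\<close>

lemma generate_field_fr:
  assumes H: "H \<subseteq> fracs"
  shows "generate_field F (fr ` H) = fr ` field_gen H"
proof
  have g: "field_gen H \<subseteq> fracs" using field_gen_least[OF fracs_in_Sub H] .
  show "generate_field F (fr ` H) \<subseteq> fr ` field_gen H"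
    using F.generate_field_min_subfield1[OF _ subfield_image[OF field_gen_in_Sub g], of "fr ` H"]
      field_gen_superset[of H] H carrier_F by blast
  have "subfield (generate_field F (fr ` H)) F"
    using H carrier_F by (intro F.generate_field_is_subfield) auto
  then have "field_gen H \<subseteq> {v \<in> fracs. fr v \<in> generate_field F (fr ` H)}"
    using H by (intro field_gen_least subfield_preimage) (auto intro: generate_field.incl)
  then show "fr ` field_gen H \<subseteq> generate_field F (fr ` H)" by blast
qed

lemma eval_fr:
  assumes "set p \<subseteq> fracs" "x \<in> fracs"
  shows "F.eval (map fr p) (fr x) = fr (poly (Poly (rev p)) x)"
  using assms(1)
proof (induction p)
  case (Cons a p)
  have pow: "fr x [^]\<^bsub>F\<^esub> n = fr (x ^ n)" for n :: nat
    using assms(2) Sub_power[OF fracs_in_Sub assms(2)] by (induction n) (auto simp: F_sel mult.commute)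
  have "poly (Poly (rev p)) x \<in> fracs"
    using Cons.prems Sub_0[OF fracs_in_Sub] assms(2)
    by (intro poly_polys_over[OF fracs_in_Sub]) (auto simp: polys_over_def nth_default_def subset_iff rev_nth)
  then show ?case using Cons assms(2) Sub_power[OF fracs_in_Sub assms(2)]
    by (auto simp: pow F_sel Poly_append poly_monom Sub_mult[OF fracs_in_Sub] add.commute mult.commute)
qed (simp add: F_sel)

text \<open>Lets algebraicity and transcendence in a function field be decided inside
  \<open>'o\<close>.\<close>

lemma algebraic_fr:
  assumes K: "K \<in> Sub" "K \<subseteq> fracs" and x: "x \<in> fracs"
  shows "(F.algebraic over (fr ` K)) (fr x) \<longleftrightarrow> alg_over K x"
proof
  assume "(F.algebraic over (fr ` K)) (fr x)"
  then obtain q where q: "q \<in> carrier ((fr ` K)[X]\<^bsub>F\<^esub>)" "q \<noteq> []" "F.eval q (fr x) = \<zero>\<^bsub>F\<^esub>"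
    using F.algebraicE[OF subfieldE(1)[OF subfield_image[OF K]] fr_closed[OF x]] by metis
  have q': "set q \<subseteq> fr ` K" "hd q \<noteq> \<zero>\<^bsub>F\<^esub>" using q by (auto simp: univ_poly_def polynomial_def)
  from q'(1) have "q \<in> lists (fr ` K)" by (simp add: lists_eq_set)
  then have "q \<in> map fr ` lists K" by (simp only: lists_image)
  then obtain p where p: "q = map fr p" "set p \<subseteq> K" by (auto simp: lists_eq_set)
  have P: "Poly (rev p) \<in> polys_over K"
    using p Sub_0[OF K(1)] by (auto simp: polys_over_def nth_default_def subset_iff rev_nth)
  have "Poly (rev p) \<noteq> 0"
  proof
    assume "Poly (rev p) = 0"
    then obtain n where "rev p = replicate n 0" by (auto simp: Poly_eq_0)
    then have "hd p = 0" using p(1) q(2) by (metis hd_in_set in_set_replicate set_rev list.map_disc_iff)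
    then show False using q'(2) p(1) q(2) F_sel by (auto simp: hd_map)
  qed
  moreover have "poly (Poly (rev p)) x = 0"
  proof -
    have "fr (poly (Poly (rev p)) x) = \<zero>\<^bsub>F\<^esub>" using q(3) p K x by (simp add: eval_fr)
    moreover have "poly (Poly (rev p)) x \<in> fracs"
      using P polys_over_mono[OF K(2)] x poly_polys_over[OF fracs_in_Sub] by blast
    ultimately show ?thesis by (simp add: fr_eq_0)
  qed
  ultimately show "alg_over K x" using P by (auto simp: alg_over_def)
next
  assume "alg_over K x"
  then obtain p where p: "p \<in> polys_over K" "p \<noteq> 0" "poly p x = 0" by (auto simp: alg_over_def)
  have sp: "set (coeffs p) \<subseteq> K" using p(1) by (auto simp: coeffs_def polys_over_def)
  have "map fr (rev (coeffs p)) \<in> carrier ((fr ` K)[X]\<^bsub>F\<^esub>)"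
    using sp p K(2) fr_eq_0[of "lead_coeff p"]
    by (auto simp: univ_poly_def polynomial_def hd_map hd_rev last_coeffs_eq_coeff_degree polys_over_def)
  moreover have "F.eval (map fr (rev (coeffs p))) (fr x) = \<zero>\<^bsub>F\<^esub>"
    using sp K(2) x p(3) by (subst eval_fr) (auto simp: F_sel)
  ultimately show "(F.algebraic over (fr ` K)) (fr x)"
    using p(2) by (intro F.algebraicI) auto
qed

end

section \<open>Specialisations with a rational root form a thin set\<close>

lemma is_hom_of_rat: "is_hom (of_rat :: rat \<Rightarrow> 'a::field_char_0)"
  by (auto simp: is_hom_def of_rat_add of_rat_mult)

definition ev2 :: "('k::field \<Rightarrow> 'a::comm_ring_1) \<Rightarrow> 'a \<Rightarrow> 'a \<Rightarrow> 'k poly poly \<Rightarrow> 'a" where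
  "ev2 h t x p = poly (map_poly (\<lambda>q. poly (map_poly h q) t) p) x"

lemma is_hom_ev2: "is_hom h \<Longrightarrow> is_hom (ev2 h t x)"
  unfolding ev2_def by (intro is_hom_poly_map)

text \<open>Coordinate 0 becomes the parameter, kept in the coefficients, and any other coordinate
  the outer variable, so that polynomials can be divided with respect to the outer variable.\<close>

definition bivar :: "'k::field mpoly \<Rightarrow> 'k poly poly" where
  "bivar = mpeval (\<lambda>a. [:[:a:]:]) (\<lambda>i. if i = 0 then [:[:0, 1:]:] else [:0, 1:])"

lemma ev2_bivar:
  assumes h: "is_hom h"
  shows "ev2 h t x (bivar p) = mpeval h (\<lambda>i. if i = 0 then t else x) p"
proof -
  have "ev2 h t x [:[:a:]:] = h a" for a
    using is_hom_0[OF h] by (simp add: ev2_def map_poly_pCons)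
  moreover have "ev2 h t x [:[:0, 1:]:] = t" "ev2 h t x [:0, 1:] = x"
    using is_hom_0[OF h] is_hom_1[OF h] by (simp_all add: ev2_def map_poly_pCons one_pCons)
  ultimately show ?thesis
    unfolding bivar_def is_hom_mpeval_apply[OF is_hom_ev2[OF h]] by (simp add: if_distrib cong: if_cong)
qed

lemma field_gen_single_subset:
  "field_gen {T :: 'a::field_char_0} \<subseteq>
     {poly (map_poly of_rat p) T / poly (map_poly of_rat q) T | p q. poly (map_poly of_rat q) T \<noteq> 0}"
  (is "_ \<subseteq> ?K")
proof (rule field_gen_least)
  let ?e = "\<lambda>p. poly (map_poly of_rat p) T"
  have "is_hom ?e" by (rule is_hom_poly_map[OF is_hom_of_rat])
  then have "{a / b |a b. a \<in> range ?e \<and> b \<in> range ?e \<and> b \<noteq> 0} \<in> Sub"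
    by (intro fractions_in_Sub ring_closed_range)
  moreover have "{a / b |a b. a \<in> range ?e \<and> b \<in> range ?e \<and> b \<noteq> 0} = ?K" by blast
  ultimately show "?K \<in> Sub" by simp
  have "T = ?e [:0, 1:] / ?e 1 \<and> ?e 1 \<noteq> 0" by (simp add: map_poly_pCons)
  then show "{T} \<subseteq> ?K" by blast
qed

lemma poly_map_of_rat_field_gen: "poly (map_poly of_rat q) T \<in> field_gen {T :: 'a::field_char_0}"
  using Sub_of_rat[OF field_gen_in_Sub] field_gen_superset[of "{T}"]
  by (intro poly_polys_over[OF field_gen_in_Sub]) (auto simp: polys_over_def coeff_map_poly)

text \<open>\<open>c\<close> is integral over Q[T] with minimal polynomial \<open>m\<close> over
  Q(T), minimality being stated over Q[T]; on constant polynomials it says that \<open>T\<close> is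
  transcendental. As \<open>m\<close> is monic in the outer variable, division by it stays over
  Q[T], and its degree does not drop at any value of the parameter.\<close>

locale integral_element =
  fixes T c :: "'o::field_char_0" and m :: "rat poly poly"
  assumes monic: "lead_coeff m = 1" and deg: "degree m \<ge> 2"
    and root: "ev2 of_rat T c m = 0"
    and minimal: "\<And>p. p \<noteq> 0 \<Longrightarrow> degree p < degree m \<Longrightarrow> ev2 of_rat T c p \<noteq> 0"
begin

definition \<Psi> :: "rat mpoly \<Rightarrow> 'o" where
  "\<Psi> = mpeval of_rat (\<lambda>i. if i = 0 then T else c)"

abbreviation "S \<equiv> (ring_of_type_algebra :: 'o ring)"

text \<open>The ideal of the plane curve with generic point (T, c); it is prime because \<Psi> maps
  to a field.\<close>

definition P :: "rat mpoly set" where "P = a_kernel (mpoly_ring 2) S \<Psi>"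

lemma S_sel: "carrier S = UNIV" "x \<otimes>\<^bsub>S\<^esub> y = x * y" "x \<oplus>\<^bsub>S\<^esub> y = x + y" "\<one>\<^bsub>S\<^esub> = 1" "\<zero>\<^bsub>S\<^esub> = 0"
  by (simp_all add: ring_of_type_algebra_def)

lemma is_hom_\<Psi>: "is_hom \<Psi>"
  unfolding \<Psi>_def by (rule is_hom_mpeval[OF is_hom_of_rat])

lemma hom: "ring_hom_ring (mpoly_ring 2) S \<Psi>"
proof (rule ring_hom_ringI2)
  show "ring S" by (rule ring_from_type_algebra)
  show "ring (mpoly_ring 2 :: rat mpoly ring)" by (rule cring.axioms(1)[OF cring_mpoly_ring])
  show "\<Psi> \<in> ring_hom (mpoly_ring 2) S"
    by (rule ring_hom_memI)
      (simp_all only: S_sel mpoly_ring_sel is_hom_mult[OF is_hom_\<Psi>] is_hom_add[OF is_hom_\<Psi>]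
        is_hom_1[OF is_hom_\<Psi>] UNIV_I)
qed

lemma P_iff: "p \<in> P \<longleftrightarrow> p \<in> carrier (mpoly_ring 2) \<and> \<Psi> p = 0"
  by (simp add: P_def a_kernel_def' S_sel)

lemma primeideal_P: "primeideal P (mpoly_ring 2)"
proof (rule primeidealI)
  show "ideal P (mpoly_ring 2)" unfolding P_def by (rule ring_hom_ring.kernel_is_ideal[OF hom])
  have "(1 :: rat mpoly) \<notin> P" using is_hom_1[OF is_hom_\<Psi>] by (simp add: P_iff)
  then show "carrier (mpoly_ring 2) \<noteq> P" using monoid.one_closed[OF ring.is_monoid[OF cring.axioms(1)[OF cring_mpoly_ring]], of 2] by (auto simp: mpoly_ring_sel)
  show "a \<in> P \<or> b \<in> P"
    if "a \<in> carrier (mpoly_ring 2)" "b \<in> carrier (mpoly_ring 2)" "a \<otimes>\<^bsub>mpoly_ring 2\<^esub> b \<in> P" for a b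
    using that by (auto simp: P_iff mpoly_ring_sel is_hom_mult[OF is_hom_\<Psi>])
qed (rule cring_mpoly_ring)

text \<open>\<Psi> is constant on the cosets of its kernel, and \<open>the_elem\<close> reads off
  the value. This embeds the coordinate ring of the curve in \<open>'o\<close>, and
  \<open>fracs\<close> is the field Q(T, c).\<close>

interpretation fm: fraction_model "coordinate_ring 2 P" "\<lambda>Y. the_elem (\<Psi> ` Y)"
proof (rule fraction_model.intro)
  show "cring (coordinate_ring 2 P)"
    unfolding coordinate_ring_def P_def by (intro ideal.quotient_is_cring ring_hom_ring.kernel_is_ideal[OF hom] cring_mpoly_ring)
  show "(\<lambda>Y. the_elem (\<Psi> ` Y)) \<in> ring_hom (coordinate_ring 2 P) ring_of_type_algebra"
    unfolding coordinate_ring_def P_def by (rule ring_hom_ring.the_elem_hom[OF hom])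
  show "inj_on (\<lambda>Y. the_elem (\<Psi> ` Y)) (carrier (coordinate_ring 2 P))"
    unfolding coordinate_ring_def P_def by (rule inj_onI) (rule ring_hom_ring.the_elem_inj[OF hom])
qed

lemma function_field_eq: "function_field 2 P = fm.F"
  by (simp add: function_field_def)

lemma regular_fun_eq:
  assumes p: "p \<in> carrier (mpoly_ring 2)"
  shows "regular_fun 2 P p = fm.fr (\<Psi> p)" "\<Psi> p \<in> fm.fracs"
proof -
  let ?X = "P +>\<^bsub>mpoly_ring 2\<^esub> p"
  have X: "?X \<in> carrier (coordinate_ring 2 P)"
    using p unfolding coordinate_ring_def FactRing_def by (auto simp: A_RCOSETS_def' )
  have \<psi>X: "the_elem (\<Psi> ` ?X) = \<Psi> p" unfolding P_def by (rule ring_hom_ring.the_elem_simp[OF hom p])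
  show "regular_fun 2 P p = fm.fr (\<Psi> p)"
    unfolding regular_fun_def using fm.fraction_eq_fr[OF X fm.one_nonzero] by (simp add: \<psi>X fm.\<psi>_simps)
  have "the_elem (\<Psi> ` ?X) / the_elem (\<Psi> ` \<one>\<^bsub>coordinate_ring 2 P\<^esub>) \<in> fm.fracs"
    unfolding fm.fracs_def using X fm.one_nonzero by blast
  then show "\<Psi> p \<in> fm.fracs" by (simp add: \<psi>X fm.\<psi>_simps)
qed

lemma \<Psi>_simps: "\<Psi> (mvar 0) = T" "\<Psi> (mvar (Suc 0)) = c" "\<Psi> (mconst q) = of_rat q"
  unfolding \<Psi>_def by (simp_all add: mpeval_mvar[OF is_hom_of_rat] mpeval_mconst[OF is_hom_of_rat])

lemma T_fracs: "T \<in> fm.fracs" and c_fracs: "c \<in> fm.fracs"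
  using regular_fun_eq(2)[OF mvar_in_mpoly_ring, of 0] regular_fun_eq(2)[OF mvar_in_mpoly_ring, of "Suc 0"]
  by (simp_all add: \<Psi>_simps)

lemma fracs_least:
  assumes L: "L \<in> Sub" "T \<in> L" "c \<in> L"
  shows "fm.fracs \<subseteq> L"
proof -
  have "\<Psi> p \<in> L" if "p \<in> carrier (mpoly_ring 2)" for p
    unfolding \<Psi>_def
    by (rule mpeval_in_ring[OF ring_closed_Sub[OF L(1)] _ _ that]) (use L Sub_of_rat in auto)
  moreover have "\<exists>p\<in>carrier (mpoly_ring 2). the_elem (\<Psi> ` Y) = \<Psi> p" if "Y \<in> carrier (coordinate_ring 2 P)" for Y
    using ring_hom_ring.the_elem_wf'[OF hom, of Y] that unfolding coordinate_ring_def P_def by auto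
  ultimately have "the_elem (\<Psi> ` Y) \<in> L" if "Y \<in> carrier (coordinate_ring 2 P)" for Y
    using that by metis
  then show ?thesis unfolding fm.fracs_def using Sub_divide[OF L(1)] by blast
qed

lemma constant_funs_eq: "constant_funs 2 P = fm.fr ` \<rat>"
  unfolding constant_funs_def Rats_def image_image
  by (simp add: regular_fun_eq(1)[OF mconst_in_mpoly_ring] \<Psi>_simps)

lemma Rats_fracs: "\<rat> \<subseteq> fm.fracs"
  by (rule Rats_subset_Sub[OF fm.fracs_in_Sub])

lemma T_transcendental: "poly (map_poly of_rat q) T \<noteq> 0" if "q \<noteq> 0"
  using minimal[of "[:q:]"] that deg by (simp add: ev2_def map_poly_pCons)

abbreviation "k0 \<equiv> field_gen {T}"

lemma k0: "k0 \<in> Sub" "k0 \<subseteq> fm.fracs"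
  using field_gen_in_Sub field_gen_least[OF fm.fracs_in_Sub] T_fracs by auto

lemma generate_k0: "generate_field fm.F (fm.fr ` (\<rat> \<union> {T})) = fm.fr ` k0"
proof -
  have "field_gen (\<rat> \<union> {T}) = k0"
    using field_gen_least[OF k0(1), of "\<rat> \<union> {T}"] field_gen_mono[of "{T}" "\<rat> \<union> {T}"]
      field_gen_superset[of "{T}"] Rats_subset_Sub[OF k0(1)] by blast
  then show ?thesis using fm.generate_field_fr[of "\<rat> \<union> {T}"] Rats_fracs T_fracs by simp
qed

lemma alg_c: "alg_over k0 c"
proof -
  let ?h = "\<lambda>q. poly (map_poly of_rat q) T"
  have co: "coeff (map_poly ?h m) i = ?h (coeff m i)" for i by (simp add: coeff_map_poly)
  have "map_poly ?h m \<in> polys_over k0" unfolding polys_over_def mem_Collect_eq co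
    using poly_map_of_rat_field_gen by blast
  moreover have "map_poly ?h m \<noteq> 0" using co[of "degree m"] monic by (auto simp: map_poly_1')
  ultimately show ?thesis using root by (auto simp: alg_over_def ev2_def)
qed

text \<open>If c = p / q, then q X - p has degree 1 over Q[T] and vanishes at \<open>c\<close>,
  against minimality.\<close>

lemma c_notin_k0: "c \<notin> k0"
proof
  assume "c \<in> k0"
  then obtain p q where pq: "c = poly (map_poly of_rat p) T / poly (map_poly of_rat q) T"
      "poly (map_poly of_rat q) T \<noteq> 0"
    using field_gen_single_subset by blast
  then have "q \<noteq> 0" by auto
  then have "degree [:- p, q:] = 1" "[:- p, q:] \<noteq> 0" by auto
  moreover have "ev2 of_rat T c [:- p, q:] = 0"
    using pq is_hom_uminus[OF is_hom_poly_map[OF is_hom_of_rat], of p T]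
    by (simp add: ev2_def map_poly_pCons)
  ultimately show False using minimal[of "[:- p, q:]"] deg by auto
qed

text \<open>\<open>T\<close> alone is a transcendence basis: since \<open>T\<close> and
  \<open>c\<close> are algebraic over Q(T), so is all of Q(T, c).\<close>

lemma has_dimension_P: "has_dimension 2 P 1"
  unfolding has_dimension_def
proof (intro exI conjI)
  show "finite {fm.fr T}" "card {fm.fr T} = 1" by auto
  have un: "fm.fr ` \<rat> \<union> {fm.fr T} = fm.fr ` (\<rat> \<union> {T})" by auto
  have gQ: "generate_field fm.F (fm.fr ` \<rat>) = fm.fr ` \<rat>"
    using fm.generate_field_fr[OF Rats_fracs] field_gen_least[OF Rats_in_Sub, of \<rat>] field_gen_superset[of \<rat>]
    by auto
  have "\<not> alg_over \<rat> T"
  proof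
    assume "alg_over \<rat> T"
    then obtain p where p: "p \<in> polys_over \<rat>" "p \<noteq> 0" "poly p T = 0" by (auto simp: alg_over_def)
    \<comment> \<open>The polynomial \<open>p\<close> transported to the type \<open>rat\<close>;
      the definite description inverts \<open>of_rat\<close>.\<close>
    define q where "q = map_poly (\<lambda>x. THE y. of_rat y = x) p"
    have inv: "(THE y. of_rat y = (of_rat x :: 'o)) = x" for x by auto
    have "(THE y. of_rat y = (0 :: 'o)) = 0" using inv[of 0] by simp
    then have "coeff q i = (THE y. of_rat y = coeff p i)" for i by (simp add: q_def coeff_map_poly)
    then have "of_rat (coeff q i) = coeff p i" for i
      using coeff_polys_over[OF p(1), of i] inv by (auto simp: Rats_def)
    then have "p = map_poly of_rat q" by (intro poly_eqI) (simp add: coeff_map_poly)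
    then show False using p T_transcendental[of q] by (cases "q = 0") auto
  qed
  then have tr: "(fm.F.transcendental over (fm.fr ` \<rat>)) (fm.fr T)"
    using fm.algebraic_fr[OF Rats_in_Sub Rats_fracs T_fracs] by (simp add: over_def)
  have "(fm.F.algebraic over (fm.fr ` k0)) x" if "x \<in> carrier fm.F" for x
  proof -
    obtain v where v: "v \<in> fm.fracs" "x = fm.fr v" using \<open>x \<in> carrier fm.F\<close> fm.carrier_F by blast
    have "fm.fracs \<subseteq> {x. alg_over k0 x}"
      using alg_c alg_over_self[OF k0(1), of T] field_gen_superset[of "{T}"]
      by (intro fracs_least algebraics_in_Sub k0) auto
    then show ?thesis using fm.algebraic_fr[OF k0 v(1)] v by auto
  qed
  then show "transcendence_basis (function_field 2 P) (constant_funs 2 P) {fm.fr T}"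
    unfolding transcendence_basis_def function_field_eq constant_funs_eq un generate_k0
    using T_fracs fm.fr_closed gQ tr by auto
qed

text \<open>Q(T, c) is the simple extension Q(T)[c], so its dimension is the degree of the
  irreducible polynomial of \<open>c\<close>, which is one less than the length of the coefficient
  list. Degree 1 would put \<open>c\<close> in Q(T).\<close>

lemma has_degree_P: "\<exists>d\<ge>2. has_degree 2 P 1 (\<lambda>_. mvar 0) d"
proof -
  let ?K = "fm.fr ` k0"
  have K: "subfield ?K fm.F" by (rule fm.subfield_image[OF k0])
  have x: "fm.fr c \<in> carrier fm.F" using c_fracs by (rule fm.fr_closed)
  have alg: "(fm.F.algebraic over ?K) (fm.fr c)" using fm.algebraic_fr[OF k0 c_fracs] alg_c by simp
  define M where "M = fm.F.simple_extension ?K (fm.fr c)"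
  have M: "subfield M fm.F"
    unfolding M_def using fm.F.simple_extension_is_subfield[OF K x] alg by simp
  have "fm.fracs \<subseteq> {v \<in> fm.fracs. fm.fr v \<in> M}"
  proof (rule fracs_least[OF fm.subfield_preimage[OF M]])
    have "?K \<subseteq> M" "fm.fr c \<in> M" unfolding M_def
      using fm.F.simple_extension_incl[OF subfieldE(3)[OF K] x]
        fm.F.simple_extension_mem[OF subfieldE(1)[OF K] x] by auto
    then show "T \<in> {v \<in> fm.fracs. fm.fr v \<in> M}" "c \<in> {v \<in> fm.fracs. fm.fr v \<in> M}"
      using T_fracs c_fracs field_gen_superset[of "{T}"] by auto
  qed
  then have M_eq: "M = carrier fm.F" using subfieldE(3)[OF M] fm.carrier_F by auto
  define p where "p = fm.F.Irr ?K (fm.fr c)"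
  have dim: "fm.F.dimension (length p - 1) ?K (carrier fm.F)"
    using fm.F.dimension_simple_extension[OF K x alg] M_eq by (simp add: M_def p_def)
  have p: "p \<in> carrier (?K[X]\<^bsub>fm.F\<^esub>)" "fm.F.eval p (fm.fr c) = \<zero>\<^bsub>fm.F\<^esub>"
    using fm.F.IrrE[OF K x alg] by (auto simp: p_def)
  have "length p - 1 \<ge> 1"
    unfolding p_def by (rule fm.F.pirreducible_degree[OF K fm.F.IrrE(1,2)[OF K x alg]])
  moreover have "length p \<noteq> 2"
  proof
    assume "length p = 2"
    then obtain u v where uv: "p = [u, v]" by (auto simp: numeral_2_eq_2 length_Suc_conv)
    then have uvK: "u \<in> ?K" "v \<in> ?K" "u \<noteq> \<zero>\<^bsub>fm.F\<^esub>" using p(1) by (auto simp: univ_poly_def polynomial_def)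
    obtain a b where ab: "a \<in> k0" "b \<in> k0" "u = fm.fr a" "v = fm.fr b" using uvK by blast
    then have ab': "a \<in> fm.fracs" "b \<in> fm.fracs" "a \<noteq> 0" using k0 uvK(3) fm.fr_eq_0 by auto
    have "fm.F.eval (map fm.fr [a, b]) (fm.fr c) = fm.fr (poly (Poly (rev [a, b])) c)"
      using ab' c_fracs by (intro fm.eval_fr) auto
    then have "fm.fr (b + c * a) = \<zero>\<^bsub>fm.F\<^esub>" using p(2) by (simp add: uv ab)
    moreover have "b + c * a \<in> fm.fracs"
      using ab' c_fracs Sub_add[OF fm.fracs_in_Sub] Sub_mult[OF fm.fracs_in_Sub] by blast
    ultimately have "b + c * a = 0" using fm.fr_eq_0 by blast
    then have "c = - b / a" using ab'(3) by (simp add: field_simps eq_neg_iff_add_eq_0)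
    then have "c \<in> k0" using ab Sub_divide[OF k0(1)] Sub_uminus[OF k0(1)] by blast
    then show False using c_notin_k0 by blast
  qed
  ultimately have len: "length p - 1 \<ge> 2" by linarith
  have gen: "constant_funs 2 P \<union> (\<lambda>i. regular_fun 2 P (mvar 0)) ` {..<1::nat} = fm.fr ` (\<rat> \<union> {T})"
    using regular_fun_eq(1)[OF mvar_in_mpoly_ring, of 0]
    by (auto simp: constant_funs_eq \<Psi>_simps lessThan_Suc)
  have "has_degree 2 P 1 (\<lambda>_. mvar 0) (length p - 1)"
    using dim unfolding has_degree_def function_field_eq over_def gen generate_k0 .
  then show ?thesis using len by blast
qed

text \<open>Every element of the ideal is a multiple of \<open>m\<close>, so roots of
  \<open>m\<close> give points of the curve. The homomorphism \<open>h\<close> is left open to cover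
  rational points (\<open>id\<close>) and geometric points (\<open>to_ac\<close>).\<close>

lemma zero_locus_P:
  assumes h: "is_hom h" and r: "ev2 h t \<rho> m = 0"
  shows "(\<lambda>i\<in>{..<2}. if i = 0 then t else \<rho>) \<in> zero_locus h 2 P"
proof -
  have "mpeval h (\<lambda>i\<in>{..<2}. if i = 0 then t else \<rho>) p = 0" if p: "p \<in> P" for p
  proof -
    have "p \<in> carrier (mpoly_ring 2)" using p by (simp add: P_iff)
    then have "mpeval h (\<lambda>i\<in>{..<2}. if i = 0 then t else \<rho>) p = ev2 h t \<rho> (bivar p)"
      unfolding ev2_bivar[OF h] by (rule mpeval_cong) auto
    also have "\<dots> = 0"
    proof -
      \<comment> \<open>Pseudo-division by a monic polynomial is division; the remainder also
        vanishes at (T, c) and is 0 by minimality.\<close>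
      obtain q r where qr: "pseudo_divmod (bivar p) m = (q, r)" by fastforce
      have m0: "m \<noteq> 0" using monic by auto
      have eq: "bivar p = m * q + r" and r: "r = 0 \<or> degree r < degree m"
        using pseudo_divmod[OF m0 qr] monic by auto
      have "ev2 of_rat T c (bivar p) = 0"
        using p by (simp add: P_iff \<Psi>_def ev2_bivar[OF is_hom_of_rat])
      then have "ev2 of_rat T c r = 0"
        using root by (simp add: eq is_hom_simps[OF is_hom_ev2[OF is_hom_of_rat]])
      then have "r = 0" using r minimal by blast
      then show ?thesis using \<open>ev2 h t \<rho> m = 0\<close> by (simp add: eq is_hom_simps[OF is_hom_ev2[OF h]])
    qed
    finally show ?thesis .
  qed
  then show ?thesis by (auto simp: zero_locus_def affine_space_def)
qed

lemma image_point:
  assumes h: "is_hom h" and y: "y \<in> affine_space 1" and r: "ev2 h (y 0) \<rho> m = 0"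
  shows "y \<in> poly_image h 1 (\<lambda>_. mvar 0) (zero_locus h 2 P)"
proof -
  let ?x = "\<lambda>i\<in>{..<2::nat}. if i = 0 then y 0 else \<rho>"
  have "(\<lambda>i\<in>{..<1::nat}. mpeval h ?x (mvar 0)) = y"
    using y by (auto simp: mpeval_mvar[OF h] affine_space_def PiE_def extensional_def fun_eq_iff restrict_def)
  then show ?thesis unfolding poly_image_def using zero_locus_P[OF h r] by (intro image_eqI) auto
qed

lemma is_hom_to_ac: "is_hom to_ac"
  by (auto simp: is_hom_def)

text \<open>Being monic, \<open>m\<close> keeps positive degree at every value of the parameter and
  so has a root in the algebraic closure: the curve projects onto the whole geometric line.\<close>

lemma dominant_P: "dominant 2 P 1 (\<lambda>_. mvar 0)"
  unfolding dominant_def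
proof (intro allI impI)
  fix E :: "rat mpoly set"
  assume sub: "poly_image to_ac 1 (\<lambda>_. mvar 0) (zero_locus to_ac 2 P) \<subseteq> zero_locus to_ac 1 E"
  have "y \<in> zero_locus to_ac 1 E" if y: "y \<in> affine_space 1" for y
  proof -
    let ?h = "\<lambda>q. poly (map_poly to_ac q) (y 0)"
    have co: "coeff (map_poly ?h m) i = ?h (coeff m i)" for i by (simp add: coeff_map_poly)
    have "coeff (map_poly ?h m) (degree m) \<noteq> 0" unfolding co by (simp add: monic)
    then have "degree (map_poly ?h m) > 0" using deg by (meson le_degree less_le_trans zero_less_numeral)
    then obtain \<rho> where "poly (map_poly ?h m) \<rho> = 0" using alg_closed_imp_poly_has_root by blast
    then have "ev2 to_ac (y 0) \<rho> m = 0" by (simp add: ev2_def)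
    then show ?thesis using image_point[OF is_hom_to_ac y] sub by blast
  qed
  then show "zero_locus to_ac 1 E = affine_space 1" by (auto simp: zero_locus_def)
qed

lemma thin_type2_P: "thin_type2 1 (poly_image id 1 (\<lambda>_. mvar 0) (zero_locus id 2 P))"
  unfolding thin_type2_def
proof -
  obtain d where d: "d \<ge> 2" "has_degree 2 P 1 (\<lambda>_. mvar 0) d" using has_degree_P by blast
  show "\<exists>m P' f d. primeideal P' (mpoly_ring m) \<and> has_dimension m P' 1 \<and>
        (\<forall>i<1. f i \<in> carrier (mpoly_ring m)) \<and> dominant m P' 1 f \<and> has_degree m P' 1 f d \<and> d \<ge> 2 \<and>
        poly_image id 1 (\<lambda>_. mvar 0) (zero_locus id 2 P) = poly_image id 1 f (zero_locus id m P')"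
    by (rule exI[of _ 2], rule exI[of _ P], rule exI[of _ "\<lambda>_. mvar 0"], rule exI[of _ d])
       (use primeideal_P has_dimension_P dominant_P d mvar_in_mpoly_ring[of 0 2] in simp)
qed

theorem thin_rational_roots: "thin_in_field {t. \<exists>r. ev2 id t r m = 0}"
proof -
  let ?Z = "(\<lambda>z. \<lambda>i\<in>{..<1::nat}. z) ` {t. \<exists>r. ev2 id t r m = 0}"
  have "?Z \<subseteq> poly_image id 1 (\<lambda>_. mvar 0) (zero_locus id 2 P)"
  proof (rule image_subsetI)
    fix t assume "t \<in> {t. \<exists>r. ev2 id t r m = 0}"
    then obtain r where "ev2 id t r m = 0" by blast
    then show "(\<lambda>i\<in>{..<1}. t) \<in> poly_image id 1 (\<lambda>_. mvar 0) (zero_locus id 2 P)"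
      by (intro image_point[of _ _ r]) (auto simp: is_hom_def affine_space_def)
  qed
  moreover have "?Z \<subseteq> affine_space 1" by (auto simp: affine_space_def split: if_splits)
  ultimately show ?thesis unfolding thin_in_field_def thin_def
  proof (intro conjI exI)
    let ?W = "poly_image id 1 (\<lambda>_. mvar 0) (zero_locus id 2 P)"
    assume "?Z \<subseteq> ?W" "?Z \<subseteq> affine_space 1"
    then show "?Z \<subseteq> \<Union>{?W}" "?Z \<subseteq> affine_space 1" by (simp_all only: Sup_insert Sup_empty sup_bot_right)
    show "finite {?W}" by (intro finite.intros)
    show "\<forall>V\<in>{?W}. thin_type1 1 V \<or> thin_type2 1 V" using thin_type2_P by blast
  qed
qed

end

section \<open>Closure properties of thin sets and the filter they define\<close>

definition line_point :: "'k \<Rightarrow> nat \<Rightarrow> 'k" where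
  "line_point z = (\<lambda>i\<in>{..<1}. z)"

lemma thin_in_field_iff:
  "thin_in_field A \<longleftrightarrow> (\<exists>\<T>. finite \<T> \<and> (\<forall>V\<in>\<T>. thin_type1 1 V \<or> thin_type2 1 V) \<and> (\<forall>z\<in>A. line_point z \<in> \<Union>\<T>))"
proof -
  have "line_point ` A \<subseteq> affine_space 1"
    by (auto simp: line_point_def affine_space_def split: if_splits)
  then show ?thesis
    unfolding thin_in_field_def thin_def line_point_def[symmetric] image_subset_iff
    by iprover
qed

lemma thin_in_field_subset: "thin_in_field B \<Longrightarrow> A \<subseteq> B \<Longrightarrow> thin_in_field A"
  unfolding thin_in_field_iff by (meson subsetD)

lemma thin_in_field_Un:
  assumes "thin_in_field A" "thin_in_field B"
  shows "thin_in_field (A \<union> B)"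
proof -
  obtain \<A> where A: "finite \<A>" "\<forall>V\<in>\<A>. thin_type1 1 V \<or> thin_type2 1 V" "\<forall>z\<in>A. line_point z \<in> \<Union>\<A>"
    using assms(1) unfolding thin_in_field_iff by (elim exE conjE)
  obtain \<B> where B: "finite \<B>" "\<forall>V\<in>\<B>. thin_type1 1 V \<or> thin_type2 1 V" "\<forall>z\<in>B. line_point z \<in> \<Union>\<B>"
    using assms(2) unfolding thin_in_field_iff by (elim exE conjE)
  show ?thesis unfolding thin_in_field_iff
  proof (intro exI conjI)
    show "finite (\<A> \<union> \<B>)" using A(1) B(1) by (rule finite_UnI)
    show "\<forall>V\<in>\<A> \<union> \<B>. thin_type1 1 V \<or> thin_type2 1 V" using A(2) B(2) by (simp only: ball_Un simp_thms)
    show "\<forall>z\<in>A \<union> B. line_point z \<in> \<Union>(\<A> \<union> \<B>)" using A(3) B(3) by blast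
  qed
qed

text \<open>The point is the zero locus of X - a, which is proper because it misses a + 1.\<close>

lemma thin_in_field_single: "thin_in_field {a :: 'k::field_char_0}"
proof -
  define p :: "'k mpoly" where "p = mvar 0 + mconst (- a)"
  have "mvar 0 \<oplus>\<^bsub>mpoly_ring 1\<^esub> mconst (- a) \<in> carrier (mpoly_ring 1)"
    by (intro cring.cring_simprules(1)[OF cring_mpoly_ring] mvar_in_mpoly_ring mconst_in_mpoly_ring) simp
  then have p: "p \<in> carrier (mpoly_ring 1)" by (simp only: p_def mpoly_ring_sel)
  have ev: "mpeval h x p = x 0 + h (- a)" if "is_hom h" for h :: "'k \<Rightarrow> 'z::comm_ring_1" and x
    by (simp add: p_def mpeval_add[OF that] mpeval_mvar[OF that] mpeval_mconst[OF that])
  have h: "is_hom (to_ac :: 'k \<Rightarrow> _)" "is_hom (id :: 'k \<Rightarrow> 'k)" by (auto simp: is_hom_def)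
  let ?y = "\<lambda>i\<in>{..<1::nat}. to_ac (a + 1)"
  have "?y \<notin> zero_locus to_ac 1 {p}" "?y \<in> affine_space 1"
    using ev[OF h(1)] by (auto simp: zero_locus_def affine_space_def simp flip: to_ac_add split: if_splits)
  then have "thin_type1 1 (zero_locus id 1 {p})" unfolding thin_type1_def using p by blast
  moreover have "line_point a \<in> zero_locus id 1 {p}"
    using ev[OF h(2)] by (auto simp: line_point_def zero_locus_def affine_space_def split: if_splits)
  ultimately show ?thesis unfolding thin_in_field_iff
    by (intro exI[of _ "{zero_locus id 1 {p}}"]) simp
qed

lemma thin_in_field_finite: "finite A \<Longrightarrow> thin_in_field A"
proof (induction A rule: finite_induct)
  case empty
  show ?case unfolding thin_in_field_iff by (rule exI[of _ "{}"]) simp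
next
  case (insert a A)
  then show ?case using thin_in_field_Un[OF thin_in_field_single[of a]] by simp
qed

text \<open>Exceptional thin sets, finitely many at a time, are combined by filter reasoning; a set
  that is not thin meets every set of this filter, see \<open>eventually_nonthin_ex\<close>.\<close>

definition nonthin :: "rat filter" where
  "nonthin = Abs_filter (\<lambda>P. thin_in_field {z. \<not> P z})"

lemma eventually_nonthin: "eventually P nonthin \<longleftrightarrow> thin_in_field {z. \<not> P z}"
  unfolding nonthin_def
proof (rule eventually_Abs_filter, rule is_filter.intro)
  show "thin_in_field {z. \<not> True}" by (simp add: thin_in_field_finite)
  show "thin_in_field {z. \<not> (P z \<and> Q z)}" if "thin_in_field {z. \<not> P z}" "thin_in_field {z. \<not> Q z}"
    for P Q :: "rat \<Rightarrow> bool"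
    using thin_in_field_Un[OF that] by (rule thin_in_field_subset) auto
  show "thin_in_field {z. \<not> Q z}" if "\<forall>x. P x \<longrightarrow> Q x" "thin_in_field {z. \<not> P z}" for P Q :: "rat \<Rightarrow> bool"
    using that(2) by (rule thin_in_field_subset) (use that(1) in auto)
qed

lemma nonthin_le_cofinite: "nonthin \<le> cofinite"
  by (rule filter_leI) (simp add: eventually_nonthin eventually_cofinite thin_in_field_finite)

section \<open>Specialisation of algebraic functions\<close>

lemma is_hom_prod: "is_hom h \<Longrightarrow> h (prod f I) = (\<Prod>i\<in>I. h (f i))"
  by (induction I rule: infinite_finite_induct) (auto simp: is_hom_simps)

lemma is_hom_inj:
  fixes h :: "'a::field \<Rightarrow> 'b::field"
  assumes h: "is_hom h"
  shows "h x = h y \<longleftrightarrow> x = y"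
proof
  assume "h x = h y"
  then have "h (x - y) = 0" by (simp add: is_hom_simps[OF h])
  then have "h ((x - y) * inverse (x - y)) = 0" by (simp only: is_hom_mult[OF h] mult_zero_left)
  then show "x = y" using is_hom_1[OF h] by (cases "x = y") auto
qed simp

lemma is_hom_eq_0: "is_hom h \<Longrightarrow> h (x :: 'a::field) = (0 :: 'b::field) \<longleftrightarrow> x = 0"
  using is_hom_inj[of h x 0] by (simp add: is_hom_0)

lemma is_hom_of_nat: "is_hom h \<Longrightarrow> h (of_nat n) = of_nat n"
  by (induction n) (auto simp: is_hom_simps)

lemma is_hom_inverse: "is_hom h \<Longrightarrow> h (inverse (x :: 'a::field)) = inverse (h x :: 'b::field)"
  by (cases "x = 0") (auto simp: is_hom_0 is_hom_1 simp flip: is_hom_mult intro!: inverse_unique[symmetric])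

lemma is_hom_of_rat_eq:
  fixes h :: "'a::field_char_0 \<Rightarrow> 'b::field_char_0"
  assumes h: "is_hom h"
  shows "h (of_rat q) = of_rat q"
proof (cases q)
  case (Fract a b)
  have "h (of_int z) = of_int z" for z
    by (cases z) (simp_all add: is_hom_of_nat[OF h] is_hom_uminus[OF h] del: of_nat_Suc)
  then show ?thesis using Fract
    by (simp add: of_rat_rat divide_inverse is_hom_mult[OF h] is_hom_inverse[OF h])
qed

lemma alg_over_Rats_hom:
  fixes h :: "'a::field_char_0 \<Rightarrow> 'b::field_char_0"
  assumes h: "is_hom h" and x: "alg_over \<rat> x"
  shows "alg_over \<rat> (h x)"
proof -
  obtain p where p: "p \<in> polys_over \<rat>" "p \<noteq> 0" "poly p x = 0" using x by (auto simp: alg_over_def)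
  have co: "coeff (map_poly h p) i = h (coeff p i)" for i by (simp add: coeff_map_poly is_hom_0[OF h])
  have "map_poly h p \<in> polys_over \<rat>" unfolding polys_over_def mem_Collect_eq co
  proof
    fix i
    obtain r where "coeff p i = of_rat r" using coeff_polys_over[OF p(1), of i] by (auto simp: Rats_def)
    then show "h (coeff p i) \<in> \<rat>" by (simp add: is_hom_of_rat_eq[OF h])
  qed
  moreover have "map_poly h p \<noteq> 0"
    using p(2) is_hom_eq_0[OF h] by (auto simp: poly_eq_iff co)
  moreover have "poly (map_poly h p) (h x) = 0"
    using is_hom_poly[OF h, of p x] p(3) is_hom_0[OF h] by simp
  ultimately show ?thesis by (auto simp: alg_over_def)
qed

text \<open>By \<open>conj\<close>, sending \<eta> to \<rho> extends to a homomorphism on K[\<eta>]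
  over \<open>K\<close>, and the set consists of its fixed points. For inverses, \<open>conj\<close>
  is applied to u p - 1, where \<open>u\<close> represents the inverse.\<close>

lemma conjugation_fixed_field:
  assumes K: "K \<in> Sub" and \<eta>: "alg_over K \<eta>"
    and conj: "\<And>p. p \<in> polys_over K \<Longrightarrow> poly p \<eta> = 0 \<Longrightarrow> poly p \<rho> = 0"
  shows "{x. \<exists>r\<in>polys_over K. poly r \<eta> = x \<and> poly r \<rho> = x} \<in> Sub" (is "?X \<in> Sub")
  unfolding Sub_iff
proof (intro conjI ballI)
  show "0 \<in> ?X" using polys_over_0[OF K] by (auto intro!: bexI[of _ 0])
  show "1 \<in> ?X" using polys_over_1[OF K] by (auto intro!: bexI[of _ 1])
  fix x assume "x \<in> ?X"
  then obtain p where p: "p \<in> polys_over K" "poly p \<eta> = x" "poly p \<rho> = x" by blast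
  show "- x \<in> ?X" using polys_over_uminus[OF K p(1)] p(2,3) by (auto intro!: bexI[of _ "- p"])
  show "inverse x \<in> ?X"
  proof (cases "x = 0")
    case True
    then show ?thesis using polys_over_0[OF K] by (auto intro!: bexI[of _ 0])
  next
    case False
    have "x \<in> adjoin K \<eta>" using p by (auto simp: adjoin_def)
    then have "inverse x \<in> adjoin K \<eta>" by (rule Sub_inverse[OF adjoin_in_Sub[OF K \<eta>]])
    then obtain u where u: "u \<in> polys_over K" "poly u \<eta> = inverse x" by (auto simp: adjoin_def)
    have "poly (u * p - 1) \<rho> = 0"
      using u p False by (intro conj polys_over_diff[OF K] polys_over_mult[OF K] polys_over_1[OF K]) auto
    then have "poly u \<rho> * x = 1" using p by simp
    then have "poly u \<rho> = inverse x" by (metis inverse_unique mult.commute)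
    then show ?thesis using u by blast
  qed
  fix y assume "y \<in> ?X"
  then obtain q where q: "q \<in> polys_over K" "poly q \<eta> = y" "poly q \<rho> = y" by blast
  show "x + y \<in> ?X" using p q polys_over_add[OF K p(1) q(1)] by (auto intro!: bexI[of _ "p + q"])
  show "x * y \<in> ?X" using p q polys_over_mult[OF K p(1) q(1)] by (auto intro!: bexI[of _ "p * q"])
qed

section \<open>Products of linear factors\<close>

lemma monic_splits:
  fixes p :: "'a::alg_closed_field poly"
  assumes "lead_coeff p = 1"
  shows "\<exists>rs. p = (\<Prod>i<degree p. [:- rs i, 1:])"
  using assms
proof (induction "degree p" arbitrary: p)
  case 0
  then have "p = 1" by (auto elim!: degree_eq_zeroE)
  then show ?case by simp
next
  case (Suc n)
  obtain r where "poly p r = 0" using alg_closed_imp_poly_has_root[of p] Suc.hyps(2) by auto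
  then obtain q where q: "p = [:- r, 1:] * q" by (auto simp: poly_eq_0_iff_dvd dvd_def)
  have lq: "lead_coeff q = 1" using Suc.prems unfolding q lead_coeff_mult by simp
  then have "q \<noteq> 0" by auto
  then have dq: "degree p = Suc (degree q)" unfolding q by (subst degree_mult_eq) auto
  obtain rs where rs: "q = (\<Prod>i<degree q. [:- rs i, 1:])" using Suc.hyps(1)[of q] lq dq Suc.hyps(2) by auto
  have "p = (\<Prod>i<degree p. [:- (rs(degree q := r)) i, 1:])"
    unfolding dq by (subst prod.lessThan_Suc) (simp add: q mult.commute flip: rs)
  then show ?case by blast
qed

text \<open>Subsets of indices are used instead of sets of roots, because roots that differ
  generically may coincide after specialisation.\<close>

lemma monic_dvd_linear_prod:
  fixes p :: "'a::field poly"
  assumes "finite J" "lead_coeff p = 1" "p dvd (\<Prod>i\<in>J. [:- a i, 1:])"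
  shows "\<exists>I\<subseteq>J. p = (\<Prod>i\<in>I. [:- a i, 1:])"
  using assms
proof (induction J arbitrary: p rule: finite_induct)
  case empty
  moreover from empty.prems have "p \<noteq> 0" by auto
  ultimately have "degree p = 0" by (simp add: is_unit_iff_degree)
  then have "p = 1" using empty.prems by (auto elim!: degree_eq_zeroE)
  then show ?case by simp
next
  case (insert j J)
  let ?Q = "\<Prod>i\<in>J. [:- a i, 1:]"
  obtain c where c: "[:- a j, 1:] * ?Q = p * c" using insert.prems insert.hyps by (auto simp: dvd_def)
  show ?case
  proof (cases "poly p (a j) = 0")
    case True
    then obtain p' where p': "p = [:- a j, 1:] * p'" by (auto simp: poly_eq_0_iff_dvd dvd_def)
    have "lead_coeff p' = 1" using insert.prems(1) unfolding p' lead_coeff_mult by simp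
    moreover have "[:- a j, 1:] * ?Q = [:- a j, 1:] * (p' * c)" using c by (simp only: p' mult.assoc)
    then have "?Q = p' * c" by (subst (asm) mult_left_cancel) auto
    ultimately obtain I where I: "I \<subseteq> J" "p' = (\<Prod>i\<in>I. [:- a i, 1:])"
      using insert.IH[of p'] by auto
    have "finite I" "j \<notin> I" using I insert.hyps finite_subset by auto
    then have "p = (\<Prod>i\<in>insert j I. [:- a i, 1:])" by (simp add: p' I)
    then show ?thesis using I(1) by blast
  next
    case False
    have "poly (p * c) (a j) = 0" by (simp flip: c)
    then have "poly c (a j) = 0" using False by simp
    then obtain c' where c': "c = [:- a j, 1:] * c'" by (auto simp: poly_eq_0_iff_dvd dvd_def)
    have "[:- a j, 1:] * ?Q = [:- a j, 1:] * (p * c')" unfolding c c' by (simp only: mult_ac)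
    then have "?Q = p * c'" by (subst (asm) mult_left_cancel) auto
    then show ?thesis using insert.IH[of p] insert.prems by auto
  qed
qed

lemma degree_linear_prod: "degree (\<Prod>i\<in>I. [:- a i, 1 :: 'a::field:]) = card I"
proof (induction I rule: infinite_finite_induct)
  case (insert i I)
  have "(\<Prod>i\<in>I. [:- a i, 1:]) \<noteq> 0" using insert.hyps by simp
  then show ?case using insert by (simp add: degree_mult_eq del: mult_pCons_left)
qed auto

text \<open>\<kappa> embeds the algebraic numbers as constants in a field where \<open>T\<close> is
  transcendental over them. Generic and specialised values live in the same field \<open>'o\<close>,
  so that one function can carry both.\<close>

locale specialisation =
  fixes \<kappa> :: "'q::{alg_closed_field, field_char_0} \<Rightarrow> 'o::{alg_closed_field, field_char_0}" and T :: 'o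
  assumes \<kappa>: "is_hom \<kappa>"
    and T: "\<And>p. p \<noteq> 0 \<Longrightarrow> poly (map_poly \<kappa> p) T \<noteq> 0"
    and algebraic: "\<And>x :: 'q. alg_over \<rat> x"
begin

abbreviation "k0 \<equiv> field_gen {T}"

definition \<Lambda> :: "'o set" where "\<Lambda> = {x. alg_over k0 x}"

definition T_at :: "rat option \<Rightarrow> 'o" where
  "T_at i = (case i of None \<Rightarrow> T | Some z \<Rightarrow> of_rat z)"

text \<open>A function on \<open>rat option\<close> packages an algebraic function of \<open>T\<close> (its value at \<open>None\<close>)
  with its specialisations at \<open>T = z\<close> (the values at \<open>Some z\<close>).\<close>

definition spec_ring :: "(rat option \<Rightarrow> 'o) set \<Rightarrow> bool" where
  "spec_ring A \<longleftrightarrow> ring_closed A \<and> (\<forall>q. (\<lambda>_. \<kappa> q) \<in> A) \<and> T_at \<in> A \<and>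
     (\<forall>f\<in>A. f None \<in> \<Lambda> \<and> (\<forall>z. f (Some z) \<in> range \<kappa>)) \<and>
     (\<forall>f\<in>A. f None = 0 \<longrightarrow> (\<forall>\<^sub>F z in cofinite. f (Some z) = 0))"

definition ev :: "rat poly \<Rightarrow> 'o" where "ev q = poly (map_poly of_rat q) T"

lemma is_hom_ev: "is_hom ev"
  unfolding ev_def by (rule is_hom_poly_map[OF is_hom_of_rat])

lemma ev_nonzero: "q \<noteq> 0 \<Longrightarrow> ev q \<noteq> 0"
proof -
  assume q: "q \<noteq> 0"
  have "map_poly \<kappa> (map_poly of_rat q) = map_poly of_rat q"
    by (rule poly_eqI) (simp add: coeff_map_poly is_hom_0[OF \<kappa>] is_hom_of_rat_eq[OF \<kappa>])
  moreover have "map_poly of_rat q \<noteq> (0 :: 'q poly)"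
  proof
    assume "map_poly of_rat q = (0 :: 'q poly)"
    then have "coeff (map_poly of_rat q :: 'q poly) i = 0" for i by simp
    then show False using q by (auto simp: coeff_map_poly poly_eq_iff)
  qed
  ultimately show ?thesis using T[of "map_poly of_rat q"] by (simp add: ev_def)
qed

lemma k0: "k0 \<in> Sub" by (rule field_gen_in_Sub)

lemma \<Lambda>_Sub: "\<Lambda> \<in> Sub" unfolding \<Lambda>_def by (rule algebraics_in_Sub[OF k0])

lemma k0_\<Lambda>: "k0 \<subseteq> \<Lambda>" unfolding \<Lambda>_def using alg_over_self[OF k0] by blast

lemma T_\<Lambda>: "T \<in> \<Lambda>" using k0_\<Lambda> field_gen_superset[of "{T}"] by blast

lemma ev_k0: "ev q \<in> k0"
  unfolding ev_def by (rule poly_map_of_rat_field_gen)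

lemma \<kappa>_\<Lambda>: "\<kappa> q \<in> \<Lambda>"
  unfolding \<Lambda>_def using alg_over_mono[OF alg_over_Rats_hom[OF \<kappa> algebraic] Rats_subset_Sub[OF k0]] by simp

lemma range_\<kappa>: "ring_closed (range \<kappa>)" by (rule ring_closed_range[OF \<kappa>])

lemma spec_ringD:
  assumes "spec_ring A"
  shows "ring_closed A" "(\<lambda>_. \<kappa> q) \<in> A" "T_at \<in> A" "f \<in> A \<Longrightarrow> f None \<in> \<Lambda>" "f \<in> A \<Longrightarrow> f (Some z) \<in> range \<kappa>"
    "f \<in> A \<Longrightarrow> f None = 0 \<Longrightarrow> \<forall>\<^sub>F z in cofinite. f (Some z) = 0"
  using assms by (auto simp: spec_ring_def)

lemma clear_denominators:
  assumes "p \<in> polys_over k0"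
  shows "\<exists>d P. d \<noteq> 0 \<and> map_poly ev P = smult (ev d) p"
  using assms
proof (induction p)
  case 0
  show ?case by (intro exI[of _ 1] exI[of _ 0]) auto
next
  case (pCons a p)
  then obtain d P where dP: "d \<noteq> 0" "map_poly ev P = smult (ev d) p" by (auto simp: polys_over_pCons)
  obtain u v where uv: "a = ev u / ev v" "ev v \<noteq> 0"
    using pCons.prems field_gen_single_subset[of T] by (auto simp: polys_over_pCons ev_def)
  have "v \<noteq> 0" using uv is_hom_0[OF is_hom_ev] by auto
  have sm: "map_poly ev (smult v P) = smult (ev v) (map_poly ev P)"
    by (rule poly_eqI) (simp add: coeff_map_poly is_hom_simps[OF is_hom_ev])
  have "map_poly ev (pCons (u * d) (smult v P)) = smult (ev (v * d)) (pCons a p)"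
    using uv(2) by (simp add: map_poly_pCons is_hom_simps[OF is_hom_ev] sm dP uv(1))
  then show ?case using dP(1) \<open>v \<noteq> 0\<close> by (intro exI[of _ "v * d"] exI[of _ "pCons (u * d) (smult v P)"]) auto
qed

definition Q_at :: "rat poly \<Rightarrow> rat option \<Rightarrow> 'o" where
  "Q_at q i = poly (map_poly of_rat q) (T_at i)"

lemma Q_at_None: "Q_at q None = ev q" by (simp add: Q_at_def ev_def T_at_def)

lemma Q_at_Some: "Q_at q (Some z) = of_rat (poly q z)"
  by (simp add: Q_at_def T_at_def is_hom_poly[OF is_hom_of_rat])

lemma Q_at_in:
  assumes A: "spec_ring A"
  shows "Q_at q \<in> A"
proof (induction q)
  case 0
  have "Q_at 0 = 0" by (auto simp: Q_at_def)
  then show ?case using rc_0[OF spec_ringD(1)[OF A]] by (simp add: zero_fun_def)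
next
  case (pCons a q)
  have eq: "Q_at (pCons a q) = (\<lambda>_. \<kappa> (of_rat a)) + T_at * Q_at q"
    by (auto simp: Q_at_def map_poly_pCons is_hom_of_rat_eq[OF \<kappa>])
  show ?case unfolding eq
    by (intro rc_add[OF spec_ringD(1)[OF A]] rc_mult[OF spec_ringD(1)[OF A]] spec_ringD(2,3)[OF A] pCons.IH)
qed

lemma ev2_at_in:
  assumes A: "spec_ring A" and f: "f \<in> A"
  shows "(\<lambda>i. ev2 of_rat (T_at i) (f i) P) \<in> A"
proof (induction P)
  case 0
  have "(\<lambda>i. ev2 of_rat (T_at i) (f i) 0) = 0" by (auto simp: ev2_def)
  then show ?case using rc_0[OF spec_ringD(1)[OF A]] by simp
next
  case (pCons q P)
  have eq: "(\<lambda>i. ev2 of_rat (T_at i) (f i) (pCons q P)) = Q_at q + f * (\<lambda>i. ev2 of_rat (T_at i) (f i) P)"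
    by (auto simp: Q_at_def map_poly_pCons ev2_def)
  show ?case unfolding eq
    by (intro rc_add[OF spec_ringD(1)[OF A]] rc_mult[OF spec_ringD(1)[OF A]] Q_at_in[OF A] f pCons.IH)
qed

lemma ev2_ev: "ev2 of_rat T x P = poly (map_poly ev P) x"
  by (simp add: ev2_def ev_def[abs_def])

lemma cofinite_poly_nonzero:
  assumes "q \<noteq> 0"
  shows "\<forall>\<^sub>F z in cofinite. poly q z \<noteq> (0 :: rat)"
  using poly_roots_finite[OF assms] by (simp add: eventually_cofinite)

lemma min_poly_coeff_0:
  assumes m: "min_poly k0 x m" and x: "x \<noteq> 0"
  shows "coeff m 0 \<noteq> 0"
proof
  assume m0: "coeff m 0 = 0"
  obtain a q where q: "m = pCons a q" by (cases m)
  then have "m = pCons 0 q" using m0 by simp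
  moreover have "m \<in> polys_over k0" "poly m x = 0" "m \<noteq> 0" using m by (auto simp: min_poly_def)
  ultimately have "q \<in> polys_over k0" "poly q x = 0" "q \<noteq> 0" "degree q < degree m"
    using x by (auto simp: polys_over_pCons)
  then show False using m unfolding min_poly_def by (meson not_le)
qed

text \<open>The minimal polynomial over Q(T) of a nonzero element has nonzero constant term. After
  clearing denominators this term is a nonzero polynomial in z, and for almost all z it has to
  vanish where \<open>f\<close> specialises to 0.\<close>

lemma spec_nonzero:
  assumes A: "spec_ring A" and f: "f \<in> A" "f None \<noteq> 0"
  shows "\<forall>\<^sub>F z in cofinite. f (Some z) \<noteq> 0"
proof -
  have "alg_over k0 (f None)" using spec_ringD(4)[OF A f(1)] by (simp add: \<Lambda>_def)
  then obtain m where m: "min_poly k0 (f None) m" using min_poly_exists[OF k0] by blast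
  then obtain d P where dP: "d \<noteq> 0" "map_poly ev P = smult (ev d) m"
    using clear_denominators[of m] by (auto simp: min_poly_def)
  have "coeff (map_poly ev P) 0 = ev (coeff P 0)" by (simp add: coeff_map_poly is_hom_0[OF is_hom_ev])
  then have "coeff P 0 \<noteq> 0"
    using dP ev_nonzero[OF dP(1)] min_poly_coeff_0[OF m f(2)] is_hom_0[OF is_hom_ev] by auto
  then have nz: "\<forall>\<^sub>F z in cofinite. poly (coeff P 0) z \<noteq> 0" by (rule cofinite_poly_nonzero)
  have "ev2 of_rat (T_at None) (f None) P = 0"
    using m by (simp add: T_at_def ev2_ev dP min_poly_def)
  then have "\<forall>\<^sub>F z in cofinite. ev2 of_rat (T_at (Some z)) (f (Some z)) P = 0"
    using spec_ringD(6)[OF A ev2_at_in[OF A f(1)]] by blast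
  with nz show ?thesis
  proof eventually_elim
    case (elim z)
    show ?case
    proof
      assume "f (Some z) = 0"
      then have "ev2 of_rat (of_rat z) 0 P = (0 :: 'o)" using elim by (simp add: T_at_def)
      moreover have "ev2 of_rat (of_rat z) 0 P = (of_rat (poly (coeff P 0) z) :: 'o)"
        by (simp add: ev2_def poly_0_coeff_0 coeff_map_poly is_hom_poly[OF is_hom_of_rat])
      ultimately show False using elim by simp
    qed
  qed
qed

lemma spec_eq:
  assumes A: "spec_ring A" and f: "f \<in> A" "g \<in> A" "f None = g None"
  shows "\<forall>\<^sub>F z in cofinite. f (Some z) = g (Some z)"
  using spec_ringD(6)[OF A rc_diff[OF spec_ringD(1)[OF A] f(1,2)]] f(3) by simp

lemma spec_rational:
  assumes A: "spec_ring A" and f: "f \<in> A" "f None \<in> k0"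
  shows "\<forall>\<^sub>F z in cofinite. f (Some z) \<in> \<rat>"
proof -
  obtain p q where pq: "f None = ev p / ev q" "ev q \<noteq> 0"
    using f(2) field_gen_single_subset[of T] by (auto simp: ev_def)
  have "q \<noteq> 0" using pq is_hom_0[OF is_hom_ev] by auto
  then have nz: "\<forall>\<^sub>F z in cofinite. poly q z \<noteq> 0" by (rule cofinite_poly_nonzero)
  have "\<forall>\<^sub>F z in cofinite. (Q_at q * f) (Some z) = Q_at p (Some z)"
    using pq by (intro spec_eq[OF A] rc_mult[OF spec_ringD(1)[OF A]] Q_at_in[OF A] f) (simp add: Q_at_None)
  with nz show ?thesis
  proof eventually_elim
    case (elim z)
    then have "f (Some z) = of_rat (poly p z) / of_rat (poly q z)" by (simp add: Q_at_Some field_simps)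
    then show ?case by (simp add: Rats_divide)
  qed
qed

text \<open>Thinness enters here: an irrational algebraic function takes rational values on a thin set only.\<close>

lemma spec_irrational:
  assumes A: "spec_ring A" and f: "f \<in> A" "f None \<notin> k0"
  shows "\<forall>\<^sub>F z in nonthin. f (Some z) \<notin> \<rat>"
proof -
  have "alg_over k0 (f None)" using spec_ringD(4)[OF A f(1)] by (simp add: \<Lambda>_def)
  then obtain m where m: "min_poly k0 (f None) m" using min_poly_exists[OF k0] by blast
  then obtain d P where dP: "d \<noteq> 0" "map_poly ev P = smult (ev d) m"
    using clear_denominators[of m] by (auto simp: min_poly_def)
  define n where "n = degree m"
  have n2: "n \<ge> 2" unfolding n_def by (rule min_poly_degree_ge_2[OF k0 m f(2)])
  have evP: "ev (coeff P j) = ev d * coeff m j" for j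
    using arg_cong[OF dP(2), of "\<lambda>p. coeff p j"] by (simp add: coeff_map_poly is_hom_0[OF is_hom_ev])
  define l where "l = coeff P n"
  have evl: "ev l = ev d" using evP[of n] m by (simp add: l_def n_def min_poly_def)
  have l0: "l \<noteq> 0" using evl ev_nonzero[OF dP(1)] is_hom_0[OF is_hom_ev] by auto
  \<comment> \<open>Scaling by the leading coefficient makes the element integral over Q[T], as
    \<open>integral_element\<close> demands.\<close>
  define c where "c = ev l * f None"
  \<comment> \<open>the monic polynomial killing \<open>c\<close>, obtained by multiplying \<open>P\<close> with \<open>l ^ (n - 1)\<close>\<close>
  define M where "M = monom 1 n + (\<Sum>j<n. monom (coeff P j * l ^ (n - 1 - j)) j)"
  have M_coeff: "coeff M j = (if j = n then 1 else if j < n then coeff P j * l ^ (n - 1 - j) else 0)" for j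
  proof -
    have "coeff (\<Sum>i<n. monom (coeff P i * l ^ (n - 1 - i)) i) j =
      (\<Sum>i<n. if i = j then coeff P i * l ^ (n - 1 - i) else 0)" by (simp add: coeff_sum)
    also have "\<dots> = (if j < n then coeff P j * l ^ (n - 1 - j) else 0)" by (subst sum.delta) auto
    finally show ?thesis by (auto simp: M_def)
  qed
  have dM: "degree M = n"
    by (intro antisym degree_le le_degree) (auto simp: M_coeff)
  have evpow: "ev (q ^ k) = ev q ^ k" for q k by (induction k) (auto simp: is_hom_simps[OF is_hom_ev])
  have ie: "integral_element T c M"
  proof
    show "lead_coeff M = 1" by (simp add: dM M_coeff)
    show "degree M \<ge> 2" using n2 dM by simp
    have "ev2 of_rat T c M = (\<Sum>j\<le>n. ev (coeff M j) * c ^ j)"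
    proof -
      have "degree (map_poly ev M) = n"
        by (intro antisym degree_le le_degree)
           (auto simp: coeff_map_poly is_hom_0[OF is_hom_ev] is_hom_1[OF is_hom_ev] M_coeff)
      then have "poly (map_poly ev M) c = (\<Sum>j\<le>n. coeff (map_poly ev M) j * c ^ j)" by (simp add: poly_altdef)
      then show ?thesis by (simp add: ev2_ev coeff_map_poly is_hom_0[OF is_hom_ev])
    qed
    also have "\<dots> = (\<Sum>j<n. ev (coeff M j) * c ^ j) + c ^ n"
      by (simp add: lessThan_Suc_atMost[symmetric] M_coeff is_hom_1[OF is_hom_ev])
    \<comment> \<open>With \<open>ev l = ev d\<close> = d this is the termwise form of M(d f) = d^n
      m(f): the factors d, d^(n-1-j) and d^j multiply to d^n.\<close>
    also have "(\<Sum>j<n. ev (coeff M j) * c ^ j) = (\<Sum>j<n. ev d ^ n * (coeff m j * f None ^ j))"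
    proof (rule sum.cong)
      fix j assume "j \<in> {..<n}"
      then have "j < n" by simp
      then have "ev (coeff M j) * c ^ j = ev d * coeff m j * ev d ^ (n - 1 - j) * (ev d ^ j * f None ^ j)"
        by (simp add: M_coeff is_hom_simps[OF is_hom_ev] evpow evl evP c_def power_mult_distrib)
      also have "\<dots> = ev d ^ (1 + (n - 1 - j) + j) * (coeff m j * f None ^ j)"
        by (simp only: power_add power_one_right mult_ac)
      also have "1 + (n - 1 - j) + j = n" using \<open>j < n\<close> by simp
      finally show "ev (coeff M j) * c ^ j = ev d ^ n * (coeff m j * f None ^ j)" .
    qed simp
    also have "c ^ n = ev d ^ n * (coeff m n * f None ^ n)"
      using m by (simp add: c_def evl power_mult_distrib n_def min_poly_def)
    also have "(\<Sum>j<n. ev d ^ n * (coeff m j * f None ^ j)) + ev d ^ n * (coeff m n * f None ^ n)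
        = ev d ^ n * (\<Sum>j\<le>n. coeff m j * f None ^ j)"
      by (simp add: sum_distrib_left distrib_left lessThan_Suc_atMost[symmetric])
    also have "(\<Sum>j\<le>n. coeff m j * f None ^ j) = poly m (f None)" by (simp add: poly_altdef n_def)
    also have "\<dots> = 0" using m by (simp add: min_poly_def)
    finally show "ev2 of_rat T c M = 0" by simp
    fix p :: "rat poly poly" assume p: "p \<noteq> 0" "degree p < degree M"
    \<comment> \<open>r(X) = p(l X) turns a relation for \<open>c\<close> into one of no larger
      degree for \<open>f None\<close>.\<close>
    define r where "r = pcompose (map_poly ev p) [:0, ev l:]"
    have evl0: "ev l \<noteq> 0" using ev_nonzero[OF l0] .
    have "map_poly ev p \<noteq> 0"
      using p(1) ev_nonzero by (auto simp: poly_eq_iff coeff_map_poly is_hom_0[OF is_hom_ev])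
    then have "r \<noteq> 0" unfolding r_def using evl0 by (simp add: pcompose_eq_0_iff)
    moreover have "r \<in> polys_over k0" unfolding r_def
      using ev_k0 Sub_0[OF k0]
      by (intro polys_over_pcompose[OF k0])
         (auto simp: polys_over_pCons polys_over_0[OF k0], auto simp: polys_over_def coeff_map_poly is_hom_0[OF is_hom_ev])
    moreover have "degree r < n"
    proof -
      have "degree r \<le> degree (map_poly ev p)" unfolding r_def using evl0 by (simp add: degree_pcompose)
      also have "\<dots> \<le> degree p" 
        by (intro degree_le) (auto simp: coeff_map_poly is_hom_0[OF is_hom_ev] coeff_eq_0)
      finally show ?thesis using p dM by simp
    qed
    ultimately have "poly r (f None) \<noteq> 0" using m unfolding min_poly_def n_def by (meson not_le)
    then show "ev2 of_rat T c p \<noteq> 0" by (simp add: r_def poly_pcompose ev2_ev c_def mult.commute)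
  qed
  \<comment> \<open>The specialisable function with generic value \<open>c\<close>: a rational value
    of \<open>f\<close> at z makes its value rational too, and that value is a root of
    \<open>M\<close> at z.\<close>
  let ?g = "Q_at l * f"
  have gA: "?g \<in> A" using Q_at_in[OF A] f(1) rc_mult[OF spec_ringD(1)[OF A]] by blast
  have "ev2 of_rat (T_at None) (?g None) M = 0" using integral_element.root[OF ie] by (simp add: T_at_def Q_at_None c_def)
  then have "\<forall>\<^sub>F z in cofinite. ev2 of_rat (T_at (Some z)) (?g (Some z)) M = 0"
    using spec_ringD(6)[OF A ev2_at_in[OF A gA]] by blast
  then have "\<forall>\<^sub>F z in nonthin. ev2 of_rat (T_at (Some z)) (?g (Some z)) M = 0"
    using nonthin_le_cofinite by (rule filter_leD[rotated])
  moreover have "\<forall>\<^sub>F z in nonthin. \<nexists>r. ev2 id z r M = 0"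
    using integral_element.thin_rational_roots[OF ie] by (simp add: eventually_nonthin)
  ultimately show ?thesis
  proof eventually_elim
    case (elim z)
    show ?case
    proof
      assume "f (Some z) \<in> \<rat>"
      then obtain q where q: "f (Some z) = of_rat q" by (auto simp: Rats_def)
      have ev2_rat: "ev2 of_rat (of_rat z) (of_rat r) M = (of_rat (ev2 id z r M) :: 'o)" for r
      proof -
        have "map_poly (\<lambda>q. poly (map_poly of_rat q) (of_rat z :: 'o)) M = map_poly of_rat (map_poly (\<lambda>q. poly (map_poly id q) z) M)"
          by (rule poly_eqI) (simp add: coeff_map_poly is_hom_poly[OF is_hom_of_rat])
        then show ?thesis by (simp add: ev2_def is_hom_poly[OF is_hom_of_rat])
      qed
      have "?g (Some z) = of_rat (poly l z * q)" by (simp add: Q_at_Some q of_rat_mult)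
      then have "(of_rat (ev2 id z (poly l z * q) M) :: 'o) = 0"
        using elim(1) ev2_rat[of "poly l z * q"] by (simp add: T_at_def)
      then have "ev2 id z (poly l z * q) M = 0" by simp
      then show False using elim(2) by blast
    qed
  qed
qed

lemma spec_ring_adjoin:
  assumes A: "spec_ring A" and y: "y None \<in> \<Lambda>" "\<And>z. y (Some z) \<in> range \<kappa>"
    and rel: "\<And>f. f \<in> polys_over A \<Longrightarrow> poly f y None = 0 \<Longrightarrow> \<forall>\<^sub>F z in cofinite. poly f y (Some z) = 0"
  shows "spec_ring (adjoin A y)"
  unfolding spec_ring_def
proof (intro conjI ballI allI impI)
  note rc = spec_ringD(1)[OF A]
  show "ring_closed (adjoin A y)" using ring_closed_adjoin[OF rc] .
  show "(\<lambda>_. \<kappa> q) \<in> adjoin A y" "T_at \<in> adjoin A y" for q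
    using subset_adjoin_rc[OF rc] spec_ringD(2,3)[OF A] by auto
  fix f assume "f \<in> adjoin A y"
  then obtain p where p: "p \<in> polys_over A" "f = poly p y" by (auto simp: adjoin_def)
  show "f None \<in> \<Lambda>" unfolding p(2) poly_fun_apply
    using coeff_polys_over[OF p(1)] spec_ringD(4)[OF A] y(1)
    by (intro poly_polys_over[OF \<Lambda>_Sub]) (auto simp: polys_over_def coeff_map_poly_apply)
  show "f (Some z) \<in> range \<kappa>" for z unfolding p(2) poly_fun_apply
    using coeff_polys_over[OF p(1)] spec_ringD(5)[OF A] y(2)
    by (intro rc_poly[OF range_\<kappa>]) (auto simp: polys_over_def coeff_map_poly_apply)
  show "\<forall>\<^sub>F z in cofinite. f (Some z) = 0" if "f None = 0" using rel[OF p(1)] that by (simp add: p)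
qed

text \<open>Polynomials in \<open>T\<close> over the algebraic constants: since \<open>T\<close> is
  transcendental, one that vanishes at \<open>T\<close> has zero coefficients and so vanishes at
  every z.\<close>

lemma spec_ring_base: "\<exists>A. spec_ring A"
proof -
  let ?h = "(\<lambda>q _. \<kappa> q) :: 'q \<Rightarrow> rat option \<Rightarrow> 'o"
  have hom: "is_hom ?h" using \<kappa> by (auto simp: is_hom_def fun_eq_iff)
  let ?A = "adjoin (range ?h) T_at"
  note rc = ring_closed_range[OF hom]
  have T_range: "of_rat z \<in> range \<kappa>" for z using is_hom_of_rat_eq[OF \<kappa>] by (metis rangeI)
  have "spec_ring ?A" unfolding spec_ring_def
  proof (intro conjI ballI allI impI)
    show "ring_closed ?A" using ring_closed_adjoin[OF rc] .
    show "(\<lambda>_. \<kappa> q) \<in> ?A" "T_at \<in> ?A" for q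
      using subset_adjoin_rc[OF rc] in_adjoin_rc[OF rc] by auto
    fix f assume "f \<in> ?A"
    then obtain p where p: "p \<in> polys_over (range ?h)" "f = poly p T_at" by (auto simp: adjoin_def)
    have co: "coeff p j i \<in> range \<kappa>" "coeff p j i = coeff p j i'" for i i' j
      using coeff_polys_over[OF p(1), of j] by auto
    have co_\<Lambda>: "coeff p j i \<in> \<Lambda>" for i j using co(1)[of j i] \<kappa>_\<Lambda> by auto
    show "f None \<in> \<Lambda>" unfolding p(2) poly_fun_apply
      using co_\<Lambda> T_\<Lambda>
      by (intro poly_polys_over[OF \<Lambda>_Sub]) (auto simp: polys_over_def coeff_map_poly_apply T_at_def)
    show "f (Some z) \<in> range \<kappa>" for z unfolding p(2) poly_fun_apply
      using co(1) T_range by (intro rc_poly[OF range_\<kappa>]) (auto simp: polys_over_def coeff_map_poly_apply T_at_def)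
    assume f0: "f None = 0"
    define p' where "p' = map_poly (\<lambda>c. inv_into UNIV \<kappa> (c None)) p"
    have inv0: "inv_into UNIV \<kappa> 0 = 0" using is_hom_inj[OF \<kappa>] is_hom_0[OF \<kappa>] by (metis inv_f_f injI)
    have "\<kappa> (coeff p' j) = coeff p j None" for j
      using co(1)[of j None] by (simp add: p'_def coeff_map_poly inv0 f_inv_into_f)
    then have "map_poly \<kappa> p' = map_poly (\<lambda>c. c None) p"
      by (intro poly_eqI) (simp add: coeff_map_poly is_hom_0[OF \<kappa>])
    then have "poly (map_poly \<kappa> p') T = 0" using f0 by (simp add: p poly_fun_apply T_at_def)
    then have "p' = 0" using T by blast
    then have "coeff p j None = 0" for j using \<open>\<And>j. \<kappa> (coeff p' j) = coeff p j None\<close>[of j] is_hom_0[OF \<kappa>] by simp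
    then have "coeff p j = 0" for j using co(2)[of j None] by (auto simp: fun_eq_iff)
    then have "p = 0" by (simp add: poly_eq_iff)
    then show "\<forall>\<^sub>F z in cofinite. f (Some z) = 0" by (simp add: p)
  qed
  then show ?thesis by blast
qed

text \<open>As for arcs, with algebraic closedness in place of Hensel's lemma: the value at z is any
  root of the specialised minimal relation of \<open>x\<close>, and minimality makes every other
  relation of \<open>x\<close> hold for the chosen roots at almost all z.\<close>

lemma spec_ring_extend:
  assumes A: "spec_ring A" and x: "x \<in> \<Lambda>"
  shows "\<exists>y. y None = x \<and> spec_ring (adjoin A y)"
proof -
  note rc = spec_ringD(1)[OF A]
  \<comment> \<open>The principal filter is an ultrafilter; vanishing along it is vanishing at the
    generic index \<open>None\<close>.\<close>
  let ?U = "principal {None :: rat option}"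
  have ev_U: "(\<forall>\<^sub>F i in ?U. P i) \<longleftrightarrow> P None" for P by (simp add: eventually_principal)
  obtain m where m: "min_poly k0 x m" using min_poly_exists[OF k0] x by (auto simp: \<Lambda>_def)
  then obtain d P where dP: "d \<noteq> 0" "map_poly ev P = smult (ev d) m"
    using clear_denominators[of m] by (auto simp: min_poly_def)
  have Q0: "Q_at 0 = 0" by (auto simp: Q_at_def)
  define f where "f = map_poly Q_at P"
  have cf: "coeff f j = Q_at (coeff P j)" for j by (simp add: f_def coeff_map_poly Q0)
  have fA: "f \<in> polys_over A" using Q_at_in[OF A] by (simp add: polys_over_def cf)
  have fN: "map_poly (\<lambda>c. c None) f = map_poly ev P"
    by (rule poly_eqI) (simp add: coeff_map_poly_apply cf Q_at_None coeff_map_poly is_hom_0[OF is_hom_ev])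
  have f0: "poly f (\<lambda>_. x) None = 0" using m by (simp add: poly_fun_apply fN dP min_poly_def)
  have "map_poly ev P \<noteq> 0" using dP ev_nonzero[OF dP(1)] m by (auto simp: min_poly_def)
  then obtain j where "coeff (map_poly ev P) j \<noteq> 0" by (auto simp: poly_eq_iff)
  then have fj: "coeff f j None \<noteq> 0" by (simp add: cf Q_at_None coeff_map_poly is_hom_0[OF is_hom_ev])
  obtain g where g: "g \<in> polys_over A" "degree g > 0" "poly g (\<lambda>_. x) None = 0" "lead_coeff g None \<noteq> 0"
      "\<And>h j. h \<in> polys_over A \<Longrightarrow> degree h < degree g \<Longrightarrow> poly h (\<lambda>_. x) None = 0 \<Longrightarrow> coeff h j None = 0"
    using minimal_relation[OF rc, of ?U f "\<lambda>_. x" j] fA f0 fj unfolding ev_U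
    by (auto simp: principal_eq_bot_iff)
  \<comment> \<open>The value 0 keeps \<open>y\<close> in the range of \<kappa>; it is a mere
    default only at the finitely many z where the leading coefficient of \<open>g\<close>
    vanishes.\<close>
  define y where "y i = (case i of None \<Rightarrow> x | Some z \<Rightarrow>
    if \<exists>w\<in>range \<kappa>. poly (map_poly (\<lambda>c. c (Some z)) g) w = 0
    then SOME w. w \<in> range \<kappa> \<and> poly (map_poly (\<lambda>c. c (Some z)) g) w = 0 else 0)" for i
  have yN: "y None = x" by (simp add: y_def)
  have yS: "y (Some z) \<in> range \<kappa> \<and> poly (map_poly (\<lambda>c. c (Some z)) g) (y (Some z)) = 0"
    if "\<exists>w\<in>range \<kappa>. poly (map_poly (\<lambda>c. c (Some z)) g) w = 0" for z
  proof -
    have "\<exists>w. w \<in> range \<kappa> \<and> poly (map_poly (\<lambda>c. c (Some z)) g) w = 0" using that by blast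
    from someI_ex[OF this] show ?thesis using that by (simp add: y_def)
  qed
  have pN: "poly h y None = poly h (\<lambda>_. x) None" for h by (simp add: poly_fun_apply yN)
  have lc: "\<forall>\<^sub>F z in cofinite. lead_coeff g (Some z) \<noteq> 0"
    using spec_nonzero[OF A coeff_polys_over[OF g(1)] g(4)] .
  then have root: "\<forall>\<^sub>F z in cofinite. poly g y (Some z) = 0"
  proof eventually_elim
    case (elim z)
    let ?gz = "map_poly (\<lambda>c. c (Some z)) g"
    define p where "p = map_poly (inv_into UNIV \<kappa>) ?gz"
    have inv0: "inv_into UNIV \<kappa> 0 = 0" using is_hom_inj[OF \<kappa>] is_hom_0[OF \<kappa>] by (metis inv_f_f injI)
    have "\<kappa> (coeff p j) = coeff ?gz j" for j
      using spec_ringD(5)[OF A coeff_polys_over[OF g(1)], of j z]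
      by (simp add: p_def coeff_map_poly inv0 f_inv_into_f)
    then have gz: "?gz = map_poly \<kappa> p" by (intro poly_eqI) (simp add: coeff_map_poly is_hom_0[OF \<kappa>])
    have "\<kappa> (coeff p (degree g)) \<noteq> 0" using elim \<open>\<kappa> (coeff p (degree g)) = _\<close> by (simp add: coeff_map_poly_apply)
    then have "coeff p (degree g) \<noteq> 0" using is_hom_0[OF \<kappa>] by auto
    then have "degree p > 0" using g(2) le_degree by fastforce
    then obtain r where "poly p r = 0" using alg_closed_imp_poly_has_root by blast
    then have "poly ?gz (\<kappa> r) = 0" using is_hom_poly[OF \<kappa>, of p r] is_hom_0[OF \<kappa>] by (simp add: gz)
    then show ?case using yS[of z] by (auto simp: poly_fun_apply)
  qed
  have "spec_ring (adjoin A y)"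
  proof (rule spec_ring_adjoin[OF A])
    show "y None \<in> \<Lambda>" using x yN by simp
    show "y (Some z) \<in> range \<kappa>" for z
      using yS[of z] rc_0[OF range_\<kappa>] by (cases "\<exists>w\<in>range \<kappa>. poly (map_poly (\<lambda>c. c (Some z)) g) w = 0") (auto simp: y_def)
    fix h assume h: "h \<in> polys_over A" "poly h y None = 0"
    have "\<forall>\<^sub>F i in filtermap Some cofinite. poly h y i = 0"
      by (rule relations_transfer_adjoin[OF rc, of ?U _ g])
         (use spec_ringD(6)[OF A] g h root lc in \<open>auto simp: ev_U pN eventually_filtermap\<close>)
    then show "\<forall>\<^sub>F z in cofinite. poly h y (Some z) = 0" by (simp add: eventually_filtermap)
  qed
  then show ?thesis using yN by blast
qed

lemma spec_ring_finite:
  assumes "finite S" "S \<subseteq> \<Lambda>"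
  shows "\<exists>A F. spec_ring A \<and> (\<forall>x\<in>S. F x \<in> A \<and> F x None = x)"
  using assms
proof (induction S rule: finite_induct)
  case empty
  then show ?case using spec_ring_base by auto
next
  case (insert x S)
  then obtain A F where A: "spec_ring A" "\<forall>x\<in>S. F x \<in> A \<and> F x None = x" by auto
  obtain y where y: "y None = x" "spec_ring (adjoin A y)" using spec_ring_extend[OF A(1)] insert.prems by blast
  show ?case
    using A(2) y insert.hyps subset_adjoin_rc[OF spec_ringD(1)[OF A(1)], of y] in_adjoin_rc[OF spec_ringD(1)[OF A(1)], of y]
    by (intro exI[of _ "adjoin A y"] exI[of _ "F(x := y)"]) auto
qed

end

section \<open>Specialising so as to avoid given algebraic numbers\<close>

context specialisation
begin

text \<open>Since \<open>\<kappa> b\<close> is not in the field generated by \<open>W\<close>, some conjugate \<open>\<rho>\<close> of a primitive element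
  \<open>\<gamma>\<close> induces the identity on \<open>W\<close> but moves \<open>\<kappa> b\<close>.\<close>

lemma conjugate_over:
  assumes W: "finite W" "W \<subseteq> \<Lambda>" "T \<in> W" and b: "\<kappa> b \<notin> field_gen W"
  shows "\<exists>\<gamma> \<rho> v m. min_poly k0 \<gamma> m \<and> poly m \<rho> = 0 \<and>
    (\<forall>x\<in>insert (\<kappa> b) W. v x \<in> polys_over k0 \<and> poly (v x) \<gamma> = x) \<and>
    (\<forall>x\<in>W. poly (v x) \<rho> = x) \<and> poly (v (\<kappa> b)) \<rho> \<noteq> \<kappa> b"
proof -
  let ?S = "insert (\<kappa> b) W" and ?F = "field_gen W"
  have "\<forall>x\<in>?S. alg_over k0 x" using W \<kappa>_\<Lambda> by (auto simp: \<Lambda>_def)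
  then obtain \<gamma> where \<gamma>: "\<gamma> \<in> field_gen (k0 \<union> ?S)" "alg_over k0 \<gamma>" "?S \<subseteq> adjoin k0 \<gamma>"
    using primitive_element[OF k0, of ?S] W(1) by auto
  have "\<forall>x\<in>?S. \<exists>p. p \<in> polys_over k0 \<and> poly p \<gamma> = x"
  proof
    fix x assume "x \<in> ?S"
    then have "x \<in> adjoin k0 \<gamma>" using \<gamma>(3) by (rule subsetD[rotated])
    then show "\<exists>p. p \<in> polys_over k0 \<and> poly p \<gamma> = x" by (auto simp: adjoin_def)
  qed
  from bchoice[OF this] obtain v where v: "\<And>x. x \<in> ?S \<Longrightarrow> v x \<in> polys_over k0 \<and> poly (v x) \<gamma> = x"
    by (elim exE) (rule that, erule bspec)
  have F: "?F \<in> Sub" by (rule field_gen_in_Sub)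
  have k0F: "k0 \<subseteq> ?F" using W(3) by (intro field_gen_mono) auto
  have "\<gamma> \<notin> ?F"
  proof
    assume "\<gamma> \<in> ?F"
    then have "adjoin k0 \<gamma> \<subseteq> ?F" by (rule adjoin_least[OF F k0F])
    then show False using \<gamma>(3) b by blast
  qed
  \<comment> \<open>The minimal polynomial is taken over the field generated by \<open>W\<close>,
    not over \<open>k0\<close>, so that the conjugation fixes \<open>W\<close>.\<close>
  obtain \<mu> where \<mu>: "min_poly ?F \<gamma> \<mu>" using min_poly_exists[OF F alg_over_mono[OF \<gamma>(2) k0F]] .
  obtain \<rho> where \<rho>: "\<rho> \<noteq> \<gamma>" "poly \<mu> \<rho> = 0"
    using min_poly_other_root[OF F \<mu> min_poly_degree_ge_2[OF F \<mu> \<open>\<gamma> \<notin> ?F\<close>]] .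
  have conjF: "poly p \<rho> = 0" if p: "p \<in> polys_over ?F" "poly p \<gamma> = 0" for p
    using min_poly_dvd[OF F \<mu> p] \<rho>(2) by (metis dvdE mult_eq_0_iff poly_mult)
  then have conj: "poly p \<rho> = 0" if p: "p \<in> polys_over k0" "poly p \<gamma> = 0" for p
    using p polys_over_mono[OF k0F] by blast
  obtain m where m: "min_poly k0 \<gamma> m" using min_poly_exists[OF k0 \<gamma>(2)] .
  have vW: "poly (v x) \<rho> = x" if "x \<in> W" for x
  proof -
    have "x \<in> ?F" using that field_gen_superset by blast
    then have "v x - [:x:] \<in> polys_over ?F"
      using v[of x] that polys_over_mono[OF k0F]
      by (intro polys_over_diff[OF F]) (auto simp: polys_over_pCons polys_over_0[OF F])
    then have "poly (v x - [:x:]) \<rho> = 0" using v[of x] that by (intro conjF) auto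
    then show ?thesis by simp
  qed
  \<comment> \<open>Otherwise the conjugation would fix \<open>k0\<close>, \<open>W\<close> and
    \<open>\<kappa> b\<close>, hence the primitive element \<gamma> in the field they generate,
    against the choice of \<rho>.\<close>
  have vb: "poly (v (\<kappa> b)) \<rho> \<noteq> \<kappa> b"
  proof
    assume vb: "poly (v (\<kappa> b)) \<rho> = \<kappa> b"
    define Y where "Y = {x. \<exists>r\<in>polys_over k0. poly r \<gamma> = x \<and> poly r \<rho> = x}"
    have "Y \<in> Sub" unfolding Y_def using conjugation_fixed_field[OF k0 \<gamma>(2) conj] .
    moreover have "k0 \<union> ?S \<subseteq> Y"
    proof
      fix x assume "x \<in> k0 \<union> ?S"
      then consider "x \<in> k0" | "x \<in> ?S" by blast
      then show "x \<in> Y"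
      proof cases
        case 1
        then have "[:x:] \<in> polys_over k0" by (simp add: polys_over_pCons polys_over_0[OF k0])
        then show ?thesis unfolding Y_def by (auto intro!: bexI[of _ "[:x:]"])
      next
        case 2
        then show ?thesis using v[of x] vW vb unfolding Y_def by auto
      qed
    qed
    ultimately have "\<gamma> \<in> Y" using field_gen_least \<gamma>(1) by blast
    then obtain r where r: "r \<in> polys_over k0" "poly r \<gamma> = \<gamma>" "poly r \<rho> = \<gamma>" by (auto simp: Y_def)
    have "poly (r - [:0, 1:]) \<rho> = 0"
      using r Sub_0[OF k0] Sub_1[OF k0]
      by (intro conj polys_over_diff[OF k0]) (auto simp: polys_over_pCons polys_over_0[OF k0])
    then show False using r(3) \<rho>(1) by simp
  qed
  have m\<rho>: "poly m \<rho> = 0" using m by (intro conj) (auto simp: min_poly_def)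
  show ?thesis
    by (rule exI[of _ \<gamma>], rule exI[of _ \<rho>], rule exI[of _ v], rule exI[of _ m])
       (use m m\<rho> v vW vb in simp)
qed

text \<open>The case distinction is there because \<open>F 0\<close> need not be the zero function,
  while coefficients beyond the degree must stay zero.\<close>

definition lift_poly :: "('o \<Rightarrow> rat option \<Rightarrow> 'o) \<Rightarrow> 'o poly \<Rightarrow> (rat option \<Rightarrow> 'o) poly" where
  "lift_poly F p = map_poly (\<lambda>a. if a = 0 then 0 else F a) p"

lemma coeff_lift_poly: "coeff (lift_poly F p) j = (if coeff p j = 0 then 0 else F (coeff p j))"
  by (simp add: lift_poly_def coeff_map_poly)

lemma coeff_set_coeffs: "coeff p j \<noteq> 0 \<Longrightarrow> coeff p j \<in> set (coeffs p)"
  using coeff_in_coeffs[of p j] le_degree[of p j] by fastforce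

abbreviation poly_at :: "(rat option \<Rightarrow> 'o) poly \<Rightarrow> rat option \<Rightarrow> 'o poly" where
  "poly_at f i \<equiv> map_poly (\<lambda>c. c i) f"

lemma is_hom_apply: "is_hom (\<lambda>f :: rat option \<Rightarrow> 'o. f i)"
  by (simp add: is_hom_def)

lemma spec_poly_rational:
  assumes A: "spec_ring A" and f: "f \<in> polys_over A" "poly_at f None \<in> polys_over k0"
  shows "\<forall>\<^sub>F z in cofinite. poly_at f (Some z) \<in> polys_over \<rat>"
proof -
  have "\<forall>\<^sub>F z in cofinite. \<forall>j\<in>{..degree f}. coeff f j (Some z) \<in> \<rat>"
    using spec_rational[OF A coeff_polys_over[OF f(1)]] coeff_polys_over[OF f(2)]
    by (intro eventually_ball_finite) (auto simp: coeff_map_poly_apply)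
  then show ?thesis
  proof eventually_elim
    case (elim z)
    show ?case unfolding polys_over_def mem_Collect_eq coeff_map_poly_apply
    proof
      fix j show "coeff f j (Some z) \<in> \<rat>" using elim by (cases "j \<le> degree f") (auto simp: coeff_eq_0)
    qed
  qed
qed

lemma lift_poly_props:
  assumes A: "spec_ring A" and F: "\<And>x. x \<in> set (coeffs p) \<Longrightarrow> F x \<in> A \<and> F x None = x"
  shows "lift_poly F p \<in> polys_over A" "poly_at (lift_poly F p) None = p"
proof -
  show "lift_poly F p \<in> polys_over A"
    unfolding polys_over_def mem_Collect_eq coeff_lift_poly
    using F coeff_set_coeffs rc_0[OF spec_ringD(1)[OF A]] by auto
  show "poly_at (lift_poly F p) None = p"
    using F coeff_set_coeffs by (intro poly_eqI) (auto simp: coeff_map_poly_apply coeff_lift_poly)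
qed

text \<open>Hilbert irreducibility: a proper factor of the specialised minimal polynomial is a subproduct
  of the specialised linear factors, and the corresponding generic subproduct has a coefficient
  outside \<open>k0\<close>.\<close>

lemma spec_min_poly_irreducible:
  assumes A: "spec_ring A" and m: "min_poly k0 \<gamma> m" and rs: "m = (\<Prod>i<degree m. [:- rs i, 1:])"
    and R: "\<And>i. i < degree m \<Longrightarrow> R i \<in> A \<and> R i None = rs i"
  shows "\<forall>\<^sub>F z in nonthin. \<forall>r\<in>polys_over \<rat>. \<forall>i<degree m. \<forall>j<degree m.
    poly r (R i (Some z)) = 0 \<longrightarrow> poly r (R j (Some z)) = 0"
proof -
  define N where "N = degree m"
  note rc = spec_ringD(1)[OF A]
  define M where "M I = (\<Prod>i\<in>I. [:- R i, 1:])" for I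
  have M_at: "poly_at (M I) x = (\<Prod>i\<in>I. [:- R i x, 1:])" for I x
    unfolding M_def is_hom_prod[OF is_hom_map_poly[OF is_hom_apply]]
    by (simp add: map_poly_pCons)
  have M_in: "M I \<in> polys_over A" if "I \<subseteq> {..<N}" for I
  proof -
    have "finite I" using that finite_subset by blast
    then show ?thesis using that unfolding M_def
    proof (induction I rule: finite_induct)
      case empty
      then show ?case using rc_polys_1[OF rc] by simp
    next
      case (insert i I)
      have lin: "[:- R i, 1:] \<in> polys_over A"
        using R[of i] insert.prems rc_uminus[OF rc] rc_1[OF rc] rc_polys_0[OF rc]
        by (auto simp: polys_over_pCons N_def)
      have "(\<Prod>i\<in>I. [:- R i, 1:]) \<in> polys_over A" using insert.IH insert.prems by blast
      then show ?case unfolding prod.insert[OF insert.hyps] by (rule rc_polys_mult[OF rc lin])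
    qed
  qed
  have M_None: "poly_at (M I) None = (\<Prod>i\<in>I. [:- rs i, 1:])" if "I \<subseteq> {..<N}" for I
    unfolding M_at using that R by (intro prod.cong) (auto simp: N_def)
  have m_props: "m \<in> polys_over k0" "poly m \<gamma> = 0" "m \<noteq> 0" using m by (auto simp: min_poly_def)
  \<comment> \<open>If all coefficients were in \<open>k0\<close>, the complementary factor would
    have its coefficients there too, and one of two factors of degree below N would vanish at
    \<gamma>.\<close>
  have irr: "\<exists>j. coeff (M I) j None \<notin> k0" if I: "I \<subseteq> {..<N}" "I \<noteq> {}" "I \<noteq> {..<N}" for I
  proof (rule ccontr)
    assume neg: "\<not> ?thesis"
    define p where "p = (\<Prod>i\<in>I. [:- rs i, 1:])"
    define q where "q = (\<Prod>i\<in>{..<N} - I. [:- rs i, 1:])"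
    have "coeff p j = coeff (M I) j None" for j using M_None[OF I(1)] by (metis coeff_map_poly_apply p_def)
    then have p: "p \<in> polys_over k0" using neg by (simp add: polys_over_def)
    have fin: "finite I" using I(1) finite_subset by blast
    have m_pq: "m = q * p" unfolding p_def q_def
      by (subst rs) (simp add: N_def[symmetric] prod.subset_diff[OF I(1)])
    have p0: "p \<noteq> 0" using m_pq m_props by auto
    have "m div p \<in> polys_over k0" by (rule polys_over_div[OF k0 m_props(1) p])
    then have q: "q \<in> polys_over k0" using p0 by (simp add: m_pq)
    have q0: "q \<noteq> 0" using m_pq m_props by auto
    have "card I < N" "card I > 0"
      using I fin psubset_card_mono[of "{..<N}" I] by (auto simp: card_gt_0_iff)
    then have "degree p < N" "degree q < N"
      using fin I(1) by (auto simp: p_def q_def degree_linear_prod card_Diff_subset)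
    moreover have "poly p \<gamma> = 0 \<or> poly q \<gamma> = 0" using m_props m_pq by auto
    ultimately show False using m p q p0 q0 unfolding min_poly_def N_def by (meson not_le)
  qed
  have "\<forall>\<^sub>F z in nonthin. \<forall>I\<in>{I. I \<subseteq> {..<N} \<and> I \<noteq> {} \<and> I \<noteq> {..<N}}. \<exists>j. coeff (M I) j (Some z) \<notin> \<rat>"
  proof (rule eventually_ball_finite)
    show "finite {I. I \<subseteq> {..<N} \<and> I \<noteq> {} \<and> I \<noteq> {..<N}}"
      by (rule finite_subset[of _ "Pow {..<N}"]) auto
    show "\<forall>I\<in>{I. I \<subseteq> {..<N} \<and> I \<noteq> {} \<and> I \<noteq> {..<N}}. \<forall>\<^sub>F z in nonthin. \<exists>j. coeff (M I) j (Some z) \<notin> \<rat>"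
    proof
      \<comment> \<open>One irrational coefficient per subproduct suffices, and there are finitely
        many subproducts, so \<open>spec_irrational\<close> excludes a thin set of z in
        total.\<close>
      fix I assume I: "I \<in> {I. I \<subseteq> {..<N} \<and> I \<noteq> {} \<and> I \<noteq> {..<N}}"
      then obtain j where "coeff (M I) j None \<notin> k0" using irr[of I] by auto
      then have "\<forall>\<^sub>F z in nonthin. coeff (M I) j (Some z) \<notin> \<rat>"
        using I by (intro spec_irrational[OF A] coeff_polys_over[OF M_in]) auto
      then show "\<forall>\<^sub>F z in nonthin. \<exists>j. coeff (M I) j (Some z) \<notin> \<rat>" by (rule eventually_mono) blast
    qed
  qed
  moreover have "\<forall>\<^sub>F z in nonthin. poly_at (M {..<N}) (Some z) \<in> polys_over \<rat>"
  proof (rule filter_leD[OF nonthin_le_cofinite], rule spec_poly_rational[OF A M_in])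
    show "poly_at (M {..<N}) None \<in> polys_over k0"
      unfolding M_None[OF order.refl] unfolding N_def rs[symmetric] by (rule m_props(1))
  qed simp
  ultimately show ?thesis
  proof eventually_elim
    case (elim z)
    let ?P = "\<Prod>i<N. [:- R i (Some z), 1:]"
    show ?case
    proof (intro ballI allI impI)
      fix r i j
      assume r: "r \<in> polys_over \<rat>" and i: "i < degree m" and j: "j < degree m"
        and ri: "poly r (R i (Some z)) = 0"
      let ?x = "R i (Some z)"
      have Px: "poly ?P (R l (Some z)) = 0" if "l < N" for l using that by (auto simp: poly_prod)
      have Prat: "?P \<in> polys_over \<rat>" using elim(2) by (simp add: M_at)
      have P0: "?P \<noteq> 0" by simp
      have "alg_over \<rat> ?x" unfolding alg_over_def
        by (rule bexI[of _ ?P], rule conjI[OF P0 Px], use i in \<open>simp add: N_def\<close>, rule Prat)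
      \<comment> \<open>The minimal polynomial over Q of a specialised root is a nonempty subproduct
        with rational coefficients, hence the full product; as it divides \<open>r\<close>, every
        specialised root is a root of \<open>r\<close>.\<close>
      then obtain \<mu> where \<mu>: "min_poly \<rat> ?x \<mu>" using min_poly_exists[OF Rats_in_Sub] by blast
      have "\<mu> dvd ?P" using min_poly_dvd[OF Rats_in_Sub \<mu> Prat] Px i by (simp add: N_def)
      then have "\<exists>I\<subseteq>{..<N}. \<mu> = (\<Prod>i\<in>I. [:- R i (Some z), 1:])"
        by (rule monic_dvd_linear_prod[rotated 2]) (use \<mu> in \<open>auto simp: min_poly_def\<close>)
      then obtain I where I: "I \<subseteq> {..<N}" "\<mu> = (\<Prod>i\<in>I. [:- R i (Some z), 1:])" by blast
      have "I \<noteq> {}" using I \<mu> by (auto simp: min_poly_def)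
      have "coeff (M I) l (Some z) \<in> \<rat>" for l
      proof -
        have "coeff (M I) l (Some z) = coeff \<mu> l" unfolding I(2) M_at[symmetric] by (simp add: coeff_map_poly_apply)
        then show ?thesis using \<mu> by (auto simp: min_poly_def polys_over_def)
      qed
      then have "I = {..<N}" using elim(1) I(1) \<open>I \<noteq> {}\<close> by blast
      then have "poly \<mu> (R j (Some z)) = 0" using Px j I(2) by (simp add: N_def)
      moreover have "\<mu> dvd r" using min_poly_dvd[OF Rats_in_Sub \<mu> r ri] .
      ultimately show "poly r (R j (Some z)) = 0" by (auto simp: dvd_def)
    qed
  qed
qed

text \<open>The identities v_x(\<gamma>) = x = v_x(\<rho>) for x in \<open>W\<close>, and the
  inequality for \<open>\<kappa> b\<close>, specialise, so the specialised conjugation fixes the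
  specialisation of \<open>W\<close> but cannot fix \<open>\<kappa> b\<close>. The set
  \<open>S\<close> of auxiliary elements is chosen before \<open>A\<close> and \<open>F\<close>, so
  that several b can be treated with one common ring.\<close>

lemma spec_notin_field_gen:
  assumes W: "finite W" "W \<subseteq> \<Lambda>" "T \<in> W" and b: "\<kappa> b \<notin> field_gen W"
  shows "\<exists>S. finite S \<and> S \<subseteq> \<Lambda> \<and> (\<forall>A F. spec_ring A \<longrightarrow> (\<forall>x\<in>S \<union> W. F x \<in> A \<and> F x None = x) \<longrightarrow>
    (\<forall>\<^sub>F z in nonthin. \<kappa> b \<notin> field_gen ((\<lambda>x. F x (Some z)) ` W)))"
proof -
  from conjugate_over[OF assms] obtain \<gamma> \<rho> v m where m: "min_poly k0 \<gamma> m" "poly m \<rho> = 0"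
    and v': "\<forall>x\<in>insert (\<kappa> b) W. v x \<in> polys_over k0 \<and> poly (v x) \<gamma> = x"
    and vW': "\<forall>x\<in>W. poly (v x) \<rho> = x" and vb: "poly (v (\<kappa> b)) \<rho> \<noteq> \<kappa> b"
    by (elim exE conjE)
  note v = bspec[OF v'] and vW = bspec[OF vW']
  obtain rs where rs: "m = (\<Prod>i<degree m. [:- rs i, 1:])"
    using monic_splits[of m] m(1) by (auto simp: min_poly_def)
  have root_rs: "\<exists>i<degree m. x = rs i" if "poly m x = 0" for x
  proof -
    have "(\<Prod>i<degree m. poly [:- rs i, 1:] x) = 0" using that by (subst (asm) rs) (simp add: poly_prod)
    then show ?thesis by (auto simp: prod_zero_iff)
  qed
  obtain i where i: "i < degree m" "\<gamma> = rs i" using root_rs m(1) by (auto simp: min_poly_def)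
  obtain j where j: "j < degree m" "\<rho> = rs j" using root_rs m(2) by blast
  \<comment> \<open>All elements whose specialisations enter the argument: the roots of
    \<open>m\<close> and the coefficients that express \<open>W\<close> and
    \<open>\<kappa> b\<close> through \<gamma>.\<close>
  define S where "S = rs ` {..<degree m} \<union> (\<Union>x\<in>insert (\<kappa> b) W. set (coeffs (v x)))"
  have "finite S" using W(1) by (simp add: S_def)
  moreover have "S \<subseteq> \<Lambda>"
  proof -
    have "poly m (rs l) = 0" if "l < degree m" for l
      using that by (subst rs) (auto simp: poly_prod)
    then have "rs l \<in> \<Lambda>" if "l < degree m" for l
    proof -
      have "m \<in> polys_over k0" "m \<noteq> 0" using m(1) by (auto simp: min_poly_def)
      then show ?thesis using \<open>\<And>l. l < degree m \<Longrightarrow> poly m (rs l) = 0\<close>[OF that]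
        unfolding \<Lambda>_def alg_over_def mem_Collect_eq by (intro bexI[of _ m] conjI)
    qed
    moreover have "set (coeffs (v x)) \<subseteq> \<Lambda>" if "x \<in> insert (\<kappa> b) W" for x
    proof -
      have "set (coeffs (v x)) \<subseteq> range (coeff (v x))" by (auto simp: coeffs_def)
      then show ?thesis using v[OF that] k0_\<Lambda> by (auto simp: polys_over_def)
    qed
    ultimately show ?thesis unfolding S_def by blast
  qed
  moreover have "\<forall>\<^sub>F z in nonthin. \<kappa> b \<notin> field_gen ((\<lambda>x. F x (Some z)) ` W)"
    if A: "spec_ring A" and F: "\<forall>x\<in>S \<union> W. F x \<in> A \<and> F x None = x" for A F
  proof -
    note rc = spec_ringD(1)[OF A]
    define V where "V x = lift_poly F (v x)" for x
    have F_coeffs: "F a \<in> A \<and> F a None = a" if "x \<in> insert (\<kappa> b) W" "a \<in> set (coeffs (v x))" for x a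
      using F that by (auto simp: S_def)
    have V: "V x \<in> polys_over A" "poly_at (V x) None = v x" if "x \<in> insert (\<kappa> b) W" for x
      using lift_poly_props[OF A, of "v x" F] F_coeffs[OF that] by (auto simp: V_def)
    have FR: "F (rs l) \<in> A \<and> F (rs l) None = rs l" if "l < degree m" for l using F that by (auto simp: S_def)
    have PV: "poly (V x) (F (rs l)) \<in> A" "poly (V x) (F (rs l)) None = poly (v x) (rs l)"
      if "x \<in> insert (\<kappa> b) W" "l < degree m" for x l
      using V[OF that(1)] FR[OF that(2)] rc_poly[OF rc] by (auto simp: poly_fun_apply)
    have "\<forall>\<^sub>F z in cofinite. \<forall>x\<in>W. poly_at (V x) (Some z) \<in> polys_over \<rat> \<and>
        poly (V x) (F \<gamma>) (Some z) = F x (Some z) \<and> poly (V x) (F \<rho>) (Some z) = F x (Some z)"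
    proof (rule eventually_ball_finite[OF W(1)], rule ballI)
      fix x assume x: "x \<in> W"
      have "\<forall>\<^sub>F z in cofinite. poly_at (V x) (Some z) \<in> polys_over \<rat>"
        using spec_poly_rational[OF A V(1)] V(2) v x by auto
      moreover have "\<forall>\<^sub>F z in cofinite. poly (V x) (F \<gamma>) (Some z) = F x (Some z)"
        using PV[of x i] i v[of x] F x by (intro spec_eq[OF A]) auto
      moreover have "\<forall>\<^sub>F z in cofinite. poly (V x) (F \<rho>) (Some z) = F x (Some z)"
        using PV[of x j] j vW[of x] F x by (intro spec_eq[OF A]) auto
      ultimately show "\<forall>\<^sub>F z in cofinite. poly_at (V x) (Some z) \<in> polys_over \<rat> \<and>
        poly (V x) (F \<gamma>) (Some z) = F x (Some z) \<and> poly (V x) (F \<rho>) (Some z) = F x (Some z)"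
        by (intro eventually_conj)
    qed
    moreover have "\<forall>\<^sub>F z in cofinite. poly_at (V (\<kappa> b)) (Some z) \<in> polys_over \<rat>"
      using spec_poly_rational[OF A V(1)] V(2) v by auto
    moreover have "\<forall>\<^sub>F z in cofinite. poly (V (\<kappa> b)) (F \<gamma>) (Some z) = \<kappa> b"
      using PV[of "\<kappa> b" i] i v[of "\<kappa> b"] spec_ringD(2)[OF A] spec_eq[OF A, of _ "\<lambda>_. \<kappa> b"] by auto
    moreover have "\<forall>\<^sub>F z in cofinite. poly (V (\<kappa> b)) (F \<rho>) (Some z) \<noteq> \<kappa> b"
    proof -
      have "poly (V (\<kappa> b)) (F \<rho>) - (\<lambda>_. \<kappa> b) \<in> A"
        using PV[of "\<kappa> b" j] j spec_ringD(2)[OF A] by (intro rc_diff[OF rc]) auto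
      moreover have "(poly (V (\<kappa> b)) (F \<rho>) - (\<lambda>_. \<kappa> b)) None \<noteq> 0" using PV(2)[of "\<kappa> b" j] j vb by simp
      ultimately have "\<forall>\<^sub>F z in cofinite. (poly (V (\<kappa> b)) (F \<rho>) - (\<lambda>_. \<kappa> b)) (Some z) \<noteq> 0"
        by (rule spec_nonzero[OF A])
      then show ?thesis by simp
    qed
    ultimately have "\<forall>\<^sub>F z in cofinite. (\<forall>x\<in>W. poly_at (V x) (Some z) \<in> polys_over \<rat> \<and>
        poly (V x) (F \<gamma>) (Some z) = F x (Some z) \<and> poly (V x) (F \<rho>) (Some z) = F x (Some z)) \<and>
      poly_at (V (\<kappa> b)) (Some z) \<in> polys_over \<rat> \<and> poly (V (\<kappa> b)) (F \<gamma>) (Some z) = \<kappa> b \<and>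
      poly (V (\<kappa> b)) (F \<rho>) (Some z) \<noteq> \<kappa> b"
      by (intro eventually_conj)
    then have "\<forall>\<^sub>F z in nonthin. (\<forall>x\<in>W. poly_at (V x) (Some z) \<in> polys_over \<rat> \<and>
        poly (V x) (F \<gamma>) (Some z) = F x (Some z) \<and> poly (V x) (F \<rho>) (Some z) = F x (Some z)) \<and>
      poly_at (V (\<kappa> b)) (Some z) \<in> polys_over \<rat> \<and> poly (V (\<kappa> b)) (F \<gamma>) (Some z) = \<kappa> b \<and>
      poly (V (\<kappa> b)) (F \<rho>) (Some z) \<noteq> \<kappa> b"
      by (rule filter_leD[OF nonthin_le_cofinite])
    moreover have "\<forall>\<^sub>F z in nonthin. \<forall>r\<in>polys_over \<rat>. \<forall>i<degree m. \<forall>j<degree m.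
        poly r (F (rs i) (Some z)) = 0 \<longrightarrow> poly r (F (rs j) (Some z)) = 0"
      using spec_min_poly_irreducible[OF A m(1) rs, of "\<lambda>l. F (rs l)"] FR by blast
    ultimately show ?thesis
    proof eventually_elim
      case (elim z)
      let ?g = "F \<gamma> (Some z)" and ?r = "F \<rho> (Some z)"
      \<comment> \<open>\<gamma> and \<rho> both occur among the roots \<open>rs\<close>, so their
        specialisations are conjugate over Q.\<close>
      have conj: "poly p ?r = 0" if "p \<in> polys_over \<rat>" "poly p ?g = 0" for p
        using elim(2) that i j by blast
      obtain q where q: "?g = \<kappa> q" using spec_ringD(5)[OF A, of "F \<gamma>" z] FR[of i] i by auto
      have alg: "alg_over \<rat> ?g" unfolding q by (rule alg_over_Rats_hom[OF \<kappa> algebraic])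
      define Y where "Y = {x. \<exists>p\<in>polys_over \<rat>. poly p ?g = x \<and> poly p ?r = x}"
      have "Y \<in> Sub" unfolding Y_def by (rule conjugation_fixed_field[OF Rats_in_Sub alg conj])
      moreover have "(\<lambda>x. F x (Some z)) ` W \<subseteq> Y"
        using elim(1) unfolding Y_def by (auto simp: poly_fun_apply)
      ultimately have "field_gen ((\<lambda>x. F x (Some z)) ` W) \<subseteq> Y" by (rule field_gen_least)
      moreover have "\<kappa> b \<notin> Y"
      proof
        assume "\<kappa> b \<in> Y"
        then obtain p where p: "p \<in> polys_over \<rat>" "poly p ?g = \<kappa> b" "poly p ?r = \<kappa> b" by (auto simp: Y_def)
        \<comment> \<open>\<open>p\<close> and \<open>?v\<close> agree at the specialisation of
          \<gamma>, hence at that of \<rho>, where \<open>?v\<close> does not take the value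
          \<open>\<kappa> b\<close>.\<close>
        let ?v = "poly_at (V (\<kappa> b)) (Some z)"
        have "poly (p - ?v) ?r = 0"
          using elim(1) p by (intro conj polys_over_diff[OF Rats_in_Sub]) (auto simp: poly_fun_apply)
        then show False using elim(1) p(3) by (simp add: poly_fun_apply)
      qed
      ultimately show ?case by blast
    qed
  qed
  ultimately show ?thesis by blast
qed

theorem specialise_avoiding:
  assumes W: "finite W" "W \<subseteq> \<Lambda>" "T \<in> W" and B: "finite B" "\<And>b. b \<in> B \<Longrightarrow> \<kappa> b \<notin> field_gen W"
  shows "\<exists>A F. spec_ring A \<and> (\<forall>x\<in>W. F x \<in> A \<and> F x None = x) \<and>
    (\<forall>\<^sub>F z in nonthin. \<forall>b\<in>B. \<kappa> b \<notin> field_gen ((\<lambda>x. F x (Some z)) ` W))"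
proof -
  have "\<forall>b\<in>B. \<exists>S. finite S \<and> S \<subseteq> \<Lambda> \<and> (\<forall>A F. spec_ring A \<longrightarrow> (\<forall>x\<in>S \<union> W. F x \<in> A \<and> F x None = x) \<longrightarrow>
    (\<forall>\<^sub>F z in nonthin. \<kappa> b \<notin> field_gen ((\<lambda>x. F x (Some z)) ` W)))"
    using spec_notin_field_gen[OF W] B(2) by blast
  then obtain S where S: "\<And>b. b \<in> B \<Longrightarrow> finite (S b) \<and> S b \<subseteq> \<Lambda>"
    and S': "\<And>b A F. b \<in> B \<Longrightarrow> spec_ring A \<Longrightarrow> \<forall>x\<in>S b \<union> W. F x \<in> A \<and> F x None = x \<Longrightarrow>
      \<forall>\<^sub>F z in nonthin. \<kappa> b \<notin> field_gen ((\<lambda>x. F x (Some z)) ` W)"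
    by metis
  have "finite (W \<union> (\<Union>b\<in>B. S b))" "W \<union> (\<Union>b\<in>B. S b) \<subseteq> \<Lambda>" using S W B by auto
  from spec_ring_finite[OF this] obtain A F
    where AF: "spec_ring A" "\<forall>x\<in>W \<union> (\<Union>b\<in>B. S b). F x \<in> A \<and> F x None = x"
    by (elim exE conjE)
  have "\<forall>b\<in>B. \<forall>\<^sub>F z in nonthin. \<kappa> b \<notin> field_gen ((\<lambda>x. F x (Some z)) ` W)"
  proof
    fix b assume "b \<in> B"
    then show "\<forall>\<^sub>F z in nonthin. \<kappa> b \<notin> field_gen ((\<lambda>x. F x (Some z)) ` W)"
      by (intro S'[OF _ AF(1)]) (use AF(2) in auto)
  qed
  then have "\<forall>\<^sub>F z in nonthin. \<forall>b\<in>B. \<kappa> b \<notin> field_gen ((\<lambda>x. F x (Some z)) ` W)"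
    by (rule eventually_ball_finite[OF B(1)])
  moreover have "\<forall>x\<in>W. F x \<in> A \<and> F x None = x" using AF(2) by simp
  ultimately show ?thesis using AF(1) by (intro exI conjI)
qed

end

section \<open>Existential formulas with infinitely many solutions\<close>

text \<open>Each equation is moved to one side: whether a formula holds then depends only on which
  of these terms vanish, which is the information that arcs and specialisations preserve.\<close>

primrec atoms :: "'a qfform \<Rightarrow> 'a rterm set" where
  "atoms (Equal s t) = {Plus s (Minus t)}"
| "atoms (Neg p) = atoms p"
| "atoms (Conj p q) = atoms p \<union> atoms q"
| "atoms (Disj p q) = atoms p \<union> atoms q"

lemma finite_atoms: "finite (atoms \<phi>)"
  by (induction \<phi>) auto

lemma atoms_vars: "t \<in> atoms \<phi> \<Longrightarrow> tvars t \<subseteq> fvars \<phi> \<and> set_rterm t \<subseteq> set_qfform \<phi>"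
  by (induction \<phi>) auto

lemma sat_eq_atoms: "(\<And>t. t \<in> atoms \<phi> \<Longrightarrow> tval e t = 0 \<longleftrightarrow> tval e' t = 0) \<Longrightarrow> sat e \<phi> \<longleftrightarrow> sat e' \<phi>"
  by (induction \<phi>) auto

lemma sat_cong: "(\<And>i. i \<in> fvars \<phi> \<Longrightarrow> e i = e' i) \<Longrightarrow> sat e \<phi> \<longleftrightarrow> sat e' \<phi>"
proof (rule sat_eq_atoms)
  fix t assume eq: "\<And>i. i \<in> fvars \<phi> \<Longrightarrow> e i = e' i" and t: "t \<in> atoms \<phi>"
  have "tval e t = tval e' t"
    unfolding tval_eq_tev using eq atoms_vars[OF t] by (intro tev_cong) blast
  then show "tval e t = 0 \<longleftrightarrow> tval e' t = 0" by simp
qed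

lemma alg_over_Rats_alg_closure: "alg_over \<rat> (x :: rat alg_closure)"
proof -
  have h: "is_hom (to_ac :: rat \<Rightarrow> _)" by (auto simp: is_hom_def)
  obtain p :: "rat poly" where p: "p \<noteq> 0" "poly (map_poly to_ac p) x = 0" by (rule alg_closure_algebraic)
  have co: "coeff (map_poly to_ac p) i = to_ac (coeff p i)" for i by (simp add: coeff_map_poly)
  have "to_ac q = of_rat q" for q using is_hom_of_rat_eq[OF h, of q] by simp
  then have "map_poly to_ac p \<in> polys_over \<rat>" by (simp add: polys_over_def co)
  moreover have "map_poly to_ac p \<noteq> 0" using p(1) by (auto simp: poly_eq_iff co)
  ultimately show ?thesis using p(2) by (auto simp: alg_over_def)
qed

text \<open>Substituting a + X amounts to a shift, which keeps a nonzero polynomial nonzero; this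
  makes the first coordinate of the arc transcendental over the constants.\<close>

lemma poly_shifted_X:
  "poly (map_poly fps_const p) (fps_const a + fps_X) = fps_of_poly (pcompose p [:a, 1 :: 'a::field:])"
proof (induction p)
  case (pCons c p)
  then show ?case
    by (simp add: map_poly_pCons pcompose_pCons fps_of_poly_add fps_of_poly_mult fps_of_poly_const fps_of_poly_linear
        add.commute)
qed simp

lemma eventually_nonthin_ex:
  assumes "eventually P nonthin" "\<not> thin_in_field Z"
  shows "\<exists>z\<in>Z. P z"
  using assms thin_in_field_subset[of "{z. \<not> P z}" Z] by (auto simp: eventually_nonthin)

definition solutions :: "'a::field set \<Rightarrow> nat \<Rightarrow> 'a qfform \<Rightarrow> 'a set" where
  "solutions L k \<phi> = {x\<in>L. \<exists>ys. length ys = k \<and> set ys \<subseteq> L \<and> sat (\<lambda>i. (x # ys) ! i) \<phi>}"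

theorem infinitely_many_solutions_spread:
  fixes L :: "rat alg_closure set"
  assumes L: "L \<in> Sub" and \<phi>: "set_qfform \<phi> \<subseteq> L" "fvars \<phi> \<subseteq> {..k}"
    and inf: "infinite (solutions L k \<phi>)"
    and C: "finite C" "C \<subseteq> L" and B: "finite B" "B \<inter> L = {}" and Z: "\<not> thin_in_field Z"
  shows "\<exists>K\<in>Sub. C \<subseteq> K \<and> K \<inter> B = {} \<and> (\<exists>z\<in>Z. of_rat z \<in> solutions K k \<phi>)"
proof -
  define S where "S = {e. (\<forall>i\<le>k. e i \<in> L) \<and> sat e \<phi>}"
  have "solutions L k \<phi> \<subseteq> (\<lambda>e. e 0) ` S"
  proof
    fix x assume "x \<in> solutions L k \<phi>"
    then obtain ys where ys: "x \<in> L" "length ys = k" "set ys \<subseteq> L" "sat (\<lambda>i. (x # ys) ! i) \<phi>"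
      by (auto simp: solutions_def)
    have "(\<lambda>i. (x # ys) ! i) \<in> S"
      using ys by (auto simp: S_def nth_Cons subset_iff split: nat.splits)
    then show "x \<in> (\<lambda>e. e 0) ` S" by (rule image_eqI[rotated]) simp
  qed
  then have infS: "infinite ((\<lambda>e. e 0) ` S)" using inf finite_subset by blast
  \<comment> \<open>Points of \<open>S\<close> whose first coordinate leaves every finite set; the
    filter is proper because this coordinate takes infinitely many values on
    \<open>S\<close>.\<close>
  let ?F = "inf (filtercomap (\<lambda>e. e 0) cofinite) (principal S)"
  have "?F \<noteq> bot"
  proof
    assume "?F = bot"
    then have "eventually (\<lambda>e. e \<in> S \<longrightarrow> False) (filtercomap (\<lambda>e. e 0) cofinite)"
      by (simp add: trivial_limit_def eventually_inf_principal)
    then obtain Q where Q: "eventually Q cofinite" "\<And>e. Q (e 0) \<Longrightarrow> e \<notin> S"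
      by (auto simp: eventually_filtercomap)
    then have "(\<lambda>e. e 0) ` S \<subseteq> {x. \<not> Q x}" by auto
    then show False using infS Q(1) finite_subset by (auto simp: eventually_cofinite)
  qed
  then obtain U where U: "U \<le> ?F" "U \<noteq> bot" "\<And>P. eventually P U \<or> eventually (\<lambda>e. \<not> P e) U"
    using ultrafilter_exists by metis
  have U_S: "\<forall>\<^sub>F \<xi> in U. \<xi> \<in> S"
    by (rule filter_leD[OF U(1)]) (simp add: eventually_inf_principal)
  \<comment> \<open>The algebraic closure of the field of Laurent series contains the arcs and the
    conjugates used in the specialisation.\<close>
  define \<iota> :: "rat alg_closure fps \<Rightarrow> rat alg_closure fls alg_closure" where "\<iota> f = to_ac (fps_to_fls f)" for f
  have \<iota>: "is_hom \<iota>" "inj \<iota>" by (auto simp: \<iota>_def is_hom_def fls_times_fps_to_fls inj_def)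
  have \<iota>0: "\<iota> f = 0 \<longleftrightarrow> f = 0" for f using \<iota> is_hom_0[OF \<iota>(1)] by (metis injD)
  define \<kappa> where "\<kappa> a = \<iota> (fps_const a)" for a
  have \<kappa>: "is_hom \<kappa>" unfolding \<kappa>_def using is_hom_comp[OF \<iota>(1) is_hom_fps_const] .
  \<comment> \<open>Constants are algebraic numbers, so what is algebraic over L(X) is already
    algebraic over Q(X).\<close>
  define \<Lambda> where "\<Lambda> = {x. alg_over (field_gen {\<iota> fps_X}) x}"
  have \<Lambda>: "\<Lambda> \<in> Sub" unfolding \<Lambda>_def by (intro algebraics_in_Sub field_gen_in_Sub)
  interpret gp: generic_points L U k \<iota> \<Lambda>
  proof
    show "\<forall>\<^sub>F \<xi> in U. \<xi> i \<in> L" if "i \<le> k" for i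
      using U_S by (rule eventually_mono) (use that in \<open>auto simp: S_def\<close>)
    show "\<forall>\<^sub>F \<xi> in U. \<xi> 0 \<noteq> c" for c
    proof (rule filter_leD[OF U(1)])
      have "eventually (\<lambda>\<xi>. \<xi> 0 \<noteq> c) (filtercomap (\<lambda>e. e (0 :: nat)) cofinite)"
        by (rule eventually_filtercomapI) (simp add: eventually_cofinite)
      then show "eventually (\<lambda>\<xi>. \<xi> 0 \<noteq> c) ?F" by (simp add: eventually_inf_principal eventually_mono)
    qed
    show "\<iota> (fps_const c) \<in> \<Lambda>" for c
      using alg_over_mono[OF alg_over_Rats_hom[OF \<kappa> alg_over_Rats_alg_closure] Rats_subset_Sub[OF field_gen_in_Sub]]
      by (simp add: \<Lambda>_def flip: \<kappa>_def)
    show "\<iota> fps_X \<in> \<Lambda>" unfolding \<Lambda>_def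
      using alg_over_self[OF field_gen_in_Sub] field_gen_superset[of "{\<iota> fps_X}"] by auto
    show "x \<in> \<Lambda>" if "alg_over \<Lambda> x" for x
      using that alg_over_trans[OF field_gen_in_Sub] unfolding \<Lambda>_def by blast
  qed (use L U \<iota> \<Lambda> in auto)
  have "\<forall>\<^sub>F \<xi> in U. \<exists>\<eta>. \<eta> 0 = fps_const (\<xi> 0) + fps_X \<and> (\<forall>i\<le>k. \<eta> i \<in> fps_over L \<and> \<iota> (\<eta> i) \<in> \<Lambda>) \<and>
     (\<forall>t\<in>atoms \<phi>. tval \<xi> t = 0 \<longleftrightarrow> tev fps_const \<eta> t = 0)"
    using atoms_vars \<phi> by (intro gp.generic_arc finite_atoms) blast
  with U_S have "\<forall>\<^sub>F \<xi> in U. \<xi> \<in> S \<and> (\<exists>\<eta>. \<eta> 0 = fps_const (\<xi> 0) + fps_X \<and>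
     (\<forall>i\<le>k. \<eta> i \<in> fps_over L \<and> \<iota> (\<eta> i) \<in> \<Lambda>) \<and>
     (\<forall>t\<in>atoms \<phi>. tval \<xi> t = 0 \<longleftrightarrow> tev fps_const \<eta> t = 0))" by (rule eventually_conj)
  then obtain \<xi> \<eta> where \<xi>: "\<xi> \<in> S" and \<eta>0: "\<eta> 0 = fps_const (\<xi> 0) + fps_X"
    and \<eta>: "\<And>i. i \<le> k \<Longrightarrow> \<eta> i \<in> fps_over L \<and> \<iota> (\<eta> i) \<in> \<Lambda>"
    and \<eta>_atoms: "\<And>t. t \<in> atoms \<phi> \<Longrightarrow> tval \<xi> t = 0 \<longleftrightarrow> tev fps_const \<eta> t = 0"
    using eventually_happens'[OF U(2)] by blast
  define T where "T = \<iota> (\<eta> 0)"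
  interpret sp: specialisation \<kappa> T
  proof
    fix p :: "rat alg_closure poly" assume p: "p \<noteq> 0"
    have "map_poly \<kappa> p = map_poly \<iota> (map_poly fps_const p)"
      by (rule poly_eqI) (simp add: coeff_map_poly \<kappa>_def is_hom_0[OF \<iota>(1)])
    then have "poly (map_poly \<kappa> p) T = \<iota> (fps_of_poly (pcompose p [:\<xi> 0, 1:]))"
      by (simp add: T_def \<eta>0 is_hom_poly[OF \<iota>(1), symmetric] poly_shifted_X)
    moreover have "pcompose p [:\<xi> 0, 1:] \<noteq> 0" using p by (simp add: pcompose_eq_0_iff)
    ultimately show "poly (map_poly \<kappa> p) T \<noteq> 0"
      using \<iota>0 fps_of_poly_eq_iff[of "pcompose p [:\<xi> 0, 1:]" 0] by simp
  qed (use \<kappa> alg_over_Rats_alg_closure in auto)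
  \<comment> \<open>X and \<open>T\<close> differ by the algebraic number \<open>\<xi> 0\<close>, so
    algebraic functions of X are algebraic functions of \<open>T\<close>.\<close>
  have \<Lambda>_sub: "\<Lambda> \<subseteq> sp.\<Lambda>"
  proof
    fix x assume "x \<in> \<Lambda>"
    have "\<iota> fps_X = T - \<kappa> (\<xi> 0)" by (simp add: T_def \<eta>0 \<kappa>_def is_hom_simps[OF \<iota>(1)])
    then have "\<iota> fps_X \<in> sp.\<Lambda>" using sp.T_\<Lambda> sp.\<kappa>_\<Lambda> Sub_diff[OF sp.\<Lambda>_Sub] by simp
    then have "field_gen {\<iota> fps_X} \<subseteq> sp.\<Lambda>" by (intro field_gen_least[OF sp.\<Lambda>_Sub]) simp
    then have "alg_over sp.\<Lambda> x" using \<open>x \<in> \<Lambda>\<close> alg_over_mono unfolding \<Lambda>_def by blast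
    then show "x \<in> sp.\<Lambda>" unfolding sp.\<Lambda>_def using alg_over_trans[OF sp.k0] by simp
  qed
  \<comment> \<open>Generators of the field to be specialised: the coordinates of the arc and the
    constants that the final field has to contain.\<close>
  define W where "W = (\<lambda>i. \<iota> (\<eta> i)) ` {..k} \<union> \<kappa> ` C"
  have W: "finite W" "W \<subseteq> sp.\<Lambda>" "T \<in> W"
    using C(1) \<eta> \<Lambda>_sub sp.\<kappa>_\<Lambda> by (auto simp: W_def T_def)
  have notin: "\<kappa> b \<notin> field_gen W" if "b \<in> B" for b
  proof
    let ?R = "\<iota> ` fps_over L"
    have R: "ring_closed ?R"
      using ring_closed_fps_over[OF L] unfolding ring_closed_def
      by (auto simp flip: is_hom_add[OF \<iota>(1)] is_hom_mult[OF \<iota>(1)] is_hom_uminus[OF \<iota>(1)])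
         (metis image_eqI is_hom_0[OF \<iota>(1)] is_hom_1[OF \<iota>(1)])+
    have mem: "x \<in> {a / b |a b. a \<in> ?R \<and> b \<in> ?R \<and> b \<noteq> 0}" if "x \<in> ?R" for x
      using that rc_1[OF R] by (intro CollectI exI[of _ x] exI[of _ 1]) auto
    have "W \<subseteq> {a / b |a b. a \<in> ?R \<and> b \<in> ?R \<and> b \<noteq> 0}"
    proof
      fix x assume "x \<in> W"
      then have "x \<in> ?R" using \<eta> C(2) by (auto simp: W_def \<kappa>_def fps_const_over[OF L])
      then show "x \<in> {a / b |a b. a \<in> ?R \<and> b \<in> ?R \<and> b \<noteq> 0}" by (rule mem)
    qed
    then have "field_gen W \<subseteq> {a / b |a b. a \<in> ?R \<and> b \<in> ?R \<and> b \<noteq> 0}"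
      by (intro field_gen_least fractions_in_Sub R)
    moreover assume "\<kappa> b \<in> field_gen W"
    ultimately obtain p q where pq: "p \<in> fps_over L" "q \<in> fps_over L" "\<kappa> b = \<iota> p / \<iota> q" by blast
    have "b \<notin> L" using that B(2) by blast
    then have "b \<noteq> 0" using Sub_0[OF L] by blast
    then have "\<kappa> b \<noteq> 0" using is_hom_eq_0[OF \<kappa>] by simp
    then have q0: "q \<noteq> 0" using pq(3) is_hom_0[OF \<iota>(1)] by auto
    then have "\<iota> (fps_const b * q) = \<iota> p"
      using pq(3) \<iota>0 by (simp add: is_hom_mult[OF \<iota>(1)] \<kappa>_def field_simps)
    then have eq: "fps_const b * q = p" using \<iota>(2) by (simp add: inj_eq)
    \<comment> \<open>Comparing coefficients in b q = p where \<open>q\<close> has a nonzero one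
      writes \<open>b\<close> as a quotient of elements of \<open>L\<close>.\<close>
    obtain n where n: "fps_nth q n \<noteq> 0" using q0 by (auto simp: fps_eq_iff)
    have "b * fps_nth q n = fps_nth p n" using arg_cong[OF eq, of "\<lambda>f. fps_nth f n"] by simp
    then have "b = fps_nth p n / fps_nth q n" using n by (simp add: field_simps)
    then have "b \<in> L" using pq Sub_divide[OF L] by (simp add: fps_over_def)
    then show False using \<open>b \<notin> L\<close> by blast
  qed
  have "\<exists>A F. sp.spec_ring A \<and> (\<forall>x\<in>W. F x \<in> A \<and> F x None = x) \<and>
    (\<forall>\<^sub>F z in nonthin. \<forall>b\<in>B. \<kappa> b \<notin> field_gen ((\<lambda>x. F x (Some z)) ` W))"
    by (rule sp.specialise_avoiding[OF W B(1) notin])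
  then obtain A F where A: "sp.spec_ring A" and F: "\<forall>x\<in>W. F x \<in> A \<and> F x None = x"
    and avoid: "\<forall>\<^sub>F z in nonthin. \<forall>b\<in>B. \<kappa> b \<notin> field_gen ((\<lambda>x. F x (Some z)) ` W)"
    by (elim exE conjE)
  note rc = sp.spec_ringD(1)[OF A]
  define y where "y i = F (\<iota> (\<eta> i))" for i
  have y: "y i \<in> A" "y i None = \<iota> (\<eta> i)" if "i \<le> k" for i
    using F that by (auto simp: y_def W_def)
  have "\<forall>\<^sub>F z in cofinite. \<forall>t\<in>atoms \<phi>. tval \<xi> t = 0 \<longleftrightarrow> tev \<kappa> (\<lambda>i. y i (Some z)) t = 0"
  proof (rule eventually_ball_finite[OF finite_atoms], rule ballI)
    fix t assume t: "t \<in> atoms \<phi>"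
    define f where "f = tev (\<lambda>a _. \<kappa> a) y t"
    have f_at: "f i = tev \<kappa> (\<lambda>j. y j i) t" for i by (simp add: f_def tev_fun_apply)
    have fA: "f \<in> A" unfolding f_def
      using y(1) sp.spec_ringD(2)[OF A] atoms_vars[OF t] \<phi>(2) by (intro tev_in_ring[OF rc]) auto
    have "f None = tev \<kappa> (\<lambda>j. \<iota> (\<eta> j)) t"
      unfolding f_at using y(2) atoms_vars[OF t] \<phi>(2) by (intro tev_cong) auto
    also have "\<dots> = \<iota> (tev fps_const \<eta> t)" unfolding is_hom_tev[OF \<iota>(1)] \<kappa>_def ..
    finally have fN: "f None = 0 \<longleftrightarrow> tval \<xi> t = 0" using \<eta>_atoms[OF t] \<iota>0 by simp
    show "\<forall>\<^sub>F z in cofinite. tval \<xi> t = 0 \<longleftrightarrow> tev \<kappa> (\<lambda>i. y i (Some z)) t = 0"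
    proof (cases "f None = 0")
      case True
      then have "\<forall>\<^sub>F z in cofinite. f (Some z) = 0" by (rule sp.spec_ringD(6)[OF A fA])
      then show ?thesis by (rule eventually_mono) (use True fN in \<open>simp add: f_at\<close>)
    next
      case False
      then have "\<forall>\<^sub>F z in cofinite. f (Some z) \<noteq> 0" by (rule sp.spec_nonzero[OF A fA])
      then show ?thesis by (rule eventually_mono) (use False fN in \<open>simp add: f_at\<close>)
    qed
  qed
  \<comment> \<open>\<open>y 0\<close> and \<open>sp.T_at\<close> have the same generic value
    \<open>T\<close>, hence agree at almost all z.\<close>
  moreover have "\<forall>\<^sub>F z in cofinite. y 0 (Some z) = of_rat z"
  proof -
    have "sp.T_at None = T" by (simp add: sp.T_at_def)
    then have "y 0 None = sp.T_at None" using y(2)[OF le0] unfolding T_def[symmetric] by simp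
    then have "\<forall>\<^sub>F z in cofinite. y 0 (Some z) = sp.T_at (Some z)"
      by (rule sp.spec_eq[OF A y(1)[OF le0] sp.spec_ringD(3)[OF A]])
    then show ?thesis by (simp add: sp.T_at_def)
  qed
  moreover have "\<forall>\<^sub>F z in cofinite. \<forall>c\<in>C. F (\<kappa> c) (Some z) = \<kappa> c"
  proof (rule eventually_ball_finite[OF C(1)], rule ballI)
    fix c assume "c \<in> C"
    then have "F (\<kappa> c) \<in> A" "F (\<kappa> c) None = \<kappa> c" using F by (auto simp: W_def)
    then show "\<forall>\<^sub>F z in cofinite. F (\<kappa> c) (Some z) = \<kappa> c"
      using sp.spec_eq[OF A _ sp.spec_ringD(2)[OF A], of "F (\<kappa> c)" c] by simp
  qed
  ultimately have "\<forall>\<^sub>F z in cofinite. (\<forall>t\<in>atoms \<phi>. tval \<xi> t = 0 \<longleftrightarrow> tev \<kappa> (\<lambda>i. y i (Some z)) t = 0) \<and>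
    y 0 (Some z) = of_rat z \<and> (\<forall>c\<in>C. F (\<kappa> c) (Some z) = \<kappa> c)" by (intro eventually_conj)
  then have "\<forall>\<^sub>F z in nonthin. (\<forall>t\<in>atoms \<phi>. tval \<xi> t = 0 \<longleftrightarrow> tev \<kappa> (\<lambda>i. y i (Some z)) t = 0) \<and>
    y 0 (Some z) = of_rat z \<and> (\<forall>c\<in>C. F (\<kappa> c) (Some z) = \<kappa> c)" by (rule filter_leD[OF nonthin_le_cofinite])
  with avoid have "\<forall>\<^sub>F z in nonthin. (\<forall>b\<in>B. \<kappa> b \<notin> field_gen ((\<lambda>x. F x (Some z)) ` W)) \<and>
    (\<forall>t\<in>atoms \<phi>. tval \<xi> t = 0 \<longleftrightarrow> tev \<kappa> (\<lambda>i. y i (Some z)) t = 0) \<and>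
    y 0 (Some z) = of_rat z \<and> (\<forall>c\<in>C. F (\<kappa> c) (Some z) = \<kappa> c)" by (rule eventually_conj)
  from eventually_nonthin_ex[OF this Z] obtain z where z: "z \<in> Z"
    and z_avoid: "\<forall>b\<in>B. \<kappa> b \<notin> field_gen ((\<lambda>x. F x (Some z)) ` W)"
    and z_atoms: "\<forall>t\<in>atoms \<phi>. tval \<xi> t = 0 \<longleftrightarrow> tev \<kappa> (\<lambda>i. y i (Some z)) t = 0"
    and z0: "y 0 (Some z) = of_rat z" and zC: "\<forall>c\<in>C. F (\<kappa> c) (Some z) = \<kappa> c"
    by (elim bexE conjE)
  let ?G = "field_gen ((\<lambda>x. F x (Some z)) ` W)"
  \<comment> \<open>The specialised field is pulled back along \<kappa>, which is possible for the
    coordinates because all specialised values lie in the range of \<kappa>.\<close>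
  define K where "K = {a. \<kappa> a \<in> ?G}"
  define e where "e i = inv_into UNIV \<kappa> (y i (Some z))" for i
  have \<kappa>e: "\<kappa> (e i) = y i (Some z)" if "i \<le> k" for i
    using sp.spec_ringD(5)[OF A y(1)[OF that]] by (simp add: e_def f_inv_into_f)
  have "\<kappa> (e 0) = \<kappa> (of_rat z)" using \<kappa>e[of 0] z0 is_hom_of_rat_eq[OF \<kappa>] by simp
  then have e0: "e 0 = of_rat z" using is_hom_inj[OF \<kappa>] by simp
  have K: "K \<in> Sub"
    unfolding Sub_iff K_def using Sub_closed[OF field_gen_in_Sub]
    by (auto simp: is_hom_simps[OF \<kappa>] is_hom_inverse[OF \<kappa>])
  have yG: "y i (Some z) \<in> ?G" if "i \<le> k" for i
    by (rule subsetD[OF field_gen_superset]) (use that in \<open>auto simp: y_def W_def\<close>)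
  have "F (\<kappa> c) (Some z) \<in> ?G" if "c \<in> C" for c
    by (rule subsetD[OF field_gen_superset]) (use that in \<open>auto simp: W_def\<close>)
  then have CK: "C \<subseteq> K" using zC by (auto simp: K_def)
  have eK: "e i \<in> K" if "i \<le> k" for i using yG[OF that] \<kappa>e[OF that] by (simp add: K_def)
  have BK: "K \<inter> B = {}" using z_avoid by (auto simp: K_def)
  have "sat e \<phi> \<longleftrightarrow> sat \<xi> \<phi>"
  proof (rule sat_eq_atoms)
    fix t assume t: "t \<in> atoms \<phi>"
    have "\<kappa> (tval e t) = tev \<kappa> (\<lambda>i. y i (Some z)) t"
      unfolding is_hom_tval[OF \<kappa>] using \<kappa>e atoms_vars[OF t] \<phi>(2) by (intro tev_cong) auto
    then show "tval e t = 0 \<longleftrightarrow> tval \<xi> t = 0" using z_atoms t is_hom_eq_0[OF \<kappa>] by metis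
  qed
  then have sat_e: "sat e \<phi>" using \<xi> by (simp add: S_def)
  \<comment> \<open>Variable 0 is the solution itself; the witnesses are the values of the variables
    1 to k.\<close>
  define ys where "ys = map e [1..<Suc k]"
  have "(of_rat z # ys) ! i = e i" if "i \<le> k" for i
    using that e0 by (cases i) (auto simp: ys_def simp del: upt_Suc)
  then have "sat (\<lambda>i. (of_rat z # ys) ! i) \<phi> \<longleftrightarrow> sat e \<phi>" using \<phi>(2) by (intro sat_cong) auto
  moreover have "length ys = k" "set ys \<subseteq> K" using eK by (auto simp: ys_def simp del: upt_Suc)
  ultimately have "of_rat z \<in> solutions K k \<phi>"
    unfolding solutions_def using sat_e Sub_of_rat[OF K] by blast
  then show ?thesis using K CK BK z by blast
qed

section \<open>Meagerness\<close>

lemma topspace_Sub_topology: "topspace Sub_topology = Sub"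
  by (auto simp: Sub_topology_def topspace_pullback_topology)

lemma openin_Sub_basic:
  assumes "finite C"
  shows "openin Sub_topology {L \<in> Sub. C \<subseteq> (L :: 'a::field set)}"
proof -
  let ?V = "{f :: 'a \<Rightarrow> bool. \<forall>x\<in>C. f x}"
  have "openin (product_topology (\<lambda>_. discrete_topology (UNIV :: bool set)) UNIV) ?V"
    unfolding openin_product_topology_alt
  proof (intro ballI)
    fix f assume f: "f \<in> ?V"
    let ?U = "\<lambda>i. if i \<in> C then {True} else UNIV"
    have "finite {i \<in> UNIV. ?U i \<noteq> topspace (discrete_topology UNIV)}"
      by (rule finite_subset[OF _ assms]) auto
    moreover have "f \<in> Pi\<^sub>E UNIV ?U" "Pi\<^sub>E UNIV ?U \<subseteq> ?V" using f by (auto split: if_splits)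
    ultimately show "\<exists>U. finite {i \<in> UNIV. U i \<noteq> topspace (discrete_topology UNIV)} \<and>
        (\<forall>i\<in>UNIV. openin (discrete_topology UNIV) (U i)) \<and> f \<in> Pi\<^sub>E UNIV U \<and> Pi\<^sub>E UNIV U \<subseteq> ?V"
      by (intro exI[of _ ?U]) simp
  qed
  moreover have "{L \<in> Sub. C \<subseteq> L} = (\<lambda>L x. x \<in> L) -` ?V \<inter> Sub" by auto
  ultimately show ?thesis unfolding Sub_topology_def openin_pullback_topology by blast
qed

lemma Sub_topology_nbhd:
  assumes "openin Sub_topology N" "L \<in> N"
  shows "\<exists>C B. finite C \<and> finite B \<and> C \<subseteq> L \<and> B \<inter> L = {} \<and>
    (\<forall>K\<in>Sub. C \<subseteq> K \<longrightarrow> K \<inter> B = {} \<longrightarrow> K \<in> N)"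
proof -
  obtain V where V: "openin (product_topology (\<lambda>_. discrete_topology (UNIV :: bool set)) UNIV) V"
    "N = (\<lambda>L x. x \<in> L) -` V \<inter> Sub"
    using assms(1) unfolding Sub_topology_def openin_pullback_topology by blast
  then have "(\<lambda>x. x \<in> L) \<in> V" using assms(2) by auto
  then obtain U where U: "finite {i. U i \<noteq> (UNIV :: bool set)}" "(\<lambda>x. x \<in> L) \<in> Pi\<^sub>E UNIV U" "Pi\<^sub>E UNIV U \<subseteq> V"
    using V(1) unfolding openin_product_topology_alt by fastforce
  \<comment> \<open>The finitely many restricted coordinates: those in \<open>L\<close> become
    required elements, the others forbidden ones.\<close>
  let ?J = "{i. U i \<noteq> UNIV}"
  have "K \<in> N" if K: "K \<in> Sub" "?J \<inter> L \<subseteq> K" "K \<inter> (?J - L) = {}" for K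
  proof -
    have "(\<lambda>x. x \<in> K) \<in> Pi\<^sub>E UNIV U"
    proof (rule PiE_I)
      fix x
      show "(x \<in> K) \<in> U x"
      proof (cases "x \<in> ?J")
        case True
        then have "x \<in> K \<longleftrightarrow> x \<in> L" using K by blast
        then show ?thesis using U(2) by (auto simp: PiE_iff)
      qed simp
    qed simp
    then show "K \<in> N" using U(3) K(1) V(2) by auto
  qed
  then show ?thesis using U(1) by (intro exI[of _ "?J \<inter> L"] exI[of _ "?J - L"]) auto
qed

lemma in_closure_ofD: "x \<in> Abstract_Topology.closure_of Y S \<Longrightarrow> openin Y T \<Longrightarrow> x \<in> T \<Longrightarrow> \<exists>y. y \<in> S \<and> y \<in> T"
  by (auto simp: in_closure_of)

text \<open>A solution with its witnesses persists in every field that contains these finitely many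
  elements, so having no solution in \<open>Z\<close> passes to the closure. If the closure had an
  interior, this would contain a member \<open>L\<close> of the set, and near \<open>L\<close> there
  is a field with a solution in \<open>Z\<close>.\<close>

lemma nowhere_dense_formula:
  fixes Z :: "rat set" and \<phi> :: "rat alg_closure qfform"
  assumes Z: "\<not> thin_in_field Z"
  shows "nowhere_dense_in Sub_topology {L \<in> Sub. set_qfform \<phi> \<subseteq> L \<and> fvars \<phi> \<subseteq> {..k} \<and>
    infinite (solutions L k \<phi>) \<and> (\<forall>z\<in>Z. of_rat z \<notin> solutions L k \<phi>)}"
  (is "nowhere_dense_in _ ?N")
proof -
  have cl: "\<forall>z\<in>Z. of_rat z \<notin> solutions L k \<phi>" if "L \<in> Abstract_Topology.closure_of Sub_topology ?N" for L
  proof (rule ballI, rule notI)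
    fix z assume z: "z \<in> Z" "of_rat z \<in> solutions L k \<phi>"
    then obtain ys where ys: "length ys = k" "set ys \<subseteq> L" "sat (\<lambda>i. (of_rat z # ys) ! i) \<phi>"
      by (auto simp: solutions_def)
    have L: "L \<in> Sub" using that by (simp add: in_closure_of topspace_Sub_topology)
    have "\<exists>K. K \<in> ?N \<and> K \<in> {K \<in> Sub. set ys \<subseteq> K}"
      using that by (rule in_closure_ofD) (use L ys in \<open>auto intro: openin_Sub_basic\<close>)
    then obtain K where K: "K \<in> ?N" "K \<in> {K \<in> Sub. set ys \<subseteq> K}" by (elim exE conjE)
    then have "of_rat z \<in> solutions K k \<phi>" unfolding solutions_def using ys Sub_of_rat by blast
    then show False using K(1) z(1) by blast
  qed
  have "Sub_topology interior_of (Abstract_Topology.closure_of Sub_topology ?N) = {}"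
  proof (rule ccontr)
    let ?I = "Sub_topology interior_of (Abstract_Topology.closure_of Sub_topology ?N)"
    assume "?I \<noteq> {}"
    then obtain L0 where L0: "L0 \<in> ?I" by blast
    have I: "openin Sub_topology ?I" "?I \<subseteq> Abstract_Topology.closure_of Sub_topology ?N"
      by (simp_all add: openin_interior_of interior_of_subset)
    \<comment> \<open>An open set that meets the closure meets the set itself; so \<open>L\<close>
      satisfies the conditions on \<phi> and not merely in the limit.\<close>
    have "L0 \<in> Abstract_Topology.closure_of Sub_topology ?N" using L0 I(2) by (rule subsetD[rotated])
    from in_closure_ofD[OF this I(1) L0] obtain L where L: "L \<in> ?N" "L \<in> ?I" by (elim exE conjE)
    from Sub_topology_nbhd[OF I(1) L(2)] obtain C B
      where CB: "finite C" "finite B" "C \<subseteq> L" "B \<inter> L = {}" "\<forall>K\<in>Sub. C \<subseteq> K \<longrightarrow> K \<inter> B = {} \<longrightarrow> K \<in> ?I"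
      by (elim exE conjE)
    have "\<exists>K\<in>Sub. C \<subseteq> K \<and> K \<inter> B = {} \<and> (\<exists>z\<in>Z. of_rat z \<in> solutions K k \<phi>)"
      using L(1) CB by (intro infinitely_many_solutions_spread[of L] Z) auto
    then obtain K where K: "K \<in> Sub" "C \<subseteq> K" "K \<inter> B = {}" "\<exists>z\<in>Z. of_rat z \<in> solutions K k \<phi>" by blast
    then have "K \<in> ?I" using CB(5) by blast
    then have "K \<in> Abstract_Topology.closure_of Sub_topology ?N" using I(2) by (rule subsetD[rotated])
    then show False using cl K(4) by blast
  qed
  moreover have "?N \<subseteq> topspace Sub_topology" by (auto simp: topspace_Sub_topology)
  ultimately show ?thesis unfolding nowhere_dense_in_def by blast
qed

section \<open>Countability of the formulas and conclusion\<close>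

instance rterm :: (countable) countable by countable_datatype
instance qfform :: (countable) countable by countable_datatype

lemma countable_rat_alg_closure: "countable (UNIV :: rat alg_closure set)"
proof -
  have "UNIV \<subseteq> (\<Union>xs :: rat list. {x :: rat alg_closure. Poly xs \<noteq> 0 \<and> poly (map_poly to_ac (Poly xs)) x = 0})"
  proof
    fix x :: "rat alg_closure"
    obtain p :: "rat poly" where "p \<noteq> 0" "poly (map_poly to_ac p) x = 0" by (rule alg_closure_algebraic)
    then show "x \<in> (\<Union>xs :: rat list. {x :: rat alg_closure. Poly xs \<noteq> 0 \<and> poly (map_poly to_ac (Poly xs)) x = 0})"
      by (intro UN_I[of "coeffs p"]) auto
  qed
  moreover have "countable {x :: rat alg_closure. p \<noteq> 0 \<and> poly (map_poly to_ac p) x = 0}" for p :: "rat poly"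
  proof (cases "p = 0")
    case False
    then have "map_poly to_ac p \<noteq> (0 :: rat alg_closure poly)" by (auto simp: poly_eq_iff coeff_map_poly)
    then have "finite {x. poly (map_poly to_ac p) x = (0 :: rat alg_closure)}" by (rule poly_roots_finite)
    then show ?thesis using False by (simp add: countable_finite)
  qed simp
  then have "countable (\<Union>xs :: rat list. {x :: rat alg_closure. Poly xs \<noteq> 0 \<and> poly (map_poly to_ac (Poly xs)) x = 0})"
    by (intro countable_UN countableI_type)
  ultimately show ?thesis by (rule countable_subset)
qed

text \<open>Numbering the parameters is injective on formulas and leads to formulas over the natural
  numbers, which form a countable datatype.\<close>

lemma countable_formulas: "countable (UNIV :: rat alg_closure qfform set)"
proof -
  have "inj (map_qfform (to_nat_on (UNIV :: rat alg_closure set)))"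
    using inj_on_to_nat_on[OF countable_rat_alg_closure] by (rule qfform.inj_map)
  then show ?thesis by (rule countableI'[of _ "UNIV :: rat alg_closure qfform set", OF inj_compose[OF inj_to_nat]])
qed

lemma universally_definable_solutions:
  assumes "C \<subseteq> L"
  shows "universally_definable_in L C \<longleftrightarrow>
    (\<exists>\<phi> k. set_qfform \<phi> \<subseteq> L \<and> fvars \<phi> \<subseteq> {..k} \<and> C = L - solutions L k (Neg \<phi>))"
  unfolding universally_definable_in_def solutions_def by (intro ex_cong1 conj_cong refl) auto

theorem theorem1p2:
  fixes Z :: "rat set"
  assumes "\<not> thin_in_field Z"
  shows "meager_in Sub_topology (S_set Z) \<and>
    S_set Z = {L \<in> Sub. \<exists>C\<subseteq>L. infinite (L - C) \<and> universally_definable_in L C \<and> C \<inter> \<rat> = of_rat ` Z}"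
proof
  have eq: "S_set Z = {L \<in> Sub. \<exists>C\<subseteq>L. infinite (L - C) \<and> universally_definable_in L C \<and> C \<inter> \<rat> = of_rat ` Z}"
    (is "_ = ?R")
  proof
    show "S_set Z \<subseteq> ?R"
    proof
      fix L assume "L \<in> S_set Z"
      then obtain A where A: "A \<inter> \<rat> = of_rat ` Z" "L \<in> Sub" "infinite (L - (A \<inter> L))"
        "universally_definable_in L (A \<inter> L)"
        by (auto simp: S_set_def)
      have "(A \<inter> L) \<inter> \<rat> = of_rat ` Z" using A(1) Rats_subset_Sub[OF A(2)] by blast
      then show "L \<in> ?R" using A by (intro CollectI conjI exI[of _ "A \<inter> L"]) auto
    qed
    show "?R \<subseteq> S_set Z"
    proof
      fix L assume "L \<in> ?R"
      then obtain C where C: "L \<in> Sub" "C \<subseteq> L" "infinite (L - C)" "universally_definable_in L C" "C \<inter> \<rat> = of_rat ` Z"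
        by blast
      then have "C \<inter> L = C" by blast
      then show "L \<in> S_set Z" unfolding S_set_def using C by (intro UN_I[of C]) auto
    qed
  qed
  show "S_set Z = ?R" by (rule eq)
  \<comment> \<open>\<open>meager_in\<close> asks for a union equal to the set, hence the
    intersection with \<open>S_set Z\<close>; subsets of nowhere dense sets are nowhere
    dense.\<close>
  define N where "N = (\<lambda>(\<phi>, k). S_set Z \<inter> {L \<in> Sub. set_qfform (Neg \<phi>) \<subseteq> L \<and> fvars (Neg \<phi>) \<subseteq> {..k} \<and>
    infinite (solutions L k (Neg \<phi>)) \<and> (\<forall>z\<in>Z. of_rat z \<notin> solutions L k (Neg \<phi>))})"
  have "countable (range N)"
    by (rule countable_image) (use countable_formulas in \<open>simp flip: UNIV_Times_UNIV\<close>)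
  moreover have "\<forall>M\<in>range N. nowhere_dense_in Sub_topology M"
  proof
    fix M assume "M \<in> range N"
    then obtain \<phi> k where M: "M = N (\<phi>, k)" by auto
    let ?M = "{L \<in> Sub. set_qfform (Neg \<phi>) \<subseteq> L \<and> fvars (Neg \<phi>) \<subseteq> {..k} \<and>
      infinite (solutions L k (Neg \<phi>)) \<and> (\<forall>z\<in>Z. of_rat z \<notin> solutions L k (Neg \<phi>))}"
    have "M \<subseteq> ?M" by (auto simp: M N_def)
    then have "Sub_topology interior_of (Abstract_Topology.closure_of Sub_topology M)
        \<subseteq> Sub_topology interior_of (Abstract_Topology.closure_of Sub_topology ?M)"
      by (intro interior_of_mono closure_of_mono)
    then show "nowhere_dense_in Sub_topology M"
      using nowhere_dense_formula[OF assms, of "Neg \<phi>" k] \<open>M \<subseteq> ?M\<close>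
      unfolding nowhere_dense_in_def by blast
  qed
  moreover have "S_set Z = \<Union>(range N)"
  proof
    show "\<Union>(range N) \<subseteq> S_set Z" by (auto simp: N_def)
    show "S_set Z \<subseteq> \<Union>(range N)"
    proof
      fix L assume L: "L \<in> S_set Z"
      then obtain C where C: "L \<in> Sub" "C \<subseteq> L" "infinite (L - C)" "universally_definable_in L C" "C \<inter> \<rat> = of_rat ` Z"
        unfolding eq by blast
      then obtain \<phi> k where \<phi>: "set_qfform \<phi> \<subseteq> L" "fvars \<phi> \<subseteq> {..k}" "C = L - solutions L k (Neg \<phi>)"
        unfolding universally_definable_solutions[OF C(2)] by blast
      have "solutions L k (Neg \<phi>) \<subseteq> L" by (auto simp: solutions_def)
      then have "L - C = solutions L k (Neg \<phi>)" using \<phi>(3) by blast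
      then have "infinite (solutions L k (Neg \<phi>))" using C(3) by simp
      moreover have "of_rat z \<notin> solutions L k (Neg \<phi>)" if "z \<in> Z" for z
      proof -
        have "of_rat z \<in> C" using C(5) that by blast
        then show ?thesis using \<phi>(3) by blast
      qed
      ultimately have "L \<in> N (\<phi>, k)" using L C(1) \<phi> by (simp add: N_def)
      then show "L \<in> \<Union>(range N)" by blast
    qed
  qed
  ultimately show "meager_in Sub_topology (S_set Z)" unfolding meager_in_def by (intro exI[of _ "range N"] conjI)
qed

end
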